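(* Let $X$ be an infinite dimensional Banach space. If $X$ coarsely embeds into Tsirelson's original space $T^*$, or if the unit ball $B_X$ of $X$ uniformly embeds into $T^*$, then $X$ is reflexive and all spreading models of $X$ are isomorphic to $c_0$.
   Context: All Banach spaces are real. $c_0$ is the space of real sequences converging to $0$ with the sup-norm; $c_{00}$ is the space of finitely supported real sequences, with unit vectors $(e_i)_{i\ge1}$. $B_X$ is the closed unit ball of $X$ with the norm metric. **Embeddings.** For a map $f:(X,d_X)\to(Y,d_Y)$ between metric spaces put $\rho_f(t)=\inf\{d_Y(f(x),f(y)): d_X(x,y)\ge t\}$ and $\omega_f(t)=\sup\{d_Y(f(x),f(y)): d_X(x,y)\le t\}$, with $\inf\emptyset=+\infty$, $\sup\emptyset=0$. $f$ is a coarse embedding if $\lim_{t\to\infty}\rho_f(t)=\infty$ and $\omega_f(t)<\infty$ for all $t>0$; $f$ is a uniform embedding if $\lim_{t\to0}\omega_f(t)=0$ and $\rho_f(t)>0$ for all $t>0$. $X$ coarsely (uniformly) embeds into $Y$ if such an $f$ exists. **Spreading models.** Let $(x_n)$ be a bounded sequence in a Banach space $X$ without norm-convergent subsequence. It has a subsequence $(y_n)$ such that for all $k\ge1$ and $a_1,\dots,a_k\in\mathbb R$ the limit $N(a_1,\dots,a_k)=\lim_{n_1<\dots<n_k\to\infty}\|a_1y_{n_1}+\dots+a_ky_{n_k}\|$ exists (meaning: for every $\varepsilon>0$ there is $r$ such that $\big|\|\sum_{i=1}^k a_iy_{n_i}\|-N(a_1,\dots,a_k)\big|<\varepsilon$ whenever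 $r\le n_1<\dots<n_k$). Then $\|\sum_{i=1}^k a_ie_i\|_E:=N(a_1,\dots,a_k)$ is a norm on $c_{00}$, and its completion $E$ is called a spreading model of $X$ generated by $(x_n)$. **Tsirelson's space.** For finite sets $E,F\subset\mathbb N=\{1,2,\dots\}$ write $E<F$ if $\max E<\min F$, and $n\le E$ if $n\le\min E$. A finite sequence $(E_j)_{j=1}^n$ of nonempty finite subsets of $\mathbb N$ is admissible if $n\le E_1<E_2<\dots<E_n$. For $x=\sum_j\xi_je_j\in c_{00}$ let $E(x)=\sum_{j\in E}\xi_je_j$. Define norms on $c_{00}$ by $\|x\|_0=\max_j|\xi_j|$ and, for $k\ge1$, $\|x\|_k=\max\big(\|x\|_{k-1},\tfrac12\max\{\sum_{j=1}^n\|E_j(x)\|_{k-1}: (E_j)_{j=1}^n\text{ admissible}\}\big)$, and $\|x\|=\lim_k\|x\|_k$. $T$ is the completion of $(c_{00},\|\cdot\|)$ and $T^*$ (Tsirelson's original space) is its dual. *)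

theory Defs
  imports "HOL-Analysis.Analysis"
begin

section \<open>Coarse and uniform embeddings\<close>

text \<open>With values in \<^typ>\<open>ennreal\<close> the conventions for the empty set are automatic:
  the infimum of the empty set is \<open>\<infinity>\<close> and its supremum is \<open>0\<close>.
  The domain is the metric subspace \<open>S\<close>.\<close>

definition compression_modulus ::
    "'a::metric_space set \<Rightarrow> ('a \<Rightarrow> 'b::metric_space) \<Rightarrow> real \<Rightarrow> ennreal" where
  "compression_modulus S f t =
     Inf {ennreal (dist (f x) (f y)) | x y. x \<in> S \<and> y \<in> S \<and> dist x y \<ge> t}"

definition expansion_modulus ::
    "'a::metric_space set \<Rightarrow> ('a \<Rightarrow> 'b::metric_space) \<Rightarrow> real \<Rightarrow> ennreal" where
  "expansion_modulus S f t =
     Sup {ennreal (dist (f x) (f y)) | x y. x \<in> S \<and> y \<in> S \<and> dist x y \<le> t}"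

definition coarse_embedding_on ::
    "'a::metric_space set \<Rightarrow> ('a \<Rightarrow> 'b::metric_space) \<Rightarrow> bool" where
  "coarse_embedding_on S f \<longleftrightarrow>
     (compression_modulus S f \<longlongrightarrow> \<infinity>) at_top \<and>
     (\<forall>t>0. expansion_modulus S f t < \<infinity>)"

definition uniform_embedding_on ::
    "'a::metric_space set \<Rightarrow> ('a \<Rightarrow> 'b::metric_space) \<Rightarrow> bool" where
  "uniform_embedding_on S f \<longleftrightarrow>
     (expansion_modulus S f \<longlongrightarrow> 0) (at_right 0) \<and>
     (\<forall>t>0. compression_modulus S f t > 0)"


section \<open>Notions from Banach space theory\<close>

definition infinite_dimensional :: "'a::real_vector itself \<Rightarrow> bool" where
  "infinite_dimensional _ \<longleftrightarrow> \<not> (\<exists>B::'a set. finite B \<and> span B = UNIV)"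

lift_definition bidual_embedding ::
    "'a::real_normed_vector \<Rightarrow> (('a \<Rightarrow>\<^sub>L real) \<Rightarrow>\<^sub>L real)" is
  "\<lambda>x f. blinfun_apply f x"
  by (rule blinfun.bounded_linear_left)

definition reflexive_space :: "'a::real_normed_vector itself \<Rightarrow> bool" where
  "reflexive_space _ \<longleftrightarrow>
     surj (bidual_embedding :: 'a \<Rightarrow> (('a \<Rightarrow>\<^sub>L real) \<Rightarrow>\<^sub>L real))"

text \<open>Linear isomorphism of two linear subspaces, each with its inherited norm.\<close>

definition isomorphic_normed_subspaces ::
    "'a::real_normed_vector set \<Rightarrow> 'b::real_normed_vector set \<Rightarrow> bool" where
  "isomorphic_normed_subspaces S T \<longleftrightarrow> subspace S \<and> subspace T \<and>
     (\<exists>f. (\<forall>x\<in>S. \<forall>y\<in>S. f (x + y) = f x + f y) \<and>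
          (\<forall>c. \<forall>x\<in>S. f (c *\<^sub>R x) = c *\<^sub>R f x) \<and>
          f ` S = T \<and>
          (\<exists>m>0. \<exists>M. \<forall>x\<in>S. m * norm x \<le> norm (f x) \<and> norm (f x) \<le> M * norm x))"

text \<open>Since \<^typ>\<open>nat\<close> is discrete, the ambient type is the space of all bounded real sequences with
  the sup-norm.\<close>

definition c0 :: "(nat \<Rightarrow>\<^sub>C real) set" where
  "c0 = {f. apply_bcontfun f \<longlonglongrightarrow> 0}"


section \<open>Spreading models\<close>

text \<open>The list \<open>[a\<^sub>1, \<dots>, a\<^sub>k]\<close> of coefficients is the argument of the limit functional \<open>N\<close>;
  indices are shifted to start from \<open>0\<close>.\<close>

definition asymptotic_norm :: "(nat \<Rightarrow> 'a::real_normed_vector) \<Rightarrow> (real list \<Rightarrow> real) \<Rightarrow> bool" where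
  "asymptotic_norm y N \<longleftrightarrow>
     (\<forall>a. \<forall>\<epsilon>>0. \<exists>r. \<forall>n::nat \<Rightarrow> nat.
        strict_mono_on {..<length a} n \<and> (\<forall>i<length a. r \<le> n i) \<longrightarrow>
        \<bar>norm (\<Sum>i<length a. (a ! i) *\<^sub>R y (n i)) - N a\<bar> < \<epsilon>)"

text \<open>\<open>E\<close> is a completion of the space of finitely supported sequences under the norm \<open>N\<close>: it is a
  closed subspace of some Banach space, and \<open>\<Sum> a\<^sub>i e\<^sub>i\<close> ranges over an isometric copy of that space
  which is dense in \<open>E\<close>. Every completion arises up to isometry in this way, for instance inside
  the space of bounded sequences, because it is separable.\<close>

definition finite_sequence_completion :: "(real list \<Rightarrow> real) \<Rightarrow> 'e::banach set \<Rightarrow> bool" where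
  "finite_sequence_completion N E \<longleftrightarrow>
     (\<exists>e::nat \<Rightarrow> 'e. (\<forall>a. norm (\<Sum>i<length a. (a ! i) *\<^sub>R e i) = N a) \<and>
        E = closure (span (range e)))"

definition spreading_model_generated_by ::
    "(nat \<Rightarrow> 'a::real_normed_vector) \<Rightarrow> 'e::banach set \<Rightarrow> bool" where
  "spreading_model_generated_by x E \<longleftrightarrow>
     (\<exists>\<sigma> N. strict_mono \<sigma> \<and> asymptotic_norm (x \<circ> \<sigma>) N \<and> finite_sequence_completion N E)"

definition spreading_model_of :: "'a::real_normed_vector itself \<Rightarrow> 'e::banach set \<Rightarrow> bool" where
  "spreading_model_of _ E \<longleftrightarrow>
     (\<exists>x::nat \<Rightarrow> 'a. bounded (range x) \<and>
        \<not> (\<exists>\<sigma>. strict_mono \<sigma> \<and> convergent (x \<circ> \<sigma>)) \<and>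
        spreading_model_generated_by x E)"


section \<open>Completion of a normed space\<close>

quotient_type (overloaded) 'a completion =
  "nat \<Rightarrow> 'a::real_normed_vector" /
  partial: "\<lambda>X Y. Cauchy X \<and> Cauchy Y \<and> (\<lambda>n. X n - Y n) \<longlonglongrightarrow> 0"
proof (rule part_equivpI)
  show "\<exists>X::nat \<Rightarrow> 'a. Cauchy X \<and> Cauchy X \<and> (\<lambda>n. X n - X n) \<longlonglongrightarrow> 0"
    by (rule exI[of _ "\<lambda>_. 0"]) (simp add: Cauchy_def)
  show "symp (\<lambda>X Y::nat \<Rightarrow> 'a. Cauchy X \<and> Cauchy Y \<and> (\<lambda>n. X n - Y n) \<longlonglongrightarrow> 0)"
    by (rule sympI) (use tendsto_minus in fastforce)
  show "transp (\<lambda>X Y::nat \<Rightarrow> 'a. Cauchy X \<and> Cauchy Y \<and> (\<lambda>n. X n - Y n) \<longlonglongrightarrow> 0)"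
  proof (rule transpI)
    fix X Y Z :: "nat \<Rightarrow> 'a"
    assume XY: "Cauchy X \<and> Cauchy Y \<and> (\<lambda>n. X n - Y n) \<longlonglongrightarrow> 0"
      and YZ: "Cauchy Y \<and> Cauchy Z \<and> (\<lambda>n. Y n - Z n) \<longlonglongrightarrow> 0"
    then have "(\<lambda>n. (X n - Y n) + (Y n - Z n)) \<longlonglongrightarrow> 0 + 0"
      by (intro tendsto_add) auto
    then show "Cauchy X \<and> Cauchy Z \<and> (\<lambda>n. X n - Z n) \<longlonglongrightarrow> 0"
      using XY YZ by simp
  qed
qed

lemma Cauchy_add_seq:
  fixes X Y :: "nat \<Rightarrow> 'a::real_normed_vector"
  assumes "Cauchy X" "Cauchy Y"
  shows "Cauchy (\<lambda>n. X n + Y n)"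
proof (rule metric_CauchyI)
  fix e :: real assume "e > 0"
  then obtain M N where M: "\<And>m n. m \<ge> M \<Longrightarrow> n \<ge> M \<Longrightarrow> dist (X m) (X n) < e / 2"
    and N: "\<And>m n. m \<ge> N \<Longrightarrow> n \<ge> N \<Longrightarrow> dist (Y m) (Y n) < e / 2"
    using assms by (metis half_gt_zero metric_CauchyD)
  have "dist (X m + Y m) (X n + Y n) < e" if "m \<ge> max M N" "n \<ge> max M N" for m n
    using M[of m n] N[of m n] that dist_triangle_add[of "X m" "Y m" "X n" "Y n"] by simp
  then show "\<exists>M. \<forall>m\<ge>M. \<forall>n\<ge>M. dist (X m + Y m) (X n + Y n) < e" by blast
qed

lemma Cauchy_scaleR_seq:
  fixes X :: "nat \<Rightarrow> 'a::real_normed_vector"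
  assumes "Cauchy X"
  shows "Cauchy (\<lambda>n. c *\<^sub>R X n)"
  by (rule bounded_linear.Cauchy[OF bounded_linear_scaleR_right assms])

lemma Cauchy_norm_convergent:
  fixes X :: "nat \<Rightarrow> 'a::real_normed_vector"
  assumes "Cauchy X"
  shows "convergent (\<lambda>n. norm (X n))"
proof -
  have "Cauchy (\<lambda>n. norm (X n))"
    unfolding Cauchy_iff
  proof (intro allI impI)
    fix e :: real assume "e > 0"
    then obtain M where "\<forall>m\<ge>M. \<forall>n\<ge>M. norm (X m - X n) < e"
      using assms unfolding Cauchy_iff by blast
    moreover have "norm (norm (X m) - norm (X n)) \<le> norm (X m - X n)" for m n
      using norm_triangle_ineq3[of "X m" "X n"] by simp
    ultimately show "\<exists>M. \<forall>m\<ge>M. \<forall>n\<ge>M. norm (norm (X m) - norm (X n)) < e"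
      by (meson order_le_less_trans)
  qed
  then show ?thesis by (rule Cauchy_convergent)
qed

instantiation completion :: (real_normed_vector) real_vector
begin

lift_definition zero_completion :: "'a completion" is "\<lambda>_. 0"
  by (simp add: Cauchy_def)

lift_definition plus_completion :: "'a completion \<Rightarrow> 'a completion \<Rightarrow> 'a completion"
  is "\<lambda>X Y n. X n + Y n"
proof (intro conjI)
  fix X X' Y Y' :: "nat \<Rightarrow> 'a"
  assume a: "Cauchy X \<and> Cauchy X' \<and> (\<lambda>n. X n - X' n) \<longlonglongrightarrow> 0"
    and b: "Cauchy Y \<and> Cauchy Y' \<and> (\<lambda>n. Y n - Y' n) \<longlonglongrightarrow> 0"
  show "Cauchy (\<lambda>n. X n + Y n)" "Cauchy (\<lambda>n. X' n + Y' n)"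
    using a b by (auto intro: Cauchy_add_seq)
  have "(\<lambda>n. (X n - X' n) + (Y n - Y' n)) \<longlonglongrightarrow> 0 + 0"
    using a b by (intro tendsto_add) auto
  then show "(\<lambda>n. X n + Y n - (X' n + Y' n)) \<longlonglongrightarrow> 0"
    by (simp add: algebra_simps)
qed

lift_definition scaleR_completion :: "real \<Rightarrow> 'a completion \<Rightarrow> 'a completion"
  is "\<lambda>c X n. c *\<^sub>R X n"
proof (intro conjI)
  fix c and X Y :: "nat \<Rightarrow> 'a"
  assume a: "Cauchy X \<and> Cauchy Y \<and> (\<lambda>n. X n - Y n) \<longlonglongrightarrow> 0"
  show "Cauchy (\<lambda>n. c *\<^sub>R X n)" "Cauchy (\<lambda>n. c *\<^sub>R Y n)"
    using a by (auto intro: Cauchy_scaleR_seq)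
  have "(\<lambda>n. c *\<^sub>R (X n - Y n)) \<longlonglongrightarrow> c *\<^sub>R 0"
    using a by (intro tendsto_scaleR) auto
  then show "(\<lambda>n. c *\<^sub>R X n - c *\<^sub>R Y n) \<longlonglongrightarrow> 0"
    by (simp add: algebra_simps)
qed

definition uminus_completion :: "'a completion \<Rightarrow> 'a completion" where
  "uminus_completion x = (-1) *\<^sub>R x"

definition minus_completion :: "'a completion \<Rightarrow> 'a completion \<Rightarrow> 'a completion" where
  "minus_completion x y = x + (- y)"

instance
proof
  fix a b c :: "'a completion" and r s :: real
  show "a + b + c = a + (b + c)"
    by transfer (auto intro!: Cauchy_add_seq simp: algebra_simps)
  show "a + b = b + a"
    by transfer (auto intro!: Cauchy_add_seq simp: algebra_simps)
  show "0 + a = a"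
    by transfer auto
  show "- a + a = 0"
    unfolding uminus_completion_def
    by transfer (auto simp: Cauchy_def)
  show "a - b = a + - b"
    by (simp add: minus_completion_def)
  show "r *\<^sub>R (a + b) = r *\<^sub>R a + r *\<^sub>R b"
    by transfer (auto intro!: Cauchy_add_seq Cauchy_scaleR_seq simp: algebra_simps)
  show "(r + s) *\<^sub>R a = r *\<^sub>R a + s *\<^sub>R a"
    by transfer (auto intro!: Cauchy_add_seq Cauchy_scaleR_seq simp: algebra_simps)
  show "r *\<^sub>R s *\<^sub>R a = (r * s) *\<^sub>R a"
    by transfer (auto intro!: Cauchy_scaleR_seq)
  show "1 *\<^sub>R a = a"
    by transfer auto
qed

end

instantiation completion :: (real_normed_vector) real_normed_vector
begin

lift_definition norm_completion :: "'a completion \<Rightarrow> real" is "\<lambda>X. lim (\<lambda>n. norm (X n))"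
proof -
  fix X Y :: "nat \<Rightarrow> 'a"
  assume a: "Cauchy X \<and> Cauchy Y \<and> (\<lambda>n. X n - Y n) \<longlonglongrightarrow> 0"
  have d: "(\<lambda>n. norm (X n) - norm (Y n)) \<longlonglongrightarrow> 0"
  proof (rule Lim_null_comparison)
    show "\<forall>\<^sub>F n in sequentially. norm (norm (X n) - norm (Y n)) \<le> norm (X n - Y n)"
      by (simp add: norm_triangle_ineq3)
    show "(\<lambda>n. norm (X n - Y n)) \<longlonglongrightarrow> 0"
      using a by (simp add: tendsto_norm_zero)
  qed
  obtain l where l: "(\<lambda>n. norm (Y n)) \<longlonglongrightarrow> l"
    using a Cauchy_norm_convergent convergent_def by blast
  have "(\<lambda>n. (norm (X n) - norm (Y n)) + norm (Y n)) \<longlonglongrightarrow> 0 + l"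
    by (rule tendsto_add[OF d l])
  then have "(\<lambda>n. norm (X n)) \<longlonglongrightarrow> l" by simp
  then show "lim (\<lambda>n. norm (X n)) = lim (\<lambda>n. norm (Y n))"
    using l by (simp add: limI)
qed

definition sgn_completion :: "'a completion \<Rightarrow> 'a completion" where
  "sgn_completion x = x /\<^sub>R norm x"

definition dist_completion :: "'a completion \<Rightarrow> 'a completion \<Rightarrow> real" where
  "dist_completion x y = norm (x - y)"

definition uniformity_completion :: "('a completion \<times> 'a completion) filter" where
  "uniformity_completion = (INF e\<in>{0 <..}. principal {(x, y). dist x y < e})"

definition open_completion :: "'a completion set \<Rightarrow> bool" where
  "open_completion U \<longleftrightarrow> (\<forall>x\<in>U. eventually (\<lambda>(x', y). x' = x \<longrightarrow> y \<in> U) uniformity)"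

instance
proof
  fix x y :: "'a completion" and c :: real and U :: "'a completion set"
  show "dist x y = norm (x - y)" by (rule dist_completion_def)
  show "sgn x = x /\<^sub>R norm x" by (rule sgn_completion_def)
  show "uniformity = (INF e\<in>{0 <..}. principal {(x::'a completion, y). dist x y < e})"
    by (rule uniformity_completion_def)
  show "open U = (\<forall>x\<in>U. \<forall>\<^sub>F (x', y) in uniformity. x' = x \<longrightarrow> y \<in> U)"
    by (rule open_completion_def)
  show "(norm x = 0) = (x = 0)"
  proof transfer
    fix X :: "nat \<Rightarrow> 'a"
    assume a: "Cauchy X \<and> Cauchy X \<and> (\<lambda>n. X n - X n) \<longlonglongrightarrow> 0"
    then have l: "(\<lambda>n. norm (X n)) \<longlonglongrightarrow> lim (\<lambda>n. norm (X n))"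
      using Cauchy_norm_convergent convergent_LIMSEQ_iff by blast
    have "(lim (\<lambda>n. norm (X n)) = 0) \<longleftrightarrow> X \<longlonglongrightarrow> 0"
      using l LIMSEQ_unique tendsto_norm_zero_iff by metis
    then show "(lim (\<lambda>n. norm (X n)) = 0) =
        (Cauchy X \<and> Cauchy (\<lambda>_. 0::'a) \<and> (\<lambda>n. X n - 0) \<longlonglongrightarrow> 0)"
      using a by (simp add: Cauchy_def[of "\<lambda>_. 0::'a"])
  qed
  show "norm (x + y) \<le> norm x + norm y"
  proof transfer
    fix X Y :: "nat \<Rightarrow> 'a"
    assume a: "Cauchy X \<and> Cauchy X \<and> (\<lambda>n. X n - X n) \<longlonglongrightarrow> 0"
      and b: "Cauchy Y \<and> Cauchy Y \<and> (\<lambda>n. Y n - Y n) \<longlonglongrightarrow> 0"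
    have X: "(\<lambda>n. norm (X n)) \<longlonglongrightarrow> lim (\<lambda>n. norm (X n))"
      using a Cauchy_norm_convergent convergent_LIMSEQ_iff by blast
    have Y: "(\<lambda>n. norm (Y n)) \<longlonglongrightarrow> lim (\<lambda>n. norm (Y n))"
      using b Cauchy_norm_convergent convergent_LIMSEQ_iff by blast
    have XY: "(\<lambda>n. norm (X n + Y n)) \<longlonglongrightarrow> lim (\<lambda>n. norm (X n + Y n))"
      using a b Cauchy_add_seq Cauchy_norm_convergent convergent_LIMSEQ_iff by blast
    show "lim (\<lambda>n. norm (X n + Y n)) \<le> lim (\<lambda>n. norm (X n)) + lim (\<lambda>n. norm (Y n))"
      by (rule LIMSEQ_le[OF XY tendsto_add[OF X Y]]) (simp add: norm_triangle_ineq)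
  qed
  show "norm (c *\<^sub>R x) = \<bar>c\<bar> * norm x"
  proof transfer
    fix c and X :: "nat \<Rightarrow> 'a"
    assume a: "Cauchy X \<and> Cauchy X \<and> (\<lambda>n. X n - X n) \<longlonglongrightarrow> 0"
    then have "(\<lambda>n. norm (X n)) \<longlonglongrightarrow> lim (\<lambda>n. norm (X n))"
      using Cauchy_norm_convergent convergent_LIMSEQ_iff by blast
    then have "(\<lambda>n. norm (c *\<^sub>R X n)) \<longlonglongrightarrow> \<bar>c\<bar> * lim (\<lambda>n. norm (X n))"
      by (simp add: tendsto_mult_left)
    then show "lim (\<lambda>n. norm (c *\<^sub>R X n)) = \<bar>c\<bar> * lim (\<lambda>n. norm (X n))"
      by (rule limI)
  qed
qed

end

lift_definition to_completion :: "'a::real_normed_vector \<Rightarrow> 'a completion" is "\<lambda>x _. x"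
  by (simp add: Cauchy_def)

lemma linear_to_completion: "linear to_completion"
  by (rule linearI; transfer) (auto simp: Cauchy_def)

lemma norm_to_completion [simp]: "norm (to_completion x) = norm x"
  by transfer simp

lemma dist_to_completion [simp]: "dist (to_completion x) (to_completion y) = dist x y"
  by (metis dist_norm linear_diff linear_to_completion norm_to_completion)

lemma to_completion_approx:
  assumes "e > 0"
  shows "\<exists>a. dist x (to_completion a) < e"
proof -
  have "\<exists>a. norm (x + (-1) *\<^sub>R to_completion a) < e"
    using assms
  proof (transfer fixing: e)
    fix X :: "nat \<Rightarrow> 'a"
    assume e: "e > 0" and a: "Cauchy X \<and> Cauchy X \<and> (\<lambda>n. X n - X n) \<longlonglongrightarrow> 0"
    obtain M where M: "\<And>m n. m \<ge> M \<Longrightarrow> n \<ge> M \<Longrightarrow> norm (X m - X n) < e / 2"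
      using a e unfolding Cauchy_iff by (meson half_gt_zero)
    have "Cauchy (\<lambda>n. X n + (-1) *\<^sub>R X M)"
      using a by (intro Cauchy_add_seq) (auto simp: Cauchy_def)
    then have l: "(\<lambda>n. norm (X n + (-1) *\<^sub>R X M)) \<longlonglongrightarrow> lim (\<lambda>n. norm (X n + (-1) *\<^sub>R X M))"
      using Cauchy_norm_convergent convergent_LIMSEQ_iff by blast
    have "lim (\<lambda>n. norm (X n + (-1) *\<^sub>R X M)) \<le> e / 2"
      by (rule LIMSEQ_le_const2[OF l]) (use M in \<open>force intro: less_imp_le\<close>)
    then show "\<exists>a. lim (\<lambda>n. norm (X n + (-1) *\<^sub>R a)) < e"
      using e by (intro exI[of _ "X M"]) simp
  qed
  then show ?thesis
    by (simp add: dist_norm)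
qed

lemma closure_range_to_completion: "closure (range to_completion) = UNIV"
proof -
  have "x \<in> closure (range to_completion)" for x :: "'a completion"
    unfolding closure_approachable
  proof (intro allI impI)
    fix e :: real assume "e > 0"
    then obtain a where "dist x (to_completion a) < e"
      using to_completion_approx by blast
    then show "\<exists>y\<in>range to_completion. dist y x < e"
      by (auto simp: dist_commute)
  qed
  then show ?thesis by blast
qed

lemma to_completion_Cauchy_LIMSEQ:
  fixes X :: "nat \<Rightarrow> 'a::real_normed_vector"
  assumes X: "Cauchy X"
  shows "(\<lambda>n. to_completion (X n)) \<longlonglongrightarrow> abs_completion X"
proof (rule LIMSEQ_I)
  fix e :: real assume e: "e > 0"
  obtain M where M: "\<And>m n. m \<ge> M \<Longrightarrow> n \<ge> M \<Longrightarrow> norm (X m - X n) < e / 2"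
    using X e unfolding Cauchy_iff by (meson half_gt_zero)
  have "norm (to_completion (X m) - abs_completion X) < e" if m: "m \<ge> M" for m
  proof -
    let ?Y = "\<lambda>n. X m + (-1) *\<^sub>R X n"
    have c0: "Cauchy (\<lambda>n. X m)"
      by (simp add: Cauchy_def)
    note c1 = Cauchy_scaleR_seq[OF X, of "-1"]
    note c = c0 c1 Cauchy_add_seq[OF c0 c1]
    have "to_completion (X m) - abs_completion X = to_completion (X m) + (-1) *\<^sub>R abs_completion X"
      by simp
    also have "\<dots> = abs_completion (\<lambda>n. X m) + abs_completion (\<lambda>n. (-1) *\<^sub>R X n)"
      by (simp only: to_completion.abs_eq scaleR_completion.abs_eq[unfolded eq_onp_def, of X "-1"] X tendsto_const simp_thms diff_self)
    also have "\<dots> = abs_completion ?Y"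
      using c by (simp add: plus_completion.abs_eq del: scaleR_minus1_left)
    also have "norm \<dots> = lim (\<lambda>n. norm (?Y n))"
      using c by (simp add: norm_completion.abs_eq del: scaleR_minus1_left)
    finally have eq: "norm (to_completion (X m) - abs_completion X) = lim (\<lambda>n. norm (?Y n))" .
    have l: "(\<lambda>n. norm (?Y n)) \<longlonglongrightarrow> lim (\<lambda>n. norm (?Y n))"
      using c Cauchy_norm_convergent convergent_LIMSEQ_iff by blast
    have "lim (\<lambda>n. norm (?Y n)) \<le> e / 2"
      by (rule LIMSEQ_le_const2[OF l]) (use M m in \<open>force intro: less_imp_le\<close>)
    then show ?thesis using eq e by simp
  qed
  then show "\<exists>M. \<forall>m\<ge>M. norm (to_completion (X m) - abs_completion X) < e" by blast
qed

instance completion :: (real_normed_vector) banach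
proof
  fix X :: "nat \<Rightarrow> 'a completion"
  assume X: "Cauchy X"
  have "\<forall>n. \<exists>a. dist (X n) (to_completion a) < inverse (real (Suc n))"
    by (intro allI to_completion_approx) simp
  then obtain a where a: "\<And>n. dist (X n) (to_completion (a n)) < inverse (real (Suc n))"
    by metis
  have d: "(\<lambda>n. to_completion (a n) - X n) \<longlonglongrightarrow> 0"
  proof (rule Lim_null_comparison[OF _ LIMSEQ_inverse_real_of_nat])
    show "\<forall>\<^sub>F n in sequentially. norm (to_completion (a n) - X n) \<le> inverse (real (Suc n))"
      using a by (intro always_eventually) (metis dist_commute dist_norm less_imp_le)
  qed
  have "Cauchy (\<lambda>n. (to_completion (a n) - X n) + X n)"
    by (rule Cauchy_add_seq[OF LIMSEQ_imp_Cauchy[OF d] X])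
  then have "Cauchy a"
    by (simp add: Cauchy_def)
  then have "(\<lambda>n. to_completion (a n)) \<longlonglongrightarrow> abs_completion a"
    by (rule to_completion_Cauchy_LIMSEQ)
  from tendsto_diff[OF this d] show "convergent X"
    by (auto simp: convergent_def)
qed


section \<open>Tsirelson's space\<close>

text \<open>The natural numbers indexing coordinates start from \<open>1\<close>; coordinate \<open>0\<close> is kept at zero.\<close>

definition c00 :: "(nat \<Rightarrow> real) set" where
  "c00 = {x. finite {i. x i \<noteq> 0} \<and> x 0 = 0}"

definition coord_restrict :: "nat set \<Rightarrow> (nat \<Rightarrow> real) \<Rightarrow> nat \<Rightarrow> real" where
  "coord_restrict E x = (\<lambda>i. if i \<in> E then x i else 0)"

definition admissible :: "nat \<Rightarrow> (nat \<Rightarrow> nat set) \<Rightarrow> bool" where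
  "admissible n E \<longleftrightarrow> 1 \<le> n \<and>
     (\<forall>j\<in>{1..n}. finite (E j) \<and> E j \<noteq> {} \<and> E j \<subseteq> {1..}) \<and>
     n \<le> Min (E 1) \<and>
     (\<forall>i j. 1 \<le> i \<and> i < j \<and> j \<le> n \<longrightarrow> Max (E i) < Min (E j))"

primrec tsirelson_norm_iter :: "nat \<Rightarrow> (nat \<Rightarrow> real) \<Rightarrow> real" where
  "tsirelson_norm_iter 0 x = Max ((\<lambda>j. \<bar>x j\<bar>) ` {1..})"
| "tsirelson_norm_iter (Suc k) x =
     max (tsirelson_norm_iter k x)
       (1 / 2 * Max {\<Sum>j=1..n. tsirelson_norm_iter k (coord_restrict (E j) x) | n E. admissible n E})"

definition tsirelson_norm :: "(nat \<Rightarrow> real) \<Rightarrow> real" where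
  "tsirelson_norm x = lim (\<lambda>k. tsirelson_norm_iter k x)"

lemma c00_zero: "(\<lambda>_. 0) \<in> c00"
  by (simp add: c00_def)

lemma c00_add: "x \<in> c00 \<Longrightarrow> y \<in> c00 \<Longrightarrow> (\<lambda>i. x i + y i) \<in> c00"
  unfolding c00_def
  by (auto intro: finite_subset[of _ "{i. x i \<noteq> 0} \<union> {i. y i \<noteq> 0}"])

lemma c00_scale: "x \<in> c00 \<Longrightarrow> (\<lambda>i. c * x i) \<in> c00"
  unfolding c00_def by (auto intro: finite_subset[of _ "{i. x i \<noteq> 0}"])

lemma c00_coord_restrict: "x \<in> c00 \<Longrightarrow> coord_restrict E x \<in> c00"
  unfolding c00_def coord_restrict_def by (auto intro: finite_subset[of _ "{i. x i \<noteq> 0}"])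

lemma admissible_disjoint:
  assumes "admissible n E" "i \<in> {1..n}" "j \<in> {1..n}" "i \<noteq> j"
  shows "E i \<inter> E j = {}"
proof -
  have *: "E i \<inter> E j = {}" if "i < j" "i \<in> {1..n}" "j \<in> {1..n}" for i j
  proof -
    have "finite (E i)" "finite (E j)" "Max (E i) < Min (E j)"
      using assms(1) that by (auto simp: admissible_def)
    then show ?thesis
      by (meson Max_ge Min_le disjoint_iff leD le_less_trans)
  qed
  show ?thesis
    using *[of i j] *[of j i] assms by (cases "i < j") auto
qed

lemma admissible_exists: "admissible 1 (\<lambda>_. {1})"
  by (auto simp: admissible_def)

abbreviation tsirelson_sums :: "nat \<Rightarrow> (nat \<Rightarrow> real) \<Rightarrow> real set" where
  "tsirelson_sums k x \<equiv>
     {\<Sum>j=1..n. tsirelson_norm_iter k (coord_restrict (E j) x) | n E. admissible n E}"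

lemma tsirelson_sums_nonempty: "tsirelson_sums k x \<noteq> {}"
  using admissible_exists by blast

lemma finite_abs_image:
  assumes "x \<in> c00"
  shows "finite ((\<lambda>j. \<bar>x j\<bar>) ` {1..})"
proof -
  have "(\<lambda>j. \<bar>x j\<bar>) ` {1..} \<subseteq> insert 0 ((\<lambda>j. \<bar>x j\<bar>) ` {i. x i \<noteq> 0})" by auto
  then show ?thesis using assms by (auto simp: c00_def intro: finite_subset)
qed

lemma tsirelson_sums_zero:
  assumes "tsirelson_norm_iter k (\<lambda>_. 0) = 0"
  shows "tsirelson_sums k (\<lambda>_. 0) = {0}"
proof -
  have "coord_restrict E (\<lambda>_. 0) = (\<lambda>_. 0)" for E
    by (auto simp: coord_restrict_def)
  then show ?thesis using admissible_exists assms by auto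
qed

lemma tsirelson_norm_iter_zero: "tsirelson_norm_iter k (\<lambda>_. 0) = 0"
proof (induction k)
  case (Suc k)
  then show ?case
    by (simp add: tsirelson_sums_zero del: One_nat_def)
qed (simp add: image_constant_conv)

lemma finite_tsirelson_sums:
  assumes x: "x \<in> c00"
  shows "finite (tsirelson_sums k x)"
proof -
  define S where "S = {i. x i \<noteq> 0}"
  have S: "finite S" using x by (simp add: c00_def S_def)
  define g where "g B = tsirelson_norm_iter k (coord_restrict B x)" for B
  have g_S: "g B = g (B \<inter> S)" for B
  proof -
    have "coord_restrict B x = coord_restrict (B \<inter> S) x"
      by (auto simp: coord_restrict_def S_def)
    then show ?thesis by (simp add: g_def)
  qed
  have g0: "g {} = 0"
    by (simp add: g_def coord_restrict_def tsirelson_norm_iter_zero)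
  have "(\<Sum>j=1..n. g (E j)) \<in> sum g ` Pow (Pow S)" if E: "admissible n E" for n E
  proof -
    define J where "J = {j\<in>{1..n}. E j \<inter> S \<noteq> {}}"
    have "(\<Sum>j=1..n. g (E j)) = (\<Sum>j=1..n. g (E j \<inter> S))"
      using g_S by simp
    also have "\<dots> = (\<Sum>j\<in>J. g (E j \<inter> S))"
      by (rule sum.mono_neutral_right) (auto simp: J_def g0)
    also have "\<dots> = sum g ((\<lambda>j. E j \<inter> S) ` J)"
    proof (rule sum.reindex_cong[symmetric])
      show "inj_on (\<lambda>j. E j \<inter> S) J"
        by (rule inj_onI) (use admissible_disjoint[OF E] in \<open>fastforce simp: J_def\<close>)
    qed auto
    finally show ?thesis by auto
  qed
  then have "tsirelson_sums k x \<subseteq> sum g ` Pow (Pow S)"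
    by (auto simp: g_def)
  moreover have "finite (sum g ` Pow (Pow S))"
    using S by simp
  ultimately show ?thesis
    by (rule finite_subset)
qed

lemma tsirelson_norm_iter_mono: "tsirelson_norm_iter k x \<le> tsirelson_norm_iter (Suc k) x"
  by simp

lemma abs_le_tsirelson_norm_iter:
  assumes "x \<in> c00"
  shows "\<bar>x i\<bar> \<le> tsirelson_norm_iter k x"
proof (induction k)
  case 0
  show ?case
  proof (cases "i = 0")
    case True
    have "0 \<le> \<bar>x 1\<bar>" by simp
    also have "\<dots> \<le> Max ((\<lambda>j. \<bar>x j\<bar>) ` {1..})"
      by (rule Max_ge[OF finite_abs_image[OF assms]]) auto
    finally show ?thesis using True assms by (simp add: c00_def)
  next
    case False
    have "\<bar>x i\<bar> \<le> Max ((\<lambda>j. \<bar>x j\<bar>) ` {1..})"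
      by (rule Max_ge[OF finite_abs_image[OF assms]]) (use False in auto)
    then show ?thesis by simp
  qed
next
  case (Suc k)
  then show ?case using tsirelson_norm_iter_mono order_trans by blast
qed

lemma tsirelson_norm_iter_le:
  assumes "x \<in> c00"
  shows "tsirelson_norm_iter k x \<le> (\<Sum>i | x i \<noteq> 0. \<bar>x i\<bar>)"
  using assms
proof (induction k arbitrary: x)
  case 0
  have "\<bar>x j\<bar> \<le> (\<Sum>i | x i \<noteq> 0. \<bar>x i\<bar>)" for j
  proof (cases "x j = 0")
    case False
    then show ?thesis
      using 0 by (intro member_le_sum) (auto simp: c00_def)
  qed (simp add: sum_nonneg)
  then show ?case
    using finite_abs_image[OF 0] by (auto intro!: Max.boundedI)
next
  case (Suc k)
  have fin: "finite {i. x i \<noteq> 0}" using Suc.prems by (simp add: c00_def)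
  let ?l = "\<Sum>i | x i \<noteq> 0. \<bar>x i\<bar>"
  have "(\<Sum>j=1..n. tsirelson_norm_iter k (coord_restrict (E j) x)) \<le> ?l" if E: "admissible n E" for n E
  proof -
    let ?A = "\<lambda>j. {i. coord_restrict (E j) x i \<noteq> 0}"
    have A: "?A j \<subseteq> {i. x i \<noteq> 0}" "?A j \<subseteq> E j" for j
      by (auto simp: coord_restrict_def split: if_splits)
    have "(\<Sum>j=1..n. tsirelson_norm_iter k (coord_restrict (E j) x))
        \<le> (\<Sum>j=1..n. \<Sum>i\<in>?A j. \<bar>coord_restrict (E j) x i\<bar>)"
      by (intro sum_mono Suc.IH c00_coord_restrict Suc.prems)
    also have "\<dots> = (\<Sum>j=1..n. \<Sum>i\<in>?A j. \<bar>x i\<bar>)"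
      by (intro sum.cong refl) (auto simp: coord_restrict_def split: if_splits)
    also have "\<dots> = (\<Sum>i\<in>(\<Union>j\<in>{1..n}. ?A j). \<bar>x i\<bar>)"
    proof (rule sum.UNION_disjoint[symmetric])
      show "\<forall>j\<in>{1..n}. finite (?A j)"
        using A(1) fin finite_subset by blast
      show "\<forall>i\<in>{1..n}. \<forall>j\<in>{1..n}. i \<noteq> j \<longrightarrow> ?A i \<inter> ?A j = {}"
        using A(2) admissible_disjoint[OF E] by blast
    qed auto
    also have "\<dots> \<le> ?l"
      by (rule sum_mono2[OF fin]) (use A(1) in auto)
    finally show ?thesis .
  qed
  then have "Max (tsirelson_sums k x) \<le> ?l"
    using finite_tsirelson_sums[OF Suc.prems] tsirelson_sums_nonempty
    by (subst Max_le_iff) blast+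
  moreover have "0 \<le> ?l" by (simp add: sum_nonneg)
  ultimately have "1 / 2 * Max (tsirelson_sums k x) \<le> ?l"
    by linarith
  then show ?case
    using Suc.IH[OF Suc.prems] unfolding tsirelson_norm_iter.simps by (rule max.boundedI[rotated])
qed

lemma tsirelson_norm_iter_scale:
  assumes "x \<in> c00"
  shows "tsirelson_norm_iter k (\<lambda>i. c * x i) = \<bar>c\<bar> * tsirelson_norm_iter k x"
  using assms
proof (induction k arbitrary: x)
  case 0
  have "(\<lambda>j. \<bar>c * x j\<bar>) ` {1..} = (*) \<bar>c\<bar> ` (\<lambda>j. \<bar>x j\<bar>) ` {1..}"
    by (simp add: image_image abs_mult)
  moreover have "\<bar>c\<bar> * Max ((\<lambda>j. \<bar>x j\<bar>) ` {1..}) = Max ((*) \<bar>c\<bar> ` (\<lambda>j. \<bar>x j\<bar>) ` {1..})"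
    by (rule mono_Max_commute[OF _ finite_abs_image[OF 0]]) (auto intro!: monoI mult_left_mono)
  ultimately show ?case by simp
next
  case (Suc k)
  have r: "coord_restrict E (\<lambda>i. c * x i) = (\<lambda>i. c * coord_restrict E x i)" for E
    by (auto simp: coord_restrict_def)
  have s: "(\<Sum>j=1..n. tsirelson_norm_iter k (coord_restrict (E j) (\<lambda>i. c * x i)))
      = \<bar>c\<bar> * (\<Sum>j=1..n. tsirelson_norm_iter k (coord_restrict (E j) x))" for n E
    by (simp add: r Suc.IH c00_coord_restrict Suc.prems sum_distrib_left)
  have "tsirelson_sums k (\<lambda>i. c * x i) = (*) \<bar>c\<bar> ` tsirelson_sums k x"
    unfolding s by blast
  moreover have "\<bar>c\<bar> * Max (tsirelson_sums k x) = Max ((*) \<bar>c\<bar> ` tsirelson_sums k x)"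
    by (rule mono_Max_commute[OF _ finite_tsirelson_sums[OF Suc.prems] tsirelson_sums_nonempty])
      (auto intro!: monoI mult_left_mono)
  ultimately have "Max (tsirelson_sums k (\<lambda>i. c * x i)) = \<bar>c\<bar> * Max (tsirelson_sums k x)"
    by simp
  then show ?case
    by (simp add: Suc.IH Suc.prems max_mult_distrib_left)
qed

lemma tsirelson_norm_iter_triangle:
  assumes "x \<in> c00" "y \<in> c00"
  shows "tsirelson_norm_iter k (\<lambda>i. x i + y i) \<le> tsirelson_norm_iter k x + tsirelson_norm_iter k y"
  using assms
proof (induction k arbitrary: x y)
  case 0
  have "\<bar>x j + y j\<bar> \<le> tsirelson_norm_iter 0 x + tsirelson_norm_iter 0 y" for j
    using abs_le_tsirelson_norm_iter[OF 0(1), of j 0] abs_le_tsirelson_norm_iter[OF 0(2), of j 0]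
      abs_triangle_ineq[of "x j" "y j"] by linarith
  then show ?case
    using finite_abs_image[OF c00_add[OF 0]] by (auto intro!: Max.boundedI)
next
  case (Suc k)
  note x = Suc.prems(1) and y = Suc.prems(2)
  have r: "coord_restrict E (\<lambda>i. x i + y i) = (\<lambda>i. coord_restrict E x i + coord_restrict E y i)" for E
    by (auto simp: coord_restrict_def)
  have "s \<le> Max (tsirelson_sums k x) + Max (tsirelson_sums k y)"
    if s: "s \<in> tsirelson_sums k (\<lambda>i. x i + y i)" for s
  proof -
    obtain n E where E: "admissible n E"
      and s: "s = (\<Sum>j=1..n. tsirelson_norm_iter k (coord_restrict (E j) (\<lambda>i. x i + y i)))"
      using s by blast
    have "s \<le> (\<Sum>j=1..n. tsirelson_norm_iter k (coord_restrict (E j) x)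
        + tsirelson_norm_iter k (coord_restrict (E j) y))"
      unfolding s r by (intro sum_mono Suc.IH c00_coord_restrict x y)
    also have "\<dots> = (\<Sum>j=1..n. tsirelson_norm_iter k (coord_restrict (E j) x))
        + (\<Sum>j=1..n. tsirelson_norm_iter k (coord_restrict (E j) y))"
      by (rule sum.distrib)
    also have "\<dots> \<le> Max (tsirelson_sums k x) + Max (tsirelson_sums k y)"
      by (intro add_mono Max_ge finite_tsirelson_sums x y) (use E in blast)+
    finally show ?thesis .
  qed
  then have "Max (tsirelson_sums k (\<lambda>i. x i + y i)) \<le> Max (tsirelson_sums k x) + Max (tsirelson_sums k y)"
    using finite_tsirelson_sums[OF c00_add[OF x y]] tsirelson_sums_nonempty
    by (subst Max_le_iff) blast+
  moreover have "max a (1 / 2 * b) \<le> max c (1 / 2 * d) + max e (1 / 2 * f)"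
    if "a \<le> c + e" "b \<le> d + f" for a b c d e f :: real
    using that by (auto simp: max_def)
  ultimately show ?case
    using Suc.IH[OF x y] unfolding tsirelson_norm_iter.simps by blast
qed

lemma tsirelson_norm_LIMSEQ:
  assumes "x \<in> c00"
  shows "(\<lambda>k. tsirelson_norm_iter k x) \<longlonglongrightarrow> tsirelson_norm x"
proof -
  have "incseq (\<lambda>k. tsirelson_norm_iter k x)"
    by (intro incseq_SucI tsirelson_norm_iter_mono)
  then have "convergent (\<lambda>k. tsirelson_norm_iter k x)"
    using tsirelson_norm_iter_le[OF assms] incseq_convergent unfolding convergent_def by metis
  then show ?thesis
    by (simp add: tsirelson_norm_def convergent_LIMSEQ_iff)
qed

lemma abs_le_tsirelson_norm:
  assumes "x \<in> c00"
  shows "\<bar>x i\<bar> \<le> tsirelson_norm x"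
  by (rule LIMSEQ_le_const[OF tsirelson_norm_LIMSEQ[OF assms]])
    (use abs_le_tsirelson_norm_iter[OF assms] in blast)

lemma tsirelson_norm_scale:
  assumes "x \<in> c00"
  shows "tsirelson_norm (\<lambda>i. c * x i) = \<bar>c\<bar> * tsirelson_norm x"
proof -
  have "(\<lambda>k. tsirelson_norm_iter k (\<lambda>i. c * x i)) \<longlonglongrightarrow> \<bar>c\<bar> * tsirelson_norm x"
    using tendsto_mult_left[OF tsirelson_norm_LIMSEQ[OF assms], of "\<bar>c\<bar>"]
    by (simp only: tsirelson_norm_iter_scale[OF assms])
  then show ?thesis
    using LIMSEQ_unique tsirelson_norm_LIMSEQ[OF c00_scale[OF assms]] by blast
qed

lemma tsirelson_norm_triangle:
  assumes "x \<in> c00" "y \<in> c00"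
  shows "tsirelson_norm (\<lambda>i. x i + y i) \<le> tsirelson_norm x + tsirelson_norm y"
  by (rule LIMSEQ_le[OF tsirelson_norm_LIMSEQ[OF c00_add[OF assms]]
        tendsto_add[OF tsirelson_norm_LIMSEQ[OF assms(1)] tsirelson_norm_LIMSEQ[OF assms(2)]]])
    (use tsirelson_norm_iter_triangle[OF assms] in blast)

lemma tsirelson_norm_zero: "tsirelson_norm (\<lambda>_. 0) = 0"
  by (simp add: tsirelson_norm_def tsirelson_norm_iter_zero)

text \<open>The space \<open>c\<^sub>0\<^sub>0\<close> with Tsirelson's norm, and its completion.\<close>

typedef tsirelson_c00 = c00
  morphisms coords Abs_tsirelson_c00
  using c00_zero by blast

setup_lifting type_definition_tsirelson_c00

instantiation tsirelson_c00 :: real_vector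
begin

lift_definition zero_tsirelson_c00 :: tsirelson_c00 is "\<lambda>_. 0"
  by (rule c00_zero)

lift_definition plus_tsirelson_c00 :: "tsirelson_c00 \<Rightarrow> tsirelson_c00 \<Rightarrow> tsirelson_c00"
  is "\<lambda>x y i. x i + y i"
  by (rule c00_add)

lift_definition scaleR_tsirelson_c00 :: "real \<Rightarrow> tsirelson_c00 \<Rightarrow> tsirelson_c00"
  is "\<lambda>c x i. c * x i"
  by (rule c00_scale)

definition uminus_tsirelson_c00 :: "tsirelson_c00 \<Rightarrow> tsirelson_c00" where
  "uminus_tsirelson_c00 x = (-1) *\<^sub>R x"

definition minus_tsirelson_c00 :: "tsirelson_c00 \<Rightarrow> tsirelson_c00 \<Rightarrow> tsirelson_c00" where
  "minus_tsirelson_c00 x y = x + (- y)"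

instance
proof
  fix a b c :: tsirelson_c00 and r s :: real
  show "a + b + c = a + (b + c)" by transfer (simp add: algebra_simps)
  show "a + b = b + a" by transfer (simp add: algebra_simps)
  show "0 + a = a" by transfer simp
  show "- a + a = 0" unfolding uminus_tsirelson_c00_def by transfer simp
  show "a - b = a + - b" by (rule minus_tsirelson_c00_def)
  show "r *\<^sub>R (a + b) = r *\<^sub>R a + r *\<^sub>R b" by transfer (simp add: algebra_simps)
  show "(r + s) *\<^sub>R a = r *\<^sub>R a + s *\<^sub>R a" by transfer (simp add: algebra_simps)
  show "r *\<^sub>R s *\<^sub>R a = (r * s) *\<^sub>R a" by transfer (simp add: algebra_simps)
  show "1 *\<^sub>R a = a" by transfer simp
qed

end

instantiation tsirelson_c00 :: real_normed_vector
begin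

lift_definition norm_tsirelson_c00 :: "tsirelson_c00 \<Rightarrow> real" is tsirelson_norm .

definition sgn_tsirelson_c00 :: "tsirelson_c00 \<Rightarrow> tsirelson_c00" where
  "sgn_tsirelson_c00 x = x /\<^sub>R norm x"

definition dist_tsirelson_c00 :: "tsirelson_c00 \<Rightarrow> tsirelson_c00 \<Rightarrow> real" where
  "dist_tsirelson_c00 x y = norm (x - y)"

definition uniformity_tsirelson_c00 :: "(tsirelson_c00 \<times> tsirelson_c00) filter" where
  "uniformity_tsirelson_c00 = (INF e\<in>{0 <..}. principal {(x, y). dist x y < e})"

definition open_tsirelson_c00 :: "tsirelson_c00 set \<Rightarrow> bool" where
  "open_tsirelson_c00 U \<longleftrightarrow> (\<forall>x\<in>U. eventually (\<lambda>(x', y). x' = x \<longrightarrow> y \<in> U) uniformity)"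

instance
proof
  fix x y :: tsirelson_c00 and c :: real and U :: "tsirelson_c00 set"
  show "dist x y = norm (x - y)" by (rule dist_tsirelson_c00_def)
  show "sgn x = x /\<^sub>R norm x" by (rule sgn_tsirelson_c00_def)
  show "uniformity = (INF e\<in>{0 <..}. principal {(x::tsirelson_c00, y). dist x y < e})"
    by (rule uniformity_tsirelson_c00_def)
  show "open U = (\<forall>x\<in>U. \<forall>\<^sub>F (x', y) in uniformity. x' = x \<longrightarrow> y \<in> U)"
    by (rule open_tsirelson_c00_def)
  show "(norm x = 0) = (x = 0)"
  proof transfer
    fix x assume x: "x \<in> c00"
    have "x = (\<lambda>_. 0)" if "tsirelson_norm x = 0"
      using abs_le_tsirelson_norm[OF x] that by (intro ext) simp
    then show "(tsirelson_norm x = 0) = (x = (\<lambda>_. 0))"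
      using tsirelson_norm_zero by blast
  qed
  show "norm (x + y) \<le> norm x + norm y"
    by transfer (rule tsirelson_norm_triangle)
  show "norm (c *\<^sub>R x) = \<bar>c\<bar> * norm x"
    by transfer (rule tsirelson_norm_scale)
qed

end

type_synonym tsirelson = "tsirelson_c00 completion"

type_synonym tsirelson_dual = "tsirelson \<Rightarrow>\<^sub>L real"

end

theory Submission
  imports Defs
begin

text \<open>The proof rests on one concentration property of \<open>T\<^sup>*\<close>, the dual of Tsirelson's space. Call a map on the
increasing \<open>k\<close>-tuples of natural numbers \<open>L\<close>-step-Lipschitz if changing one entry of a tuple moves
the value by at most \<open>L\<close>. Every such map into \<open>T\<^sup>*\<close> has oscillation at most \<open>6 L\<close> on the
\<open>k\<close>-tuples from some infinite set, and this bound does not depend on \<open>k\<close>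
(\<open>tsirelson_dual_concentration\<close>). To see it, take iterated weak-star limits along an ultrafilter, from
the last entry to the first. The value at a tuple is then a constant plus \<open>k\<close> increments of norm at
most \<open>L\<close>, and each increment is weak-star null in its last index. On a sparse set of indices the
increments are almost supported on successive intervals lying beyond \<open>k\<close>, and there the definition of
Tsirelson's norm gives \<open>\<Sum> \<parallel>I\<^sub>i x\<parallel> \<le> 2 \<parallel>x\<parallel>\<close>. Hence the sum of the increments has norm at most
\<open>2 L\<close> up to a small error. Increments can be cut off on the right because the unit vector basis of \<open>T\<close> is
shrinking (\<open>tsirelson_shrinking\<close>). If it were not, normalised blocks far out would behave like
an \<open>\<ell>\<^sub>1\<close>-basis with constant close to \<open>1\<close>, while a block plus the average of many later blocks has
norm at most \<open>7/4\<close> instead of nearly \<open>2\<close>.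

A coarse embedding of \<open>X\<close>, or a uniform embedding of its unit ball, transfers a bound independent of
\<open>k\<close> to \<open>1\<close>-step-Lipschitz maps with values in \<open>X\<close> (\<open>bounded_concentration\<close>). For the ball one
rescales the map so that it fits into the ball with diameter about \<open>1\<close>: if the oscillation is large
then the rescaled map has small steps, and the embedding shows that its oscillation can be halved.

This property is applied to the sums \<open>\<Sum> c\<^sub>i x (n\<^sub>i)\<close> with \<open>\<bar>c\<^sub>i\<bar> \<le> 1\<close> for a bounded sequence \<open>x\<close>. If
\<open>X\<close> is not reflexive, James's construction gives a bounded sequence together with functionals that
vanish on its beginning and are \<open>1\<close> on the rest, so that two disjoint sums of \<open>k\<close> terms have distance of order
\<open>k\<close>: a contradiction. For a spreading model with fundamental sequence \<open>(e\<^sub>i)\<close> the property says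
\<open>\<parallel>\<Sum> c\<^sub>i (e\<^sub>i - e\<^bsub>k+i\<^esub>)\<parallel> \<le> C\<close>, where \<open>i\<close> runs from \<open>0\<close> to \<open>k - 1\<close>. Averaging over shifts of the second block removes it whenever
\<open>\<Sum> c\<^sub>i = 0\<close>. So the averages of \<open>(e\<^sub>i)\<close> converge to some \<open>u\<close>, and either \<open>u = 0\<close> and \<open>(e\<^sub>i)\<close> is
equivalent to the unit vector basis of \<open>c\<^sub>0\<close>, or \<open>u, e\<^sub>0 - u, e\<^sub>1 - u, \<dots>\<close> is.\<close>

section \<open>Limits along an ultrafilter\<close>

definition ultrafilter :: "'a filter \<Rightarrow> bool" where
  "ultrafilter U \<longleftrightarrow> U \<noteq> bot \<and> (\<forall>P. eventually P U \<or> eventually (\<lambda>x. \<not> P x) U)"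

text \<open>Zorn's lemma for the reversed order of filters: the infimum of a chain of proper filters is proper
because an event that eventually holds for the infimum already does so for a member of the chain.\<close>

lemma ultrafilter_below:
  assumes "F \<noteq> (bot::'a filter)"
  shows "\<exists>U\<le>F. ultrafilter U"
proof -
  let ?A = "{G. G \<le> F \<and> G \<noteq> bot}"
  have "\<exists>m\<in>?A. \<forall>a\<in>?A. m \<ge> a \<longrightarrow> a = m"
  proof (rule predicate_Zorn[where P="\<lambda>x y. x \<ge> y"])
    show "partial_order_on ?A (relation_of (\<lambda>x y. x \<ge> y) ?A)"
      by (rule partial_order_on_relation_ofI) auto
  next
    fix C assume C: "C \<in> Chains (relation_of (\<lambda>x y::'a filter. x \<ge> y) ?A)"
    then have sub: "C \<subseteq> ?A" and ch: "\<And>G H. G \<in> C \<Longrightarrow> H \<in> C \<Longrightarrow> G \<le> H \<or> H \<le> G"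
      by (auto simp: Chains_def relation_of_def)
    show "\<exists>u\<in>?A. \<forall>a\<in>C. a \<ge> u"
    proof (cases "C = {}")
      case True
      then show ?thesis using assms by auto
    next
      case False
      have "eventually P (Inf C) \<longleftrightarrow> (\<exists>b\<in>C. eventually P b)" for P
      proof (rule eventually_Inf_base[OF False])
        fix G H assume "G \<in> C" "H \<in> C"
        then show "\<exists>x\<in>C. x \<le> inf G H"
          using ch[of G H] by (metis inf.absorb1 inf.absorb2 order_refl)
      qed
      then have "Inf C \<noteq> bot"
        using sub by (auto simp: trivial_limit_def)
      moreover have "Inf C \<le> F"
        using False sub by (metis (mono_tags, lifting) CollectD Inf_lower2 ex_in_conv subset_iff)
      ultimately show ?thesis by (intro bexI[of _ "Inf C"]) (auto intro: Inf_lower)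
    qed
  qed
  then obtain U where U: "U \<le> F" "U \<noteq> bot" and min: "\<And>G. G \<le> F \<Longrightarrow> G \<noteq> bot \<Longrightarrow> G \<le> U \<Longrightarrow> G = U"
    by auto
  have "eventually P U \<or> eventually (\<lambda>x. \<not> P x) U" for P
  proof (cases "inf U (principal {x. P x}) = bot")
    case True
    then show ?thesis
      unfolding trivial_limit_def eventually_inf_principal by simp
  next
    case False
    then have "inf U (principal {x. P x}) = U"
      using U by (intro min) (auto intro: le_infI1)
    then have "eventually P U"
      using eventually_inf_principal[of P U "{x. P x}"] by simp
    then show ?thesis ..
  qed
  then show ?thesis using U unfolding ultrafilter_def by blast
qed

lemma ultrafilter_tendsto_compact:
  assumes U: "ultrafilter U" and S: "compact S" and g: "eventually (\<lambda>n. g n \<in> S) U"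
  shows "\<exists>x\<in>S. (g \<longlongrightarrow> x) U"
proof -
  let ?F = "filtermap g U"
  have "?F \<noteq> bot" "eventually (\<lambda>x. x \<in> S) ?F"
    using U g by (auto simp: ultrafilter_def filtermap_bot_iff eventually_filtermap)
  then obtain x where x: "x \<in> S" "inf (nhds x) ?F \<noteq> bot"
    using S unfolding compact_filter by blast
  have "eventually (\<lambda>n. P (g n)) U" if P: "eventually P (nhds x)" for P
  proof (rule ccontr)
    assume "\<not> eventually (\<lambda>n. P (g n)) U"
    then have "eventually (\<lambda>n. \<not> P (g n)) U"
      using U unfolding ultrafilter_def by blast
    then have "eventually (\<lambda>y. \<not> P y) ?F"
      by (simp add: eventually_filtermap)
    with P have "eventually (\<lambda>y. False) (inf (nhds x) ?F)"
      unfolding eventually_inf by blast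
    with x show False by (simp add: trivial_limit_def)
  qed
  then have "(g \<longlongrightarrow> x) U"
    unfolding filterlim_def le_filter_def eventually_filtermap by blast
  with x show ?thesis by blast
qed

text \<open>A bounded family of functionals converges weak-star along every ultrafilter; this replaces the
extraction of subsequences, and is available in the dual of any normed space.\<close>

lemma dual_ball_ultralimit:
  fixes \<phi> :: "'n \<Rightarrow> 'a::real_normed_vector \<Rightarrow>\<^sub>L real"
  assumes U: "ultrafilter U" and B: "eventually (\<lambda>n. norm (\<phi> n) \<le> B) U"
  shows "\<exists>\<psi>::'a \<Rightarrow>\<^sub>L real. \<forall>x. ((\<lambda>n. \<phi> n x) \<longlongrightarrow> \<psi> x) U"
proof -
  have nb: "U \<noteq> bot" using U by (simp add: ultrafilter_def)
  have bd: "eventually (\<lambda>n. \<phi> n x \<in> cball 0 (B * norm x)) U" for x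
    using B
  proof eventually_elim
    case (elim n)
    have "norm (\<phi> n x) \<le> norm (\<phi> n) * norm x" by (rule norm_blinfun)
    also have "\<dots> \<le> B * norm x" using elim by (rule mult_right_mono) simp
    finally show ?case by simp
  qed
  have "\<exists>v\<in>cball 0 (B * norm x). ((\<lambda>n. \<phi> n x) \<longlongrightarrow> v) U" for x
    by (rule ultrafilter_tendsto_compact[OF U compact_cball bd])
  then obtain g where g: "\<And>x. ((\<lambda>n. \<phi> n x) \<longlongrightarrow> g x) U" and gb: "\<And>x. g x \<in> cball 0 (B * norm x)"
    by metis
  have "bounded_linear g"
  proof (rule bounded_linear_intro)
    fix x y
    have "((\<lambda>n. \<phi> n x + \<phi> n y) \<longlongrightarrow> g x + g y) U"
      by (intro tendsto_add g)
    then show "g (x + y) = g x + g y"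
      using tendsto_unique[OF nb g[of "x + y"]] by (simp add: blinfun.add_right)
  next
    fix r x
    have "((\<lambda>n. r *\<^sub>R \<phi> n x) \<longlongrightarrow> r *\<^sub>R g x) U"
      by (intro tendsto_scaleR tendsto_const g)
    then show "g (r *\<^sub>R x) = r *\<^sub>R g x"
      using tendsto_unique[OF nb g[of "r *\<^sub>R x"]] by (simp add: blinfun.scaleR_right)
  next
    fix x show "norm (g x) \<le> norm x * B" using gb[of x] by (simp add: mult.commute)
  qed
  then show ?thesis
    using g by (intro exI[of _ "Blinfun g"]) (simp add: bounded_linear_Blinfun_apply)
qed

lemma dual_ball_closed_under_limits:
  fixes \<psi> :: "'a::real_normed_vector \<Rightarrow>\<^sub>L real" and \<phi> :: "'n \<Rightarrow> 'a \<Rightarrow>\<^sub>L real"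
  assumes "U \<noteq> bot" and lim: "\<And>x. ((\<lambda>n. \<phi> n x) \<longlongrightarrow> \<psi> x) U"
    and B: "eventually (\<lambda>n. norm (\<phi> n) \<le> B) U"
  shows "norm \<psi> \<le> B"
proof (rule norm_blinfun_bound)
  obtain n where "norm (\<phi> n) \<le> B"
    using eventually_happens'[OF assms(1) B] by blast
  then show "B \<ge> 0" using norm_ge_zero order_trans by blast
  fix x
  show "norm (\<psi> x) \<le> B * norm x"
  proof (rule tendsto_upperbound[OF tendsto_norm[OF lim] _ assms(1)])
    show "\<forall>\<^sub>F n in U. norm (\<phi> n x) \<le> B * norm x"
      using B
    proof eventually_elim
      case (elim n)
      have "norm (\<phi> n x) \<le> norm (\<phi> n) * norm x" by (rule norm_blinfun)
      also have "\<dots> \<le> B * norm x" using elim by (rule mult_right_mono) simp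
      finally show ?case .
    qed
  qed
qed

section \<open>The Hahn-Banach theorem and Helly's theorem\<close>

definition sublinear :: "('a::real_vector \<Rightarrow> real) \<Rightarrow> bool" where
  "sublinear q \<longleftrightarrow> (\<forall>x y. q (x + y) \<le> q x + q y) \<and> (\<forall>t>0. \<forall>x. q (t *\<^sub>R x) = t * q x)"

lemma sublinear_add: "sublinear q \<Longrightarrow> q (x + y) \<le> q x + q y"
  by (simp add: sublinear_def)

lemma sublinear_scale: "sublinear q \<Longrightarrow> t > 0 \<Longrightarrow> q (t *\<^sub>R x) = t * q x"
  by (simp add: sublinear_def)

lemma sublinear_zero: "sublinear q \<Longrightarrow> q 0 = 0"
  using sublinear_scale[of q 2 0] by simp

lemma sublinear_lower: "sublinear q \<Longrightarrow> - q (- x) \<le> q x"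
  using sublinear_add[of q x "-x"] sublinear_zero[of q] by simp

lemma sublinear_norm: "sublinear norm"
  by (simp add: sublinear_def norm_triangle_ineq)

text \<open>Sublinear functionals can be pushed down to meet demands: each
\<open>(c, s) \<in> S\<close> asks for a functional with value at least \<open>s\<close> at \<open>c\<close>. For a convex cone \<open>S\<close> of demands that
\<open>q\<close> does not contradict, the infimum of \<open>q (x + c) - s\<close> over \<open>(c, s) \<in> S\<close> is again sublinear, and
every linear functional below it satisfies all demands. It serves twice below: with the ray
spanned by \<open>(a, q a)\<close> to see that minimal sublinear functionals are additive, and with the cone
generated by a point and a subspace to obtain separating functionals.\<close>

lemma sublinear_reduce:
  fixes q :: "'a::real_vector \<Rightarrow> real" and S :: "('a \<times> real) set"
  assumes q: "sublinear q" and zero: "(0, 0) \<in> S"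
    and add: "\<And>c s d t. (c, s) \<in> S \<Longrightarrow> (d, t) \<in> S \<Longrightarrow> (c + d, s + t) \<in> S"
    and scale: "\<And>r c s. r > 0 \<Longrightarrow> (c, s) \<in> S \<Longrightarrow> (r *\<^sub>R c, r * s) \<in> S"
    and le: "\<And>c s. (c, s) \<in> S \<Longrightarrow> s \<le> q c"
  obtains p where "sublinear p" "\<And>x. p x \<le> q x" "\<And>x c s. (c, s) \<in> S \<Longrightarrow> p x \<le> q (x + c) - s"
proof -
  define V where "V x = {q (x + c) - s | c s. (c, s) \<in> S}" for x
  define p where "p x = Inf (V x)" for x
  have lb: "- q (- x) \<le> v" if vx: "v \<in> V x" for x v
  proof -
    obtain c s where v: "v = q (x + c) - s" "(c, s) \<in> S" using vx unfolding V_def by blast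
    have "q c \<le> q (x + c) + q (- x)" using sublinear_add[OF q, of "x + c" "- x"] by simp
    with v le[of c s] show ?thesis by simp
  qed
  have bdd: "bdd_below (V x)" for x using lb by (meson bdd_belowI)
  have ne: "V x \<noteq> {}" for x using zero by (auto simp: V_def)
  have up: "p x \<le> q (x + c) - s" if "(c, s) \<in> S" for x c s
    unfolding p_def by (rule cInf_lower[OF _ bdd]) (use that in \<open>auto simp: V_def\<close>)
  have scale_le: "p (t *\<^sub>R x) \<le> t * p x" if "t > 0" for t x
  proof -
    have "p (t *\<^sub>R x) / t \<le> p x"
      unfolding p_def[of x]
    proof (rule cInf_greatest[OF ne])
      fix v assume "v \<in> V x"
      then obtain c s where v: "v = q (x + c) - s" "(c, s) \<in> S" unfolding V_def by blast
      have "p (t *\<^sub>R x) \<le> q (t *\<^sub>R x + t *\<^sub>R c) - t * s"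
        by (rule up[OF scale[OF that v(2)]])
      also have "\<dots> = t * v"
        using sublinear_scale[OF q that, of "x + c"] by (simp add: v algebra_simps)
      finally show "p (t *\<^sub>R x) / t \<le> v" using that by (simp add: field_simps)
    qed
    then show ?thesis using that by (simp add: field_simps)
  qed
  have "sublinear p"
    unfolding sublinear_def
  proof (intro conjI allI impI)
    fix x y
    have "p (x + y) - v \<le> w" if vw: "v \<in> V x" "w \<in> V y" for v w
    proof -
      obtain c s d t where v: "v = q (x + c) - s" "(c, s) \<in> S" and w: "w = q (y + d) - t" "(d, t) \<in> S"
        using vw unfolding V_def by blast
      have "p (x + y) \<le> q (x + y + (c + d)) - (s + t)"
        by (rule up[OF add[OF v(2) w(2)]])
      also have "\<dots> \<le> v + w"
        using sublinear_add[OF q, of "x + c" "y + d"] by (simp add: v w algebra_simps)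
      finally show ?thesis by simp
    qed
    then have "p (x + y) - v \<le> p y" if "v \<in> V x" for v
      unfolding p_def[of y] by (intro cInf_greatest[OF ne]) (use that in blast)
    then have "p (x + y) - p y \<le> p x"
      unfolding p_def[of x] by (intro cInf_greatest[OF ne]) (simp add: algebra_simps)
    then show "p (x + y) \<le> p x + p y" by simp
  next
    fix t :: real and x assume t: "t > 0"
    have "p x \<le> (1 / t) * p (t *\<^sub>R x)"
      using scale_le[of "1 / t" "t *\<^sub>R x"] t by simp
    with scale_le[OF t, of x] t show "p (t *\<^sub>R x) = t * p x"
      by (simp add: field_simps)
  qed
  moreover have "p x \<le> q x" for x using up[OF zero, of x] by simp
  ultimately show ?thesis using up that by blast
qed

lemma minimal_sublinear_linear:
  assumes q: "sublinear q" and min: "\<And>p. sublinear p \<Longrightarrow> (\<And>x. p x \<le> q x) \<Longrightarrow> p = q"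
  shows "linear q"
proof -
  have ge: "q x + q a \<le> q (x + a)" for x a
  proof -
    let ?S = "{(t *\<^sub>R a, t * q a) | t. t \<ge> 0}"
    obtain p where p: "sublinear p" "\<And>x. p x \<le> q x"
        and up: "\<And>x c s. (c, s) \<in> ?S \<Longrightarrow> p x \<le> q (x + c) - s"
    proof (rule sublinear_reduce[OF q, of ?S])
      show "(0, 0) \<in> ?S" by force
      show "(c + d, s + t) \<in> ?S" if "(c, s) \<in> ?S" "(d, t) \<in> ?S" for c s d t
      proof -
        from that obtain u w where "u \<ge> 0" "w \<ge> 0" "c = u *\<^sub>R a" "s = u * q a" "d = w *\<^sub>R a" "t = w * q a"
          by auto
        then show ?thesis
          by (auto intro!: exI[of _ "u + w"] simp: algebra_simps)
      qed
      show "(r *\<^sub>R c, r * s) \<in> ?S" if "r > 0" "(c, s) \<in> ?S" for r c s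
      proof -
        from that obtain u where "u \<ge> 0" "c = u *\<^sub>R a" "s = u * q a" by auto
        then show ?thesis using that(1)
          by (auto intro!: exI[of _ "r * u"])
      qed
      show "s \<le> q c" if "(c, s) \<in> ?S" for c s
      proof -
        from that obtain u where u: "u \<ge> 0" "c = u *\<^sub>R a" "s = u * q a" by auto
        then show ?thesis
          using sublinear_scale[OF q, of u a] sublinear_zero[OF q] by (cases "u = 0") auto
      qed
    qed blast
    have "p = q" using min p by blast
    with up[of a "q a" x] show ?thesis by (force intro: exI[of _ 1])
  qed
  then have add: "q (x + y) = q x + q y" for x y
    using sublinear_add[OF q] by (simp add: antisym)
  have neg: "q (- x) = - q x" for x
    using add[of x "- x"] sublinear_zero[OF q] by simp
  show ?thesis
  proof (rule linearI[OF add])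
    fix r :: real and x
    consider "r > 0" | "r = 0" | "r < 0" by linarith
    then show "q (r *\<^sub>R x) = r *\<^sub>R q x"
    proof cases
      case 3
      then show ?thesis
        using sublinear_scale[OF q, of "- r" x] neg[of "r *\<^sub>R x"] by simp
    qed (use sublinear_scale[OF q] sublinear_zero[OF q] in auto)
  qed
qed

text \<open>Zorn's lemma yields a minimal sublinear functional below \<open>p\<close>. A chain has a pointwise infimum since
all its members lie above \<open>x \<mapsto> - p (- x)\<close>.\<close>

lemma linear_below_sublinear:
  fixes p :: "'a::real_vector \<Rightarrow> real"
  assumes p: "sublinear p"
  obtains f where "linear f" "\<And>x. f x \<le> p x"
proof -
  let ?A = "{q. sublinear q \<and> (\<forall>x. q x \<le> p x)}"
  let ?P = "\<lambda>q r::'a \<Rightarrow> real. r \<le> q"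
  have "\<exists>m\<in>?A. \<forall>a\<in>?A. ?P m a \<longrightarrow> a = m"
  proof (rule predicate_Zorn)
    show "partial_order_on ?A (relation_of ?P ?A)"
      by (rule partial_order_on_relation_ofI) auto
  next
    fix C assume C: "C \<in> Chains (relation_of ?P ?A)"
    then have sub: "C \<subseteq> ?A" and ch: "\<And>q r. q \<in> C \<Longrightarrow> r \<in> C \<Longrightarrow> q \<le> r \<or> r \<le> q"
      by (auto simp: Chains_def relation_of_def)
    show "\<exists>u\<in>?A. \<forall>a\<in>C. ?P a u"
    proof (cases "C = {}")
      case True
      then show ?thesis using p by auto
    next
      case False
      define u where "u x = (INF q\<in>C. q x)" for x
      have lb: "- p (- x) \<le> q x" if "q \<in> C" for q x
        using sublinear_lower[of q x] that sub by (metis (mono_tags, lifting) CollectD neg_le_iff_le order_trans subset_iff)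
      then have bdd: "bdd_below ((\<lambda>q. q x) ` C)" for x
        by (intro bdd_belowI2)
      have up: "u x \<le> q x" if "q \<in> C" for q x
        unfolding u_def by (rule cINF_lower[OF bdd that])
      have gr: "b \<le> u x" if "\<And>q. q \<in> C \<Longrightarrow> b \<le> q x" for b x
        unfolding u_def by (rule cINF_greatest[OF False that])
      have "sublinear u"
        unfolding sublinear_def
      proof (intro conjI allI impI)
        fix x y
        have "u (x + y) \<le> q x + r y" if qr: "q \<in> C" "r \<in> C" for q r
        proof -
          obtain w where w: "w \<in> C" "w \<le> q" "w \<le> r" using ch[OF qr] qr by blast
          have "u (x + y) \<le> w (x + y)" by (rule up[OF w(1)])
          also have "\<dots> \<le> w x + w y" using w sub by (auto intro: sublinear_add)
          also have "\<dots> \<le> q x + r y" using w by (intro add_mono) (auto simp: le_fun_def)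
          finally show ?thesis .
        qed
        then have "u (x + y) - q x \<le> r y" if "q \<in> C" "r \<in> C" for q r
          using that by (simp add: diff_le_eq add.commute)
        then have "u (x + y) - q x \<le> u y" if "q \<in> C" for q
          by (intro gr) (use that in blast)
        then have "u (x + y) - u y \<le> u x"
          by (intro gr) (simp add: algebra_simps)
        then show "u (x + y) \<le> u x + u y" by simp
      next
        fix t :: real and x assume t: "t > 0"
        have sc: "q (t *\<^sub>R x) = t * q x" if "q \<in> C" for q
          using that sub t by (auto intro: sublinear_scale)
        have "u (t *\<^sub>R x) / t \<le> u x"
          by (rule gr) (use up[of _ "t *\<^sub>R x"] sc t in \<open>auto simp: field_simps\<close>)
        moreover have "t * u x \<le> u (t *\<^sub>R x)"
          by (rule gr) (simp add: sc t up less_imp_le mult_left_mono)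
        ultimately show "u (t *\<^sub>R x) = t * u x" using t by (simp add: field_simps)
      qed
      moreover obtain q where q: "q \<in> C" using False by blast
      have "u x \<le> p x" for x
        using up[OF q, of x] sub q by (auto intro: order_trans)
      ultimately show ?thesis using up by (intro bexI[of _ u]) (auto simp: le_fun_def)
    qed
  qed
  then obtain m where m: "sublinear m" "\<And>x. m x \<le> p x"
    and min: "\<And>a. sublinear a \<Longrightarrow> (\<forall>x. a x \<le> p x) \<Longrightarrow> a \<le> m \<Longrightarrow> a = m"
    by auto
  have "linear m"
  proof (rule minimal_sublinear_linear[OF m(1)])
    fix a assume a: "sublinear a" "\<And>x. a x \<le> m x"
    then have "\<forall>x. a x \<le> p x" using m(2) order_trans by blast
    with a show "a = m" by (intro min) (auto simp: le_fun_def)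
  qed
  then show ?thesis using m that by blast
qed

text \<open>The demands are that the functional be at least \<open>d\<close> at \<open>x0\<close> and nonnegative at \<open>- k\<close> for \<open>k \<in> K\<close>;
since \<open>K\<close> is a subspace, the latter forces it to vanish on \<open>K\<close>.\<close>

theorem hahn_banach_distance:
  fixes K :: "'a::real_normed_vector set" and x0 :: 'a
  assumes K: "subspace K" and d: "\<And>k. k \<in> K \<Longrightarrow> d \<le> norm (x0 - k)"
  obtains g :: "'a \<Rightarrow>\<^sub>L real"
  where "norm g \<le> 1" "\<And>k. k \<in> K \<Longrightarrow> g k = 0" "d \<le> g x0"
proof -
  let ?S = "{(t *\<^sub>R x0 - k, t * d) | t k. t \<ge> 0 \<and> k \<in> K}"
  obtain p where p: "sublinear p" "\<And>x. p x \<le> norm x"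
      and up: "\<And>x c s. (c, s) \<in> ?S \<Longrightarrow> p x \<le> norm (x + c) - s"
  proof (rule sublinear_reduce[OF sublinear_norm, of ?S])
    show "(0, 0) \<in> ?S" using subspace_0[OF K] by force
    show "(c + e, s + t) \<in> ?S" if "(c, s) \<in> ?S" "(e, t) \<in> ?S" for c s e t
    proof -
      from that obtain u k w l where "u \<ge> 0" "w \<ge> 0" "k \<in> K" "l \<in> K"
        "c = u *\<^sub>R x0 - k" "s = u * d" "e = w *\<^sub>R x0 - l" "t = w * d" by auto
      then show ?thesis
        by (auto intro!: exI[of _ "u + w"] exI[of _ "k + l"] subspace_add[OF K] simp: algebra_simps)
    qed
    show "(r *\<^sub>R c, r * s) \<in> ?S" if "r > 0" "(c, s) \<in> ?S" for r c s
    proof -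
      from that obtain u k where "u \<ge> 0" "k \<in> K" "c = u *\<^sub>R x0 - k" "s = u * d" by auto
      then show ?thesis using that(1)
        by (auto intro!: exI[of _ "r * u"] exI[of _ "r *\<^sub>R k"] subspace_scale[OF K] simp: scaleR_diff_right)
    qed
    show "s \<le> norm c" if "(c, s) \<in> ?S" for c s
    proof -
      from that obtain u k where u: "u \<ge> 0" "k \<in> K" "c = u *\<^sub>R x0 - k" "s = u * d" by auto
      show ?thesis
      proof (cases "u = 0")
        case False
        then have "c = u *\<^sub>R (x0 - (1 / u) *\<^sub>R k)" using u by (simp add: algebra_simps)
        then have "norm c = u * norm (x0 - (1 / u) *\<^sub>R k)" using u by simp
        also have "\<dots> \<ge> u * d" using u by (intro mult_left_mono d subspace_scale[OF K])
        finally show ?thesis using u by simp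
      qed (use u in simp)
    qed
  qed blast
  obtain f where f: "linear f" "\<And>x. f x \<le> p x"
    using linear_below_sublinear[OF p(1)] by blast
  have le: "f x \<le> norm x" for x using f(2) p(2) order_trans by blast
  have abs_le: "\<bar>f x\<bar> \<le> norm x" for x
    using le[of x] le[of "- x"] linear_neg[OF f(1), of x] by (simp add: abs_le_iff)
  have bl: "bounded_linear f"
  proof (rule bounded_linear_intro)
    show "f (x + y) = f x + f y" for x y by (rule linear_add[OF f(1)])
    show "f (r *\<^sub>R x) = r *\<^sub>R f x" for r x by (rule linear_scale[OF f(1)])
    show "norm (f x) \<le> norm x * 1" for x
      using abs_le[of x] by simp
  qed
  have fK: "f k \<le> 0" if "k \<in> K" for k
  proof -
    have "(- k, 0) \<in> ?S" using that by (force intro: exI[of _ 0])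
    from up[OF this, of k] f(2)[of k] show ?thesis by simp
  qed
  have "(x0, d) \<in> ?S" using subspace_0[OF K] by (force intro: exI[of _ 1])
  from up[OF this, of "- x0"] f(2)[of "- x0"] have x0: "d \<le> f x0"
    using linear_neg[OF f(1), of x0] by simp
  show ?thesis
  proof (rule that[of "Blinfun f"])
    show "norm (Blinfun f) \<le> 1"
      by (rule norm_blinfun_bound) (simp_all add: bounded_linear_Blinfun_apply[OF bl] abs_le)
    show "Blinfun f k = 0" if "k \<in> K" for k
      using fK[OF that] fK[OF subspace_neg[OF K that]] linear_neg[OF f(1), of k]
      by (simp add: bounded_linear_Blinfun_apply[OF bl])
    show "d \<le> Blinfun f x0" using x0 by (simp add: bounded_linear_Blinfun_apply[OF bl])
  qed
qed

corollary norming_functional: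
  fixes x :: "'a::real_normed_vector"
  obtains g :: "'a \<Rightarrow>\<^sub>L real" where "norm g \<le> 1" "norm x \<le> g x"
  by (rule hahn_banach_distance[of "{0}" "norm x" x]) (auto simp: subspace_single_0)

text \<open>Induction on the number of functionals: if the last one does not vanish on the common kernel of the
others, subtracting a multiple of it from \<open>g\<close> reduces to the others; if it does, the others already suffice.\<close>

lemma functional_in_span:
  fixes f :: "nat \<Rightarrow> 'a::real_vector \<Rightarrow> real"
  assumes "\<And>i. i < n \<Longrightarrow> linear (f i)" and "linear g"
    and "\<And>x. (\<And>i. i < n \<Longrightarrow> f i x = 0) \<Longrightarrow> g x = 0"
  shows "\<exists>c. \<forall>x. g x = (\<Sum>i<n. c i * f i x)"
  using assms
proof (induction n arbitrary: g)
  case 0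
  then show ?case by auto
next
  case (Suc n)
  show ?case
  proof (cases "\<exists>y. (\<forall>i<n. f i y = 0) \<and> f n y \<noteq> 0")
    case True
    then obtain y where y: "\<And>i. i < n \<Longrightarrow> f i y = 0" "f n y \<noteq> 0" by blast
    define g' where "g' x = g x - g y / f n y * f n x" for x
    have fn: "linear (f n)" using Suc.prems(1) by simp
    have "\<exists>c. \<forall>x. g' x = (\<Sum>i<n. c i * f i x)"
    proof (rule Suc.IH)
      show "linear g'"
        unfolding g'_def by (rule linearI)
          (simp_all add: linear_add[OF fn] linear_add[OF Suc.prems(2)] linear_scale[OF fn] linear_scale[OF Suc.prems(2)] algebra_simps add_divide_distrib)
      show "g' x = 0" if x: "\<And>i. i < n \<Longrightarrow> f i x = 0" for x
      proof -
        have "g (x - (f n x / f n y) *\<^sub>R y) = 0"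
        proof (rule Suc.prems(3))
          fix i assume "i < Suc n"
          then have "linear (f i)" using Suc.prems(1) by simp
          then have "f i (x - (f n x / f n y) *\<^sub>R y) = f i x - f n x / f n y * f i y"
            by (simp add: linear_diff linear_scale)
          with \<open>i < Suc n\<close> x y show "f i (x - (f n x / f n y) *\<^sub>R y) = 0"
            by (cases "i = n") auto
        qed
        then show ?thesis
          using Suc.prems(2) by (simp add: g'_def linear_diff linear_scale)
      qed
    qed (use Suc.prems in auto)
    then obtain c where c: "\<And>x. g' x = (\<Sum>i<n. c i * f i x)" by blast
    show ?thesis
    proof (intro exI[of _ "c(n := g y / f n y)"] allI)
      fix x
      show "g x = (\<Sum>i<Suc n. (c(n := g y / f n y)) i * f i x)"
        using c[of x] by (simp add: g'_def)
    qed
  next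
    case False
    then have "g x = 0" if "\<And>i. i < n \<Longrightarrow> f i x = 0" for x
      using that by (intro Suc.prems(3)) (auto simp: less_Suc_eq)
    then obtain c where c: "\<And>x. g x = (\<Sum>i<n. c i * f i x)"
      using Suc.IH[of g] Suc.prems by auto
    show ?thesis
      by (intro exI[of _ "c(n := 0)"]) (use c in simp)
  qed
qed

text \<open>The system is solvable as soon as the right-hand sides satisfy every linear relation that holds
between the functionals.\<close>

lemma solve_functional_equations:
  fixes f :: "nat \<Rightarrow> 'a::real_vector \<Rightarrow> real"
  assumes "\<And>i. i < n \<Longrightarrow> linear (f i)"
    and "\<And>c. (\<And>x. (\<Sum>i<n. c i * f i x) = 0) \<Longrightarrow> (\<Sum>i<n. c i * v i) = 0"
  shows "\<exists>x. \<forall>i<n. f i x = v i"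
  using assms
proof (induction n)
  case (Suc n)
  have fn: "linear (f n)" using Suc.prems(1) by simp
  have "\<exists>x. \<forall>i<n. f i x = v i"
  proof (rule Suc.IH)
    show "(\<Sum>i<n. c i * v i) = 0" if "\<And>x. (\<Sum>i<n. c i * f i x) = 0" for c
      using Suc.prems(2)[of "c(n := 0)"] that by simp
  qed (use Suc.prems in auto)
  then obtain x where x: "\<And>i. i < n \<Longrightarrow> f i x = v i" by blast
  show ?case
  proof (cases "\<exists>y. (\<forall>i<n. f i y = 0) \<and> f n y \<noteq> 0")
    case True
    then obtain y where y: "\<And>i. i < n \<Longrightarrow> f i y = 0" "f n y \<noteq> 0" by blast
    let ?z = "x + ((v n - f n x) / f n y) *\<^sub>R y"
    have "f i ?z = v i" if "i < Suc n" for i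
    proof -
      have "linear (f i)" using that Suc.prems(1) by simp
      then have "f i ?z = f i x + (v n - f n x) / f n y * f i y"
        by (simp add: linear_add linear_scale)
      with that x y show ?thesis by (cases "i = n") auto
    qed
    then show ?thesis by blast
  next
    case False
    have "\<exists>c. \<forall>x. f n x = (\<Sum>i<n. c i * f i x)"
      by (rule functional_in_span) (use Suc.prems(1) False in auto)
    then obtain c where c: "\<And>x. f n x = (\<Sum>i<n. c i * f i x)" by blast
    have "(\<Sum>i<Suc n. (c(n := - 1)) i * v i) = 0"
      by (rule Suc.prems(2)) (use c in simp)
    then have "v n = (\<Sum>i<n. c i * v i)" by simp
    also have "\<dots> = f n x" using c[of x] x by simp
    finally show ?thesis using x by (auto simp: less_Suc_eq)
  qed
qed simp

text \<open>Take any solution \<open>x0\<close>. The other solutions are \<open>x0 - k\<close> with \<open>k\<close> in the common kernel, so the infimum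
of their norms is the distance of \<open>x0\<close> to the kernel. By Hahn-Banach a functional \<open>g\<close> of norm at
most \<open>1\<close> which vanishes on the kernel attains at least that distance at \<open>x0\<close>. It is a combination of the
given functionals, and the hypothesis bounds its value at \<open>x0\<close> by \<open>M\<close>.\<close>

theorem helly:
  fixes f :: "nat \<Rightarrow> 'a::real_normed_vector \<Rightarrow>\<^sub>L real"
  assumes M: "\<And>c. \<bar>\<Sum>i<n. c i * v i\<bar> \<le> M * norm (\<Sum>i<n. c i *\<^sub>R f i)" and "0 \<le> M" "M < M'"
  obtains x where "norm x \<le> M'" "\<And>i. i < n \<Longrightarrow> f i x = v i"
proof -
  have app: "blinfun_apply (\<Sum>i<n. c i *\<^sub>R f i) x = (\<Sum>i<n. c i * f i x)" for c x
    by (simp add: blinfun.sum_left blinfun.scaleR_left)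
  have lin: "linear (blinfun_apply h)" for h :: "'a \<Rightarrow>\<^sub>L real"
    using blinfun.bounded_linear_right bounded_linear.linear by blast
  have "\<exists>x. \<forall>i<n. blinfun_apply (f i) x = v i"
  proof (rule solve_functional_equations[OF lin])
    fix c assume "\<And>x. (\<Sum>i<n. c i * f i x) = 0"
    then have "(\<Sum>i<n. c i *\<^sub>R f i) = 0"
      by (intro blinfun_eqI) (simp add: app)
    with M[of c] show "(\<Sum>i<n. c i * v i) = 0" by simp
  qed
  then obtain x0 where x0: "\<And>i. i < n \<Longrightarrow> f i x0 = v i" by blast
  define K where "K = {x. \<forall>i<n. f i x = 0}"
  have K: "subspace K"
    by (simp add: K_def subspace_def blinfun.add_right blinfun.scaleR_right blinfun.zero_right)
  have "\<exists>k\<in>K. norm (x0 - k) < M'"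
  proof (rule ccontr)
    assume "\<not> ?thesis"
    then have ge: "M' \<le> norm (x0 - k)" if "k \<in> K" for k using that by force
    obtain g :: "'a \<Rightarrow>\<^sub>L real" where g: "norm g \<le> 1" "\<And>k. k \<in> K \<Longrightarrow> g k = 0" "M' \<le> g x0"
      using hahn_banach_distance[OF K ge] by blast
    have "\<exists>c. \<forall>x. blinfun_apply g x = (\<Sum>i<n. c i * blinfun_apply (f i) x)"
      by (rule functional_in_span[OF lin lin]) (auto intro: g(2) simp: K_def)
    then obtain c where c: "\<And>x. g x = (\<Sum>i<n. c i * f i x)" by blast
    then have geq: "g = (\<Sum>i<n. c i *\<^sub>R f i)"
      by (intro blinfun_eqI) (simp add: app)
    have "g x0 = (\<Sum>i<n. c i * v i)" using c[of x0] x0 by simp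
    also have "\<dots> \<le> M * norm g" using M[of c] geq by simp
    also have "\<dots> \<le> M" using g(1) \<open>0 \<le> M\<close> by (simp add: mult_left_le)
    finally show False using g(3) \<open>M < M'\<close> by simp
  qed
  then obtain k where "k \<in> K" "norm (x0 - k) < M'" by blast
  then show ?thesis using x0 by (intro that[of "x0 - k"]) (auto simp: K_def blinfun.diff_right)
qed

section \<open>Nonreflexive spaces\<close>

lemma bidual_embedding_apply [simp]: "bidual_embedding x g = g x"
  by (simp add: bidual_embedding.rep_eq)

lemma bounded_linear_bidual_embedding:
  "bounded_linear (bidual_embedding :: 'a::real_normed_vector \<Rightarrow> ('a \<Rightarrow>\<^sub>L real) \<Rightarrow>\<^sub>L real)"
proof (rule bounded_linear_intro)
  show "norm (bidual_embedding x) \<le> norm x * 1" for x :: 'a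
  proof (rule norm_blinfun_bound)
    show "norm (bidual_embedding x g) \<le> norm x * 1 * norm g" for g
      using norm_blinfun[of g x] by (simp add: mult.commute)
  qed simp
qed (auto intro!: blinfun_eqI simp: blinfun.add_left blinfun.add_right blinfun.scaleR_left blinfun.scaleR_right)

lemma norm_bidual_embedding_ge: "norm x \<le> norm (bidual_embedding x)"
proof -
  obtain g where g: "norm g \<le> 1" "norm x \<le> blinfun_apply g x" by (rule norming_functional)
  have "norm x \<le> norm (bidual_embedding x g)" using g(2) by simp
  also have "\<dots> \<le> norm (bidual_embedding x) * norm g" by (rule norm_blinfun)
  also have "\<dots> \<le> norm (bidual_embedding x)" using g(1) by (simp add: mult_left_le)
  finally show ?thesis .
qed

lemma closed_range_bidual_embedding:
  "closed (range (bidual_embedding :: 'a::banach \<Rightarrow> ('a \<Rightarrow>\<^sub>L real) \<Rightarrow>\<^sub>L real))"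
proof -
  have "complete (range (bidual_embedding :: 'a \<Rightarrow> ('a \<Rightarrow>\<^sub>L real) \<Rightarrow>\<^sub>L real))"
    by (rule complete_isometric_image[of 1])
      (auto simp: bounded_linear_bidual_embedding norm_bidual_embedding_ge complete_UNIV)
  then show ?thesis by (rule complete_imp_closed)
qed

text \<open>James's construction. Fix \<open>F\<close> in the bidual at distance at least \<open>d > 0\<close> from the canonical image
of the space. Helly's theorem, alternately in the dual and in the space, provides \<open>g n\<close> which vanishes
on the vectors chosen so far and satisfies \<open>F (g n) = 1\<close>, and then \<open>x n\<close> on which all functionals chosen
so far take the same value \<open>1\<close> as \<open>F\<close> does. The norms are controlled by \<open>1 / d\<close> and by \<open>norm F\<close>.\<close>

theorem nonreflexive_triangular_system:
  fixes T :: "'a::banach itself"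
  assumes "\<not> reflexive_space T"
  obtains x :: "nat \<Rightarrow> 'a" and g :: "nat \<Rightarrow> 'a \<Rightarrow>\<^sub>L real" and M R :: real
  where "\<And>n. norm (x n) \<le> R" "\<And>n. norm (g n) \<le> M" "\<And>n i. g n (x i) = (if n \<le> i then 1 else 0)"
proof -
  obtain F :: "('a \<Rightarrow>\<^sub>L real) \<Rightarrow>\<^sub>L real" where F: "F \<notin> range bidual_embedding"
    using assms unfolding reflexive_space_def by blast
  obtain d where d: "d > 0" and dF: "\<And>x. d \<le> norm (F - bidual_embedding x)"
  proof -
    have "open (- range (bidual_embedding :: 'a \<Rightarrow> _))"
      using closed_range_bidual_embedding by (rule open_Compl)
    then obtain d where "d > 0" "ball F d \<subseteq> - range bidual_embedding"
      using F unfolding open_contains_ball by blast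
    then show ?thesis
      by (intro that[of d]) (force simp: dist_norm not_less[symmetric])+
  qed
  note lin = bounded_linear.linear[OF bounded_linear_bidual_embedding]
  define M where "M = 1 / d + 1"
  define R where "R = norm F + 1"
  define good :: "nat \<Rightarrow> (nat \<Rightarrow> 'a \<times> ('a \<Rightarrow>\<^sub>L real)) \<Rightarrow> bool" where
    "good n h \<longleftrightarrow> (\<forall>i<n. norm (fst (h i)) \<le> R \<and> norm (snd (h i)) \<le> M \<and> F (snd (h i)) = 1 \<and>
       (\<forall>j<n. snd (h j) (fst (h i)) = (if j \<le> i then 1 else 0)))" for n h
  have step: "\<exists>h'. good (Suc n) h' \<and> (\<forall>i<n. h' i = h i)" if h: "good n h" for n h
  proof -
    let ?J = "\<lambda>i. if i < n then bidual_embedding (fst (h i)) else F"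
    obtain u where u: "norm u \<le> M" "\<And>i. i < Suc n \<Longrightarrow> blinfun_apply (?J i) u = (if i < n then 0 else 1)"
    proof (rule helly[where n="Suc n" and v="\<lambda>i. if i < n then 0 else 1" and M="1 / d" and f="?J" and M'=M])
      fix c :: "nat \<Rightarrow> real"
      let ?s = "\<Sum>i<n. c i *\<^sub>R fst (h i)"
      have sJ: "(\<Sum>i<n. c i *\<^sub>R bidual_embedding (fst (h i))) = bidual_embedding ?s"
        by (simp add: linear_sum[OF lin] linear_scale[OF lin])
      have "\<bar>c n\<bar> * d \<le> norm (bidual_embedding ?s + c n *\<^sub>R F)"
      proof (cases "c n = 0")
        case False
        have "bidual_embedding ?s + c n *\<^sub>R F = c n *\<^sub>R (F - bidual_embedding (- (1 / c n) *\<^sub>R ?s))"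
          using False by (simp only: linear_scale[OF lin]) (simp add: algebra_simps)
        then have "norm (bidual_embedding ?s + c n *\<^sub>R F) = \<bar>c n\<bar> * norm (F - bidual_embedding (- (1 / c n) *\<^sub>R ?s))"
          by simp
        then show ?thesis using dF by (simp add: mult_left_mono)
      qed simp
      then show "\<bar>\<Sum>i<Suc n. c i * (if i < n then 0 else 1)\<bar> \<le> 1 / d * norm (\<Sum>i<Suc n. c i *\<^sub>R ?J i)"
        using d by (simp add: sJ field_simps)
    qed (use d in \<open>auto simp: M_def\<close>)
    let ?g = "\<lambda>j. if j < n then snd (h j) else u"
    have F1: "F (?g j) = 1" if "j < Suc n" for j
      using that h u(2)[of n] by (auto simp: good_def)
    obtain w where w: "norm w \<le> R" "\<And>j. j < Suc n \<Longrightarrow> blinfun_apply (?g j) w = 1"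
    proof (rule helly[where n="Suc n" and v="\<lambda>_. 1" and M="norm F" and f="?g" and M'=R])
      fix c :: "nat \<Rightarrow> real"
      have "F (\<Sum>j<Suc n. c j *\<^sub>R ?g j) = (\<Sum>j<Suc n. c j * F (?g j))"
        by (simp only: blinfun.sum_right blinfun.scaleR_right real_scaleR_def)
      also have "\<dots> = (\<Sum>j<Suc n. c j * 1)" using F1 by (intro sum.cong) auto
      finally have "\<bar>\<Sum>j<Suc n. c j * 1\<bar> = norm (F (\<Sum>j<Suc n. c j *\<^sub>R ?g j))" by simp
      also have "\<dots> \<le> norm F * norm (\<Sum>j<Suc n. c j *\<^sub>R ?g j)" by (rule norm_blinfun)
      finally show "\<bar>\<Sum>j<Suc n. c j * 1\<bar> \<le> norm F * norm (\<Sum>j<Suc n. c j *\<^sub>R ?g j)" .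
    qed (auto simp: R_def)
    have "good (Suc n) (h(n := (w, u)))"
      unfolding good_def
    proof (intro allI impI conjI)
      fix i j assume ij: "i < Suc n" "j < Suc n"
      show "snd ((h(n := (w, u))) j) (fst ((h(n := (w, u))) i)) = (if j \<le> i then 1 else 0)"
        using ij h w(2)[of j] u(2)[of i] by (auto simp: good_def less_Suc_eq)
    qed (use h w(1) u(1) F1[of n] in \<open>auto simp: good_def less_Suc_eq\<close>)
    then show ?thesis by (intro exI[of _ "h(n := (w, u))"]) auto
  qed
  have "\<exists>H. \<forall>n. good n (H n) \<and> (\<forall>i<n. H (Suc n) i = H n i)"
  proof (rule dependent_nat_choice)
    show "\<exists>h. good 0 h" by (simp add: good_def)
  qed (use step in blast)
  then obtain H where H: "\<And>n. good n (H n)" "\<And>n i. i < n \<Longrightarrow> H (Suc n) i = H n i" by blast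
  define h where "h i = H (Suc i) i" for i
  have hH: "H n i = h i" if "i < n" for n i
    using that
  proof (induction n)
    case (Suc n)
    then show ?case using H(2)[of i n] by (cases "i = n") (auto simp: h_def)
  qed simp
  have gd: "good n h" for n
    using H(1)[of n] hH by (simp add: good_def)
  show ?thesis
  proof (rule that[of "fst \<circ> h" R "snd \<circ> h" M])
    show "norm ((fst \<circ> h) n) \<le> R" "norm ((snd \<circ> h) n) \<le> M" for n
      using gd[of "Suc n"] by (auto simp: good_def)
    show "(snd \<circ> h) n ((fst \<circ> h) i) = (if n \<le> i then 1 else 0)" for n i
      using gd[of "Suc (max n i)"] by (auto simp: good_def less_Suc_eq_le)
  qed
qed

section \<open>Norm estimates in Tsirelson's space\<close>

lift_definition restr :: "nat set \<Rightarrow> tsirelson_c00 \<Rightarrow> tsirelson_c00" is coord_restrict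
  by (rule c00_coord_restrict)

lemma coords_restr: "coords (restr E x) i = (if i \<in> E then coords x i else 0)"
  by transfer (simp add: coord_restrict_def)

lemma coords_add: "coords (x + y) i = coords x i + coords y i"
  by transfer simp

lemma coords_scaleR: "coords (c *\<^sub>R x) i = c * coords x i"
  by transfer simp

lemma coords_zero: "coords 0 i = 0"
  by transfer simp

lemma coords_sum: "coords (\<Sum>i\<in>A. x i) j = (\<Sum>i\<in>A. coords (x i) j)"
  by (induction A rule: infinite_finite_induct) (auto simp: coords_add coords_zero)

lemma tsirelson_c00_eqI: "(\<And>i. coords x i = coords y i) \<Longrightarrow> x = y"
  by (metis coords_inject ext)

lemma coords_at_0: "coords x 0 = 0"
  using coords[of x] by (simp add: c00_def)

lemma finite_coords_support: "finite {i. coords x i \<noteq> 0}"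
  using coords[of x] by (simp add: c00_def)

lemma linear_restr: "linear (restr E)"
  by (rule linearI) (auto intro!: tsirelson_c00_eqI simp: coords_restr coords_add coords_scaleR)

lemma restr_restr: "restr E (restr F x) = restr (E \<inter> F) x"
  by (rule tsirelson_c00_eqI) (simp add: coords_restr)

lemma restr_id: "(\<And>i. coords x i \<noteq> 0 \<Longrightarrow> i \<in> E) \<Longrightarrow> restr E x = x"
  by (rule tsirelson_c00_eqI) (auto simp: coords_restr)

lemma restr_eq_0: "(\<And>i. i \<in> E \<Longrightarrow> coords x i = 0) \<Longrightarrow> restr E x = 0"
  by (rule tsirelson_c00_eqI) (auto simp: coords_restr coords_zero)

lemma abs_coords_le_norm: "\<bar>coords x i\<bar> \<le> norm x"
  by transfer (rule abs_le_tsirelson_norm)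

lemma tsirelson_norm_iter_restrict:
  assumes "x \<in> c00"
  shows "tsirelson_norm_iter k (coord_restrict E x) \<le> tsirelson_norm_iter k x"
  using assms
proof (induction k arbitrary: x)
  case 0
  have "\<bar>coord_restrict E x j\<bar> \<le> tsirelson_norm_iter 0 x" for j
    using abs_le_tsirelson_norm_iter[OF 0, of j 0] abs_le_tsirelson_norm_iter[OF 0, of 0 0]
    by (auto simp: coord_restrict_def)
  then show ?case
    using finite_abs_image[OF c00_coord_restrict[OF 0, of E]] by (auto intro!: Max.boundedI)
next
  case (Suc k)
  have "s \<le> Max (tsirelson_sums k x)" if s: "s \<in> tsirelson_sums k (coord_restrict E x)" for s
  proof -
    obtain n F where F: "admissible n F"
      and s: "s = (\<Sum>j=1..n. tsirelson_norm_iter k (coord_restrict (F j) (coord_restrict E x)))"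
      using s by blast
    have comm: "coord_restrict (F j) (coord_restrict E x) = coord_restrict E (coord_restrict (F j) x)" for j
      by (auto simp: coord_restrict_def)
    have "s \<le> (\<Sum>j=1..n. tsirelson_norm_iter k (coord_restrict (F j) x))"
      unfolding s comm by (intro sum_mono Suc.IH c00_coord_restrict Suc.prems)
    also have "\<dots> \<le> Max (tsirelson_sums k x)"
      by (intro Max_ge finite_tsirelson_sums Suc.prems) (use F in blast)
    finally show ?thesis .
  qed
  then have "Max (tsirelson_sums k (coord_restrict E x)) \<le> Max (tsirelson_sums k x)"
    using finite_tsirelson_sums[OF c00_coord_restrict[OF Suc.prems]] tsirelson_sums_nonempty
    by (subst Max_le_iff) blast+
  then show ?case
    using Suc.IH[OF Suc.prems] unfolding tsirelson_norm_iter.simps by linarith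
qed

lemma norm_restr_le: "norm (restr E x) \<le> norm x"
proof transfer
  fix E x assume x: "x \<in> c00"
  show "tsirelson_norm (coord_restrict E x) \<le> tsirelson_norm x"
    by (rule LIMSEQ_le[OF tsirelson_norm_LIMSEQ[OF c00_coord_restrict[OF x]] tsirelson_norm_LIMSEQ[OF x]])
      (use tsirelson_norm_iter_restrict[OF x] in blast)
qed

lemma tsirelson_norm_iter_le_norm:
  assumes "x \<in> c00"
  shows "tsirelson_norm_iter k x \<le> tsirelson_norm x"
  by (rule incseq_le[OF _ tsirelson_norm_LIMSEQ[OF assms]])
    (intro incseq_SucI tsirelson_norm_iter_mono)

text \<open>The next two lemmas express the implicit equation of Tsirelson's norm: one of its directions bounds the
admissible sums, the other one says that the norm is attained either by a coordinate or, up to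
any loss, by an admissible sum.\<close>

lemma sum_norm_restr_admissible:
  assumes "admissible n E"
  shows "(\<Sum>j=1..n. norm (restr (E j) x)) \<le> 2 * norm x"
  using assms
proof (transfer fixing: n E)
  fix x assume x: "x \<in> c00" and E: "admissible n E"
  have "(\<lambda>k. \<Sum>j=1..n. tsirelson_norm_iter k (coord_restrict (E j) x))
     \<longlonglongrightarrow> (\<Sum>j=1..n. tsirelson_norm (coord_restrict (E j) x))"
    by (intro tendsto_sum tsirelson_norm_LIMSEQ c00_coord_restrict x)
  moreover have "(\<Sum>j=1..n. tsirelson_norm_iter k (coord_restrict (E j) x)) \<le> 2 * tsirelson_norm x" for k
  proof -
    have "(\<Sum>j=1..n. tsirelson_norm_iter k (coord_restrict (E j) x)) \<le> Max (tsirelson_sums k x)"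
      by (intro Max_ge finite_tsirelson_sums x) (use E in blast)
    then have "(\<Sum>j=1..n. tsirelson_norm_iter k (coord_restrict (E j) x)) \<le> 2 * tsirelson_norm_iter (Suc k) x"
      unfolding tsirelson_norm_iter.simps by linarith
    then show ?thesis using tsirelson_norm_iter_le_norm[OF x, of "Suc k"] by linarith
  qed
  ultimately show "(\<Sum>j=1..n. tsirelson_norm (coord_restrict (E j) x)) \<le> 2 * tsirelson_norm x"
    by (intro LIMSEQ_le_const2) auto
qed

lemma less_norm_tsirelsonE:
  assumes "c < norm (x :: tsirelson_c00)"
  obtains j where "c < \<bar>coords x j\<bar>"
  | n E where "admissible n E" "2 * c < (\<Sum>j=1..n. norm (restr (E j) x))"
  using assms
proof (transfer fixing: c)
  fix x thesis
  assume x: "x \<in> c00" and 1: "\<And>j. c < \<bar>x j\<bar> \<Longrightarrow> thesis"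
    and 2: "\<And>n E. admissible n E \<Longrightarrow> 2 * c < (\<Sum>j=1..n. tsirelson_norm (coord_restrict (E j) x)) \<Longrightarrow> thesis"
    and c: "c < tsirelson_norm x"
  have "\<exists>k. c < tsirelson_norm_iter k x"
    using LIMSEQ_le_const2[OF tsirelson_norm_LIMSEQ[OF x], of c] c by (meson linorder_not_less)
  then obtain k where "c < tsirelson_norm_iter k x" "\<And>i. i < k \<Longrightarrow> tsirelson_norm_iter i x \<le> c"
    using exists_least_iff[of "\<lambda>k. c < tsirelson_norm_iter k x"] by (auto simp: not_less)
  then show thesis
  proof (cases k)
    case 0
    then have c0: "c < Max ((\<lambda>j. \<bar>x j\<bar>) ` {1..})" using \<open>c < tsirelson_norm_iter k x\<close> by simp
    have "Max ((\<lambda>j. \<bar>x j\<bar>) ` {1..}) \<in> (\<lambda>j. \<bar>x j\<bar>) ` {1..}"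
      by (rule Max_in[OF finite_abs_image[OF x]]) auto
    with c0 show ?thesis using 1 by (metis imageE)
  next
    case (Suc l)
    then have "tsirelson_norm_iter l x \<le> c" "c < tsirelson_norm_iter (Suc l) x"
      using \<open>c < tsirelson_norm_iter k x\<close> \<open>\<And>i. i < k \<Longrightarrow> tsirelson_norm_iter i x \<le> c\<close> by auto
    then have "2 * c < Max (tsirelson_sums l x)"
      unfolding tsirelson_norm_iter.simps by linarith
    moreover have "Max (tsirelson_sums l x) \<in> tsirelson_sums l x"
      by (rule Max_in[OF finite_tsirelson_sums[OF x] tsirelson_sums_nonempty])
    ultimately obtain n E where E: "admissible n E"
      and "2 * c < (\<Sum>j=1..n. tsirelson_norm_iter l (coord_restrict (E j) x))" by auto
    note this(2)
    also have "\<dots> \<le> (\<Sum>j=1..n. tsirelson_norm (coord_restrict (E j) x))"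
      by (intro sum_mono tsirelson_norm_iter_le_norm c00_coord_restrict x)
    finally show ?thesis using 2 E by blast
  qed
qed

lemma admissible_less:
  assumes E: "admissible n E" and "1 \<le> i" "i < j" "j \<le> n" and l: "l \<in> E i" "l' \<in> E j"
  shows "l < l'"
proof -
  have "Max (E i) < Min (E j)"
    using assms unfolding admissible_def by blast
  moreover have "finite (E i)" "finite (E j)"
    using assms unfolding admissible_def by auto
  ultimately have "Max (E i) < Min (E j)" "finite (E i)" "finite (E j)" .
  then show ?thesis using l by (meson Max_ge Min_le le_less_trans less_le_trans)
qed

lemma admissible_ge:
  assumes E: "admissible n E" and j: "j \<in> {1..n}" and l: "l \<in> E j"
  shows "n \<le> l"
proof -
  have n: "n \<le> Min (E 1)" and E1: "finite (E 1)" "E 1 \<noteq> {}"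
    using E unfolding admissible_def by simp_all
  show ?thesis
  proof (cases "j = 1")
    case True
    then show ?thesis using n E1 l by (meson Min_le order_trans)
  next
    case False
    then have "Min (E 1) < l"
      using admissible_less[OF E, of 1 j "Min (E 1)" l] Min_in[OF E1] j l by auto
    then show ?thesis using n by simp
  qed
qed

text \<open>The form in which admissibility is used for concentration: \<open>k\<close> successive intervals beyond \<open>k\<close>.\<close>

lemma sum_norm_restr_intervals:
  assumes ab: "\<And>i. i < k \<Longrightarrow> a i < b i" and ba: "\<And>i. Suc i < k \<Longrightarrow> b i \<le> a (Suc i)"
    and k: "k \<le> a 0"
  shows "(\<Sum>i<k. norm (restr {a i<..b i} x)) \<le> 2 * norm x"
proof (cases "k = 0")
  case False
  have mono: "b i \<le> a j" if "i < j" "j < k" for i j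
    using that
  proof (induction j)
    case (Suc j)
    then show ?case using ba[of j] ab[of j] by (cases "i = j") auto
  qed simp
  have a0: "k \<le> a i" if "i < k" for i
    using k mono[of 0 i] ab[of 0] that by (cases i) (auto intro: order_trans less_imp_le)
  let ?E = "\<lambda>j. {a (j - 1)<..b (j - 1)}"
  have mm: "Min (?E j) = Suc (a (j - 1))" "Max (?E j) = b (j - 1)" if "j \<in> {1..k}" for j
  proof -
    have "j - 1 < k" using that by auto
    from ab[OF this] show "Min (?E j) = Suc (a (j - 1))" "Max (?E j) = b (j - 1)"
      by (auto intro!: Min_eqI Max_eqI)
  qed
  have "admissible k ?E"
    unfolding admissible_def
  proof (intro conjI ballI allI impI)
    show "?E j \<noteq> {}" if "j \<in> {1..k}" for j
    proof -
      have "j - 1 < k" using that by auto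
      from ab[OF this] show ?thesis by auto
    qed
    show "k \<le> Min (?E 1)" using mm[of 1] k False by simp
    fix i j assume "1 \<le> i \<and> i < j \<and> j \<le> k"
    then have "i \<in> {1..k}" "j \<in> {1..k}" "i - 1 < j - 1" "j - 1 < k" by auto
    then show "Max (?E i) < Min (?E j)"
      by (simp only: mm mono less_Suc_eq_le)
  qed (use False in auto)
  then have "(\<Sum>j=1..k. norm (restr (?E j) x)) \<le> 2 * norm x" by (rule sum_norm_restr_admissible)
  moreover have "(\<Sum>j=1..k. norm (restr (?E j) x)) = (\<Sum>i<k. norm (restr {a i<..b i} x))"
    by (rule sum.reindex_bij_witness[of _ Suc "\<lambda>j. j - 1"]) auto
  ultimately show ?thesis by simp
qed simp

section \<open>The unit vector basis of Tsirelson's space is shrinking\<close>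

text \<open>A block split by the family is charged to the first set that meets it. Two split blocks cannot be
charged to the same set: a later set meets the earlier block, so the charged set ends before the
later block begins.\<close>

lemma card_split_blocks:
  fixes x :: "nat \<Rightarrow> tsirelson_c00" and p :: "nat \<Rightarrow> nat"
  assumes E: "admissible n E" and p: "mono p"
    and supp: "\<And>i l. i < r \<Longrightarrow> coords (x i) l \<noteq> 0 \<Longrightarrow> p i < l \<and> l \<le> p (Suc i)"
  shows "card {i. i < r \<and> (\<exists>j j'. 1 \<le> j \<and> j < j' \<and> j' \<le> n \<and> restr (E j) (x i) \<noteq> 0 \<and> restr (E j') (x i) \<noteq> 0)} \<le> n"
    (is "card ?B \<le> n")
proof -
  define J where "J i = (SOME j. \<exists>j'. 1 \<le> j \<and> j < j' \<and> j' \<le> n \<and> restr (E j) (x i) \<noteq> 0 \<and> restr (E j') (x i) \<noteq> 0)" for i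
  have J: "\<exists>j'. 1 \<le> J i \<and> J i < j' \<and> j' \<le> n \<and> restr (E (J i)) (x i) \<noteq> 0 \<and> restr (E j') (x i) \<noteq> 0"
    if "i \<in> ?B" for i
    unfolding J_def by (rule someI_ex) (use that in simp)
  have hit: "\<exists>l\<in>E j. p i < l \<and> l \<le> p (Suc i)" if "i < r" "restr (E j) (x i) \<noteq> 0" for i j
    using restr_eq_0[of "E j" "x i"] supp[OF that(1)] that(2) by blast
  have neq: "J i \<noteq> J i'" if i: "i \<in> ?B" "i' \<in> ?B" "i < i'" for i i'
  proof
    assume eq: "J i = J i'"
    obtain j' where j': "1 \<le> J i" "J i < j'" "j' \<le> n" "restr (E j') (x i) \<noteq> 0"
      using J[OF i(1)] by blast
    have "restr (E (J i)) (x i') \<noteq> 0" using J[OF i(2)] eq by auto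
    then obtain l where l: "l \<in> E (J i)" "p i' < l" using hit i(2) by blast
    obtain l' where l': "l' \<in> E j'" "l' \<le> p (Suc i)" using hit j'(4) i(1) by blast
    have "p (Suc i) \<le> p i'" using p i(3) by (simp add: monoD)
    then have "l' < l" using l l' by simp
    moreover have "l < l'" by (rule admissible_less[OF E j'(1-3) l(1) l'(1)])
    ultimately show False by simp
  qed
  define B where "B = ?B"
  have neqB: "J i \<noteq> J i'" if "i \<in> B" "i' \<in> B" "i < i'" for i i'
    using neq that unfolding B_def by blast
  have "inj_on J B"
    by (intro inj_onI) (metis neqB linorder_neqE_nat)
  moreover have "J ` B \<subseteq> {1..<Suc n}"
  proof
    fix j assume "j \<in> J ` B"
    then obtain i where i: "i \<in> B" "j = J i" by blast
    obtain j' where "1 \<le> J i" "J i < j'" "j' \<le> n" using J i(1) unfolding B_def by blast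
    with i show "j \<in> {1..<Suc n}" by simp
  qed
  ultimately have "card B \<le> card {1..<Suc n}" by (intro card_inj_on_le) auto
  then have "card ?B \<le> card {1..<Suc n}" by (simp only: B_def)
  then show ?thesis by simp
qed

text \<open>The value \<open>7/4\<close> arises from \<open>(2 + 1 + 1/2) / 2\<close>. An admissible family that meets the support of \<open>x0\<close>
has at most \<open>m\<close> members. It contributes at most \<open>2\<close> on \<open>x0\<close>; on the average it contributes \<open>1/r\<close> per
block, except for the at most \<open>m \<le> r/2\<close> blocks it splits, where the contribution is at most \<open>2/r\<close>. A family that
misses \<open>x0\<close> sees only the average, whose norm is at most \<open>1\<close>.\<close>

lemma norm_head_plus_average:
  fixes x0 :: tsirelson_c00 and r :: nat
  assumes x0: "norm x0 \<le> 1" "\<And>l. coords x0 l \<noteq> 0 \<Longrightarrow> l \<le> m"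
    and x: "\<And>i. i < r \<Longrightarrow> norm (x i) \<le> 1"
    and supp: "\<And>i l. i < r \<Longrightarrow> coords (x i) l \<noteq> 0 \<Longrightarrow> p i < l \<and> l \<le> p (Suc i)"
    and p: "mono p" "m \<le> p 0" and r: "2 * m \<le> r" "0 < r"
  shows "norm (x0 + (1 / real r) *\<^sub>R (\<Sum>i<r. x i)) \<le> 7 / 4"
proof (rule ccontr)
  define y where "y = (1 / real r) *\<^sub>R (\<Sum>i<r. x i)"
  assume "\<not> ?thesis"
  then have "7 / 4 < norm (x0 + y)" by (simp add: y_def)
  have ny: "norm y \<le> 1"
  proof -
    have "norm (\<Sum>i<r. x i) \<le> (\<Sum>i<r. 1)" using x by (intro sum_norm_le) auto
    then show ?thesis using r by (simp add: y_def field_simps)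
  qed
  show False using \<open>7 / 4 < norm (x0 + y)\<close>
  proof (cases rule: less_norm_tsirelsonE)
    case (1 l)
    show ?thesis
    proof (cases "l \<le> m")
      case True
      then have "coords (x i) l = 0" if "i < r" for i
        using supp[OF that, of l] p monoD[OF p(1), of 0 i] by fastforce
      then have "coords y l = 0" by (simp add: y_def coords_scaleR coords_sum)
      then show ?thesis using 1 abs_coords_le_norm[of x0 l] x0(1) by (simp add: coords_add)
    next
      case False
      then have "coords x0 l = 0" using x0(2) by blast
      then show ?thesis using 1 abs_coords_le_norm[of y l] ny by (simp add: coords_add)
    qed
  next
    case (2 n E)
    have split: "(\<Sum>j=1..n. norm (restr (E j) (x0 + y))) \<le>
        (\<Sum>j=1..n. norm (restr (E j) x0)) + (\<Sum>j=1..n. norm (restr (E j) y))"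
      unfolding sum.distrib[symmetric]
      by (intro sum_mono) (simp add: linear_add[OF linear_restr] norm_triangle_ineq)
    have h: "(\<Sum>j=1..n. norm (restr (E j) z)) \<le> 2 * norm z" for z
      by (rule sum_norm_restr_admissible[OF 2(1)])
    show ?thesis
    proof (cases "m < n")
      case True
      have "restr (E j) x0 = 0" if "j \<in> {1..n}" for j
      proof (rule restr_eq_0)
        fix l assume l: "l \<in> E j"
        have "n \<le> l" by (rule admissible_ge[OF 2(1) that l])
        then show "coords x0 l = 0" using True x0(2)[of l] by fastforce
      qed
      then show ?thesis using split h[of y] ny 2(2) by simp
    next
      case False
      define bad where "bad = {i. i < r \<and> (\<exists>j j'. 1 \<le> j \<and> j < j' \<and> j' \<le> n \<and> restr (E j) (x i) \<noteq> 0 \<and> restr (E j') (x i) \<noteq> 0)}"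
      have bad: "card bad \<le> n" unfolding bad_def by (rule card_split_blocks[OF 2(1) p(1) supp])
      have each: "(\<Sum>j=1..n. norm (restr (E j) (x i))) \<le> 1 + (if i \<in> bad then 1 else 0)" if i: "i < r" for i
      proof (cases "i \<in> bad")
        case True
        then show ?thesis using h[of "x i"] x[OF i] by simp
      next
        case nb: False
        show ?thesis
        proof (cases "\<exists>j\<in>{1..n}. restr (E j) (x i) \<noteq> 0")
          case True
          then obtain j where j: "j \<in> {1..n}" "restr (E j) (x i) \<noteq> 0" by blast
          have "restr (E j') (x i) = 0" if "j' \<in> {1..n} - {j}" for j'
          proof (rule ccontr)
            assume "restr (E j') (x i) \<noteq> 0"
            moreover from that have "j' \<in> {1..n}" "j' \<noteq> j" by auto
            moreover have "\<not> (1 \<le> a \<and> a < b \<and> b \<le> n \<and> restr (E a) (x i) \<noteq> 0 \<and> restr (E b) (x i) \<noteq> 0)" for a b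
              using nb i unfolding bad_def by blast
            ultimately show False using j by (metis atLeastAtMost_iff linorder_neqE_nat)
          qed
          then have "(\<Sum>j=1..n. norm (restr (E j) (x i))) = norm (restr (E j) (x i))"
            by (subst sum.remove[OF _ j(1)]) auto
          also have "\<dots> \<le> 1" using norm_restr_le x[OF i] order_trans by blast
          finally show ?thesis using nb by simp
        qed simp
      qed
      have "real r * (\<Sum>j=1..n. norm (restr (E j) y)) = (\<Sum>j=1..n. norm (\<Sum>i<r. restr (E j) (x i)))"
        using r by (simp add: y_def linear_scale[OF linear_restr] linear_sum[OF linear_restr] sum_distrib_left)
      also have "\<dots> \<le> (\<Sum>j=1..n. \<Sum>i<r. norm (restr (E j) (x i)))"
        by (intro sum_mono norm_sum)
      also have "\<dots> = (\<Sum>i<r. \<Sum>j=1..n. norm (restr (E j) (x i)))" by (rule sum.swap)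
      also have "\<dots> \<le> (\<Sum>i<r. 1 + (if i \<in> bad then 1 else 0))" by (intro sum_mono each) simp
      also have "\<dots> = real r + card bad"
      proof -
        have "{..<r} \<inter> bad = bad" by (auto simp: bad_def)
        then show ?thesis by (simp add: sum.distrib sum.If_cases)
      qed
      also have "\<dots> \<le> real r + m" using bad False by simp
      also have "\<dots> \<le> real r * (3 / 2)" using r(1) by simp
      finally have "(\<Sum>j=1..n. norm (restr (E j) y)) \<le> 3 / 2" using r(2) by simp
      then show ?thesis using split h[of x0] x0(1) 2(2) by simp
    qed
  qed
qed

lemma finite_support_bounded: "\<exists>N. \<forall>l. coords x l \<noteq> 0 \<longrightarrow> l \<le> N"
  using finite_coords_support[of x] finite_nat_set_iff_bounded_le by auto

text \<open>Let \<open>\<tau>\<close> be the limit of the norms \<open>t N\<close> of \<open>\<phi>\<close> on vectors supported beyond \<open>N\<close>. If \<open>\<tau> > 0\<close>, choose \<open>N0\<close> with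
\<open>t N0 < (1 + 1/20) \<tau>\<close> and successive blocks beyond \<open>N0\<close>, of norm at most \<open>1\<close>, on which \<open>\<phi>\<close> exceeds
\<open>(1 - 1/20) \<tau>\<close>. A block plus the average of many later ones then has value above \<open>1.9 \<tau>\<close>, while
\<open>norm_head_plus_average\<close> bounds it by \<open>21/20 * 7/4 * \<tau>\<close>, which is less than \<open>1.84 \<tau>\<close>.\<close>

theorem tsirelson_shrinking:
  fixes \<phi> :: "tsirelson_c00 \<Rightarrow> real"
  assumes \<phi>: "bounded_linear \<phi>" and e: "e > 0"
  shows "\<exists>N. \<forall>M\<ge>N. \<forall>x. \<bar>\<phi> (restr {M<..} x)\<bar> \<le> e * norm x"
proof -
  have lin: "linear \<phi>" using \<phi> by (rule bounded_linear.linear)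
  obtain B where B: "B \<ge> 0" "\<And>x. norm (\<phi> x) \<le> norm x * B" using bounded_linear.nonneg_bounded[OF \<phi>] by blast
  define S where "S N = {\<phi> (restr {N<..} x) | x. norm x \<le> 1}" for N :: nat
  define t where "t N = Sup (S N)" for N
  have zero: "0 \<in> S N" for N
    unfolding S_def using linear_0[OF lin] linear_0[OF linear_restr] by (intro CollectI exI[of _ 0]) simp
  have "v \<le> B" if v: "v \<in> S N" for v N
  proof -
    obtain x where x: "v = \<phi> (restr {N<..} x)" "norm x \<le> 1" using v unfolding S_def by blast
    have "norm v \<le> norm (restr {N<..} x) * B" unfolding x(1) by (rule B(2))
    also have "\<dots> \<le> 1 * B" using norm_restr_le[of "{N<..}" x] x(2) B(1) by (intro mult_right_mono) auto
    finally show ?thesis by simp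
  qed
  then have bdd: "bdd_above (S N)" for N by (meson bdd_aboveI)
  have upS: "v \<le> t N" if "v \<in> S N" for v N unfolding t_def by (rule cSup_upper[OF that bdd])
  have t0: "0 \<le> t N" for N using upS[OF zero] .
  have up: "\<bar>\<phi> (restr {N<..} x)\<bar> \<le> t N * norm x" for N x
  proof (cases "x = 0")
    case True
    then show ?thesis using linear_0[OF lin] linear_0[OF linear_restr] by simp
  next
    case False
    have "\<phi> (restr {N<..} (c *\<^sub>R x)) \<le> t N" if "\<bar>c\<bar> * norm x = 1" for c
      using that by (intro upS) (auto simp: S_def)
    then have "c * \<phi> (restr {N<..} x) \<le> t N" if "\<bar>c\<bar> * norm x = 1" for c
      using that by (simp add: linear_scale[OF lin] linear_scale[OF linear_restr])
    from this[of "1 / norm x"] this[of "- 1 / norm x"] False show ?thesis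
      by (simp add: field_simps abs_le_iff)
  qed
  have anti: "t M \<le> t N" if "N \<le> M" for M N
    unfolding t_def[of M]
  proof (rule cSup_least)
    show "S M \<noteq> {}" using zero by blast
    fix v assume "v \<in> S M"
    then obtain x where x: "v = \<phi> (restr {M<..} x)" "norm x \<le> 1" by (auto simp: S_def)
    have "restr {M<..} x = restr {N<..} (restr {M<..} x)"
      using that by (simp add: restr_restr) (metis Int_absorb1 greaterThan_subset_iff)
    then have "v = \<phi> (restr {N<..} (restr {M<..} x))" using x(1) by simp
    moreover have "norm (restr {M<..} x) \<le> 1" using norm_restr_le x(2) order_trans by blast
    ultimately show "v \<le> t N" by (intro upS) (auto simp: S_def)
  qed
  define \<tau> where "\<tau> = Inf (range t)"
  have bt: "bdd_below (range t)" using t0 by (intro bdd_belowI[of _ 0]) auto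
  have \<tau>le: "\<tau> \<le> t N" for N unfolding \<tau>_def by (intro cInf_lower bt) auto
  have "\<tau> \<ge> 0" unfolding \<tau>_def using t0 by (intro cInf_greatest) auto
  have "\<tau> = 0"
  proof (rule ccontr)
    assume "\<tau> \<noteq> 0"
    with \<open>\<tau> \<ge> 0\<close> have \<tau>: "\<tau> > 0" by simp
    then have "Inf (range t) < 21 / 20 * \<tau>" by (simp add: \<tau>_def)
    then obtain N0 where N0: "t N0 < 21 / 20 * \<tau>"
      using cInf_lessD[of "range t"] by blast
    have ex: "\<exists>x N'. norm x \<le> 1 \<and> 19 / 20 * \<tau> < \<phi> x \<and> N \<le> N' \<and> (\<forall>l. coords x l \<noteq> 0 \<longrightarrow> N < l \<and> l \<le> N')" for N
    proof -
      have "19 / 20 * \<tau> < Sup (S N)" using \<tau> \<tau>le[of N] by (simp add: t_def)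
      then obtain v where "v \<in> S N" "19 / 20 * \<tau> < v" using less_cSupD[of "S N"] zero by blast
      then obtain x where x: "norm x \<le> 1" "19 / 20 * \<tau> < \<phi> (restr {N<..} x)" by (auto simp: S_def)
      obtain N' where N': "\<And>l. coords x l \<noteq> 0 \<Longrightarrow> l \<le> N'" using finite_support_bounded by blast
      show ?thesis
        using x(2) order_trans[OF norm_restr_le x(1)] N'
        by (intro exI[of _ "restr {N<..} x"] exI[of _ "max N N'"]) (auto simp: coords_restr le_max_iff_disj)
    qed
    have "\<exists>f. \<forall>n. (n = 0 \<longrightarrow> snd (f n) = N0) \<and> (norm (fst (f (Suc n))) \<le> 1 \<and> 19 / 20 * \<tau> < \<phi> (fst (f (Suc n)))
        \<and> snd (f n) \<le> snd (f (Suc n)) \<and>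
        (\<forall>l. coords (fst (f (Suc n))) l \<noteq> 0 \<longrightarrow> snd (f n) < l \<and> l \<le> snd (f (Suc n))))"
    proof (rule dependent_nat_choice)
      show "\<exists>s::tsirelson_c00 \<times> nat. 0 = (0::nat) \<longrightarrow> snd s = N0" by auto
    qed (use ex in auto)
    then obtain f :: "nat \<Rightarrow> tsirelson_c00 \<times> nat" where f0: "snd (f 0) = N0"
      and f: "\<And>n. norm (fst (f (Suc n))) \<le> 1" "\<And>n. 19 / 20 * \<tau> < \<phi> (fst (f (Suc n)))"
        "\<And>n. snd (f n) \<le> snd (f (Suc n))"
        "\<And>n l. coords (fst (f (Suc n))) l \<noteq> 0 \<Longrightarrow> snd (f n) < l \<and> l \<le> snd (f (Suc n))"
      by blast
    define q where "q n = snd (f n)" for n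
    define x where "x n = fst (f (Suc n))" for n
    have q: "mono q" unfolding q_def mono_iff_le_Suc using f(3) by blast
    \<comment> \<open>The first block ends at \<open>q 1\<close>; averaging twice as many later blocks is enough.\<close>
    define r where "r = 2 * q 1 + 1"
    define z where "z = x 0 + (1 / real r) *\<^sub>R (\<Sum>i<r. x (Suc i))"
    have "norm z \<le> 7 / 4"
      unfolding z_def
    proof (rule norm_head_plus_average[where m="q 1" and p="\<lambda>i. q (Suc i)"])
      show "l \<le> q 1" if "coords (x 0) l \<noteq> 0" for l using f(4)[of 0 l] that by (simp add: x_def q_def)
      show "mono (\<lambda>i. q (Suc i))" using q by (auto simp: mono_def)
      show "q (Suc i) < l \<and> l \<le> q (Suc (Suc i))" if "i < r" "coords (x (Suc i)) l \<noteq> 0" for i l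
        using f(4)[of "Suc i" l] that by (simp add: x_def q_def)
    qed (auto simp: f x_def r_def)
    moreover have "restr {N0<..} z = z"
    proof -
      have "restr {N0<..} (x n) = x n" for n
      proof (rule restr_id)
        fix l assume "coords (x n) l \<noteq> 0"
        then have "q n < l" using f(4)[of n l] by (simp add: x_def q_def)
        moreover have "N0 \<le> q n" using monoD[OF q, of 0 n] f0 by (simp add: q_def)
        ultimately show "l \<in> {N0<..}" by simp
      qed
      then show ?thesis
        by (simp add: z_def linear_add[OF linear_restr] linear_scale[OF linear_restr] linear_sum[OF linear_restr])
    qed
    ultimately have "\<phi> z \<le> t N0 * (7 / 4)"
      using up[of N0 z] t0[of N0] by (metis abs_le_iff mult_left_mono order_trans)
    also have "\<dots> < 21 / 20 * \<tau> * (7 / 4)" using N0 by simp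
    finally have less: "\<phi> z < 147 / 80 * \<tau>" by simp
    have "real r * (19 / 20 * \<tau>) \<le> (\<Sum>i<r. \<phi> (x (Suc i)))"
      using sum_mono[of "{..<r}" "\<lambda>_. 19 / 20 * \<tau>" "\<lambda>i. \<phi> (x (Suc i))"] f(2) by (auto simp: x_def less_imp_le)
    then have "19 / 20 * \<tau> \<le> 1 / real r * (\<Sum>i<r. \<phi> (x (Suc i)))"
      by (simp add: r_def field_simps)
    moreover have "19 / 20 * \<tau> < \<phi> (x 0)" using f(2) by (simp add: x_def)
    moreover have "\<phi> z = \<phi> (x 0) + 1 / real r * (\<Sum>i<r. \<phi> (x (Suc i)))"
      by (simp add: z_def linear_add[OF lin] linear_scale[OF lin] linear_sum[OF lin])
    ultimately show False using less \<tau> by linarith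
  qed
  then have "Inf (range t) < e" using e by (simp add: \<tau>_def)
  then obtain N where N: "t N < e" using cInf_lessD[of "range t"] by blast
  have "\<bar>\<phi> (restr {M<..} x)\<bar> \<le> e * norm x" if "M \<ge> N" for M x
  proof -
    have "t M * norm x \<le> e * norm x" using anti[OF that] N by (intro mult_right_mono) auto
    with up[of M x] show ?thesis by linarith
  qed
  then show ?thesis by blast
qed

section \<open>Concentration of step-Lipschitz maps into the dual of Tsirelson's space\<close>

text \<open>Increasing lists of length \<open>k\<close> stand for the \<open>k\<close>-element sets of natural numbers. Only changes of a single
entry that keep the list increasing are considered. For the Hamming metric this amounts to the
Lipschitz condition.\<close>

definition step_lipschitz :: "nat \<Rightarrow> real \<Rightarrow> (nat list \<Rightarrow> 'b::metric_space) \<Rightarrow> bool" where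
  "step_lipschitz k L g \<longleftrightarrow>
     (\<forall>l n n' r. length (l @ n # r) = k \<and> sorted_wrt (<) (l @ n # r) \<and> sorted_wrt (<) (l @ n' # r) \<longrightarrow>
        dist (g (l @ n # r)) (g (l @ n' # r)) \<le> L)"

lemma step_lipschitzD:
  "step_lipschitz k L g \<Longrightarrow> length (l @ n # r) = k \<Longrightarrow> sorted_wrt (<) (l @ n # r) \<Longrightarrow>
    sorted_wrt (<) (l @ n' # r) \<Longrightarrow> dist (g (l @ n # r)) (g (l @ n' # r)) \<le> L"
  unfolding step_lipschitz_def by blast

text \<open>An infinite set of natural numbers is represented by its increasing enumeration \<open>\<sigma>\<close>.\<close>

definition oscillation_le :: "nat \<Rightarrow> (nat list \<Rightarrow> 'b::metric_space) \<Rightarrow> (nat \<Rightarrow> nat) \<Rightarrow> real \<Rightarrow> bool" where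
  "oscillation_le k h \<sigma> d \<longleftrightarrow>
     (\<forall>l l'. length l = k \<and> length l' = k \<and> sorted_wrt (<) l \<and> sorted_wrt (<) l' \<longrightarrow>
        dist (h (map \<sigma> l)) (h (map \<sigma> l')) \<le> d)"

lemma eventually_sorted_append:
  fixes U :: "nat filter"
  assumes "U \<le> sequentially" "sorted_wrt (<) l"
  shows "eventually (\<lambda>n. sorted_wrt (<) (l @ [n])) U"
proof -
  have "eventually (\<lambda>n. \<forall>x\<in>set l. x < n) U"
    by (rule filter_leD[OF assms(1)]) (intro eventually_ball_finite ballI eventually_gt_at_top finite_set)
  then show ?thesis by eventually_elim (use assms(2) in \<open>simp add: sorted_wrt_append\<close>)
qed

text \<open>Bounds on single steps pass to weak-star limits in the last entry, and the limit stays within one step of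
the function, because any two values of the last entry differ by one step.\<close>

lemma dual_step_limits:
  fixes f :: "nat list \<Rightarrow> 'a::real_normed_vector \<Rightarrow>\<^sub>L real"
  assumes U: "ultrafilter U" "U \<le> sequentially" and f: "step_lipschitz (Suc k) L f"
  obtains g :: "nat list \<Rightarrow> 'a \<Rightarrow>\<^sub>L real"
  where "step_lipschitz k L g"
    "\<And>l x. length l = k \<Longrightarrow> sorted_wrt (<) l \<Longrightarrow> ((\<lambda>n. f (l @ [n]) x) \<longlongrightarrow> g l x) U"
    "\<And>l n. length l = k \<Longrightarrow> sorted_wrt (<) (l @ [n]) \<Longrightarrow> norm (f (l @ [n]) - g l) \<le> L"
proof -
  have nb: "U \<noteq> bot" using U(1) by (simp add: ultrafilter_def)
  define g where "g l = (SOME \<psi>::'a \<Rightarrow>\<^sub>L real. \<forall>x. ((\<lambda>n. f (l @ [n]) x) \<longlongrightarrow> \<psi> x) U)" for l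
  have lim: "((\<lambda>n. f (l @ [n]) x) \<longlongrightarrow> g l x) U" if l: "length l = k" "sorted_wrt (<) l" for l x
  proof -
    note ev = eventually_sorted_append[OF U(2) l(2)]
    obtain n0 where n0: "sorted_wrt (<) (l @ [n0])"
      using eventually_happens'[OF nb ev] by blast
    have "eventually (\<lambda>n. norm (f (l @ [n])) \<le> L + norm (f (l @ [n0]))) U"
      using ev
    proof eventually_elim
      case (elim n)
      have "dist (f (l @ [n])) (f (l @ [n0])) \<le> L"
        by (rule step_lipschitzD[OF f]) (use l n0 elim in auto)
      then show ?case using norm_triangle_sub[of "f (l @ [n])" "f (l @ [n0])"] by (simp add: dist_norm)
    qed
    from dual_ball_ultralimit[OF U(1) this]
    have "\<forall>x. ((\<lambda>n. f (l @ [n]) x) \<longlongrightarrow> g l x) U" unfolding g_def by (rule someI_ex)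
    then show ?thesis ..
  qed
  have "step_lipschitz k L g"
    unfolding step_lipschitz_def
  proof (intro allI impI, elim conjE)
    fix l r :: "nat list" and n n'
    let ?s = "l @ n # r" and ?t = "l @ n' # r"
    assume len: "length ?s = k" and s: "sorted_wrt (<) ?s" and t: "sorted_wrt (<) ?t"
    have lt: "length ?t = k" using len by simp
    have "norm (g ?s - g ?t) \<le> L"
    proof (rule dual_ball_closed_under_limits[OF nb])
      show "((\<lambda>p. blinfun_apply (f (?s @ [p]) - f (?t @ [p])) x) \<longlongrightarrow> blinfun_apply (g ?s - g ?t) x) U" for x
        unfolding blinfun.diff_left by (intro tendsto_diff lim len lt s t)
      show "eventually (\<lambda>p. norm (f (?s @ [p]) - f (?t @ [p])) \<le> L) U"
        using eventually_sorted_append[OF U(2) s] eventually_sorted_append[OF U(2) t]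
      proof eventually_elim
        case (elim p)
        then show ?case
          using step_lipschitzD[OF f, of l n "r @ [p]" n'] len by (simp add: dist_norm)
      qed
    qed
    then show "dist (g ?s) (g ?t) \<le> L" by (simp add: dist_norm)
  qed
  moreover have "norm (f (l @ [n]) - g l) \<le> L" if l: "length l = k" "sorted_wrt (<) (l @ [n])" for l n
  proof (rule dual_ball_closed_under_limits[OF nb])
    have sl: "sorted_wrt (<) l" using l(2) by (simp add: sorted_wrt_append)
    show "((\<lambda>p. blinfun_apply (f (l @ [n]) - f (l @ [p])) x) \<longlongrightarrow> blinfun_apply (f (l @ [n]) - g l) x) U" for x
      unfolding blinfun.diff_left by (intro tendsto_diff tendsto_const lim l sl)
    show "eventually (\<lambda>p. norm (f (l @ [n]) - f (l @ [p])) \<le> L) U"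
      using eventually_sorted_append[OF U(2) sl]
    proof eventually_elim
      case (elim p)
      then show ?case using step_lipschitzD[OF f, of l n "[]" p] l by (simp add: dist_norm)
    qed
  qed
  ultimately show ?thesis using lim that by blast
qed

text \<open>Iterating the limit in the last entry extends \<open>f\<close> to all shorter tuples. The increments along a
branch of the resulting tree are bounded by \<open>L\<close> and weak-star null in the last entry.\<close>

lemma weak_star_tree:
  fixes f :: "nat list \<Rightarrow> 'a::real_normed_vector \<Rightarrow>\<^sub>L real"
  assumes U: "ultrafilter U" "U \<le> sequentially" and f: "step_lipschitz k L f"
  shows "\<exists>w::nat list \<Rightarrow> 'a \<Rightarrow>\<^sub>L real. (\<forall>l. length l = k \<longrightarrow> w l = f l) \<and>
    (\<forall>l x. length l < k \<and> sorted_wrt (<) l \<longrightarrow> ((\<lambda>n. w (l @ [n]) x) \<longlongrightarrow> w l x) U) \<and>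
    (\<forall>l n. length l < k \<and> sorted_wrt (<) (l @ [n]) \<longrightarrow> norm (w (l @ [n]) - w l) \<le> L)"
  using f
proof (induction k arbitrary: f)
  case 0
  then show ?case by (intro exI[of _ f]) simp
next
  case (Suc k)
  obtain g :: "nat list \<Rightarrow> 'a \<Rightarrow>\<^sub>L real" where g: "step_lipschitz k L g"
    "\<And>l x. length l = k \<Longrightarrow> sorted_wrt (<) l \<Longrightarrow> ((\<lambda>n. f (l @ [n]) x) \<longlongrightarrow> g l x) U"
    "\<And>l n. length l = k \<Longrightarrow> sorted_wrt (<) (l @ [n]) \<Longrightarrow> norm (f (l @ [n]) - g l) \<le> L"
    using dual_step_limits[OF U Suc.prems] by blast
  obtain w :: "nat list \<Rightarrow> 'a \<Rightarrow>\<^sub>L real" where w: "\<And>l. length l = k \<Longrightarrow> w l = g l"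
    "\<And>l x. length l < k \<Longrightarrow> sorted_wrt (<) l \<Longrightarrow> ((\<lambda>n. w (l @ [n]) x) \<longlongrightarrow> w l x) U"
    "\<And>l n. length l < k \<Longrightarrow> sorted_wrt (<) (l @ [n]) \<Longrightarrow> norm (w (l @ [n]) - w l) \<le> L"
    using Suc.IH[OF g(1)] by blast
  show ?case
    by (rule exI[of _ "\<lambda>l. if length l = Suc k then f l else w l"])
      (use g w in \<open>auto simp: less_Suc_eq\<close>)
qed

subsection \<open>Functionals on Tsirelson's space\<close>

lemma bounded_linear_to_completion: "bounded_linear (to_completion :: 'a::real_normed_vector \<Rightarrow> _)"
  by (rule bounded_linear_intro[where K=1])
    (simp_all add: linear_add[OF linear_to_completion] linear_scale[OF linear_to_completion])

lemma norm_completion_dual_le: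
  fixes y :: "'a::real_normed_vector completion \<Rightarrow>\<^sub>L real"
  assumes "B \<ge> 0" and le: "\<And>a. \<bar>y (to_completion a)\<bar> \<le> B * norm a"
  shows "norm y \<le> B"
proof (rule norm_blinfun_bound[OF assms(1)])
  fix x
  have "closed {x. norm (y x) \<le> B * norm x}"
    by (intro closed_Collect_le continuous_intros)
  moreover have "range to_completion \<subseteq> {x. norm (y x) \<le> B * norm x}" using le by auto
  ultimately have "closure (range to_completion) \<subseteq> {x. norm (y x) \<le> B * norm x}"
    by (rule closure_minimal[rotated])
  then show "norm (y x) \<le> B * norm x" using closure_range_to_completion by blast
qed

lift_definition unit_vector :: "nat \<Rightarrow> tsirelson_c00" is "\<lambda>j i. if i = j \<and> j \<noteq> 0 then 1 else 0"
  by (auto simp: c00_def)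

lemma coords_unit_vector: "coords (unit_vector j) i = (if i = j \<and> j \<noteq> 0 then 1 else 0)"
  by transfer simp

lemma restr_atMost_sum: "restr {..N} a = (\<Sum>j\<le>N. coords a j *\<^sub>R unit_vector j)"
proof (rule tsirelson_c00_eqI)
  fix i
  have "(\<Sum>j\<le>N. coords a j * coords (unit_vector j) i) = (\<Sum>j\<le>N. if j = i then coords a j else 0)"
    by (rule sum.cong) (auto simp: coords_unit_vector coords_at_0)
  then show "coords (restr {..N} a) i = coords (\<Sum>j\<le>N. coords a j *\<^sub>R unit_vector j) i"
    by (simp add: coords_restr coords_sum coords_scaleR)
qed

text \<open>Below \<open>N\<close> only finitely many coordinates matter, so pointwise convergence is uniform there.\<close>

lemma weak_star_null_heads:
  fixes y :: "nat \<Rightarrow> tsirelson_dual"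
  assumes y: "\<And>x. ((\<lambda>n. y n x) \<longlongrightarrow> 0) U" and e: "e > 0"
  shows "eventually (\<lambda>n. \<forall>a. \<bar>y n (to_completion (restr {..N} a))\<bar> \<le> e * norm a) U"
proof -
  have "((\<lambda>n. \<Sum>j\<le>N. \<bar>y n (to_completion (unit_vector j))\<bar>) \<longlongrightarrow> (\<Sum>j\<le>N. \<bar>0\<bar>)) U"
    by (intro tendsto_sum tendsto_rabs y)
  then have "eventually (\<lambda>n. (\<Sum>j\<le>N. \<bar>y n (to_completion (unit_vector j))\<bar>) < e) U"
    using e by (intro order_tendstoD(2)) auto
  then show ?thesis
  proof (eventually_elim, intro allI)
    fix n a assume less: "(\<Sum>j\<le>N. \<bar>y n (to_completion (unit_vector j))\<bar>) < e"
    have "\<bar>y n (to_completion (restr {..N} a))\<bar> = \<bar>\<Sum>j\<le>N. coords a j * y n (to_completion (unit_vector j))\<bar>"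
      by (simp add: restr_atMost_sum linear_sum[OF linear_to_completion] linear_scale[OF linear_to_completion]
          blinfun.sum_right blinfun.scaleR_right)
    also have "\<dots> \<le> (\<Sum>j\<le>N. \<bar>coords a j\<bar> * \<bar>y n (to_completion (unit_vector j))\<bar>)"
      using sum_abs by (simp add: abs_mult[symmetric])
    also have "\<dots> \<le> (\<Sum>j\<le>N. norm a * \<bar>y n (to_completion (unit_vector j))\<bar>)"
      by (intro sum_mono mult_right_mono abs_coords_le_norm) simp
    also have "\<dots> = norm a * (\<Sum>j\<le>N. \<bar>y n (to_completion (unit_vector j))\<bar>)"
      by (rule sum_distrib_left[symmetric])
    also have "\<dots> \<le> norm a * e"
      using less by (intro mult_left_mono) auto
    also have "\<dots> = e * norm a" by (rule mult.commute)
    finally show "\<bar>y n (to_completion (restr {..N} a))\<bar> \<le> e * norm a" .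
  qed
qed

lemma eventually_dual_tails:
  fixes y :: tsirelson_dual
  assumes "e > 0"
  shows "eventually (\<lambda>N. \<forall>a. \<bar>y (to_completion (restr {N<..} a))\<bar> \<le> e * norm a) sequentially"
proof -
  have "bounded_linear (\<lambda>a. y (to_completion a))"
    by (rule bounded_linear_compose[OF blinfun.bounded_linear_right bounded_linear_to_completion])
  from tsirelson_shrinking[OF this assms] show ?thesis by (simp add: eventually_sequentially)
qed

lemma almost_supported_dual_bound:
  fixes y :: tsirelson_dual
  assumes "N \<le> M" and "\<bar>y (to_completion (restr {..N} a))\<bar> \<le> e * norm a"
    and "\<bar>y (to_completion (restr {M<..} a))\<bar> \<le> e * norm a" and "norm y \<le> L"
  shows "\<bar>y (to_completion a)\<bar> \<le> L * norm (restr {N<..M} a) + 2 * e * norm a"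
proof -
  have "a = restr {..N} a + restr {N<..M} a + restr {M<..} a"
    using assms(1) by (intro tsirelson_c00_eqI) (auto simp: coords_restr coords_add)
  then have "y (to_completion a) = y (to_completion (restr {..N} a + restr {N<..M} a + restr {M<..} a))"
    by (rule arg_cong)
  also have "\<dots> = y (to_completion (restr {..N} a)) + y (to_completion (restr {N<..M} a))
      + y (to_completion (restr {M<..} a))"
    by (simp only: linear_add[OF linear_to_completion] blinfun.add_right)
  finally have "y (to_completion a) = y (to_completion (restr {..N} a)) + y (to_completion (restr {N<..M} a))
      + y (to_completion (restr {M<..} a))" .
  moreover have "\<bar>y (to_completion (restr {N<..M} a))\<bar> \<le> L * norm (restr {N<..M} a)"
    using norm_blinfun[of y "to_completion (restr {N<..M} a)"] mult_right_mono[OF assms(4) norm_ge_zero, of "restr {N<..M} a"]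
    by simp
  ultimately show ?thesis using assms(2,3) by linarith
qed

text \<open>The infinite set \<open>{m 1, m 2, \<dots>}\<close> is chosen together with cut points \<open>N j\<close> such that every increment of the tree
with last entry \<open>m (Suc j)\<close> and earlier entries at most \<open>m j\<close> is small on \<open>{..N j}\<close> (as it is weak-star
null) and on \<open>{N (Suc j)<..}\<close> (as the basis is shrinking). At each stage only finitely many
increments are involved.\<close>

theorem tsirelson_dual_concentration:
  fixes f :: "nat list \<Rightarrow> tsirelson_dual"
  assumes f: "step_lipschitz k L f" and L: "L > 0"
  shows "\<exists>\<sigma>. strict_mono \<sigma> \<and> oscillation_le k f \<sigma> (6 * L)"
proof -
  obtain U :: "nat filter" where U: "ultrafilter U" "U \<le> sequentially"
    using ultrafilter_below[of sequentially] by auto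
  have nb: "U \<noteq> bot" using U(1) by (simp add: ultrafilter_def)
  obtain w :: "nat list \<Rightarrow> tsirelson_dual" where wf: "\<And>l. length l = k \<Longrightarrow> w l = f l"
    and wlim: "\<And>l x. length l < k \<Longrightarrow> sorted_wrt (<) l \<Longrightarrow> ((\<lambda>n. w (l @ [n]) x) \<longlongrightarrow> w l x) U"
    and wL: "\<And>l n. length l < k \<Longrightarrow> sorted_wrt (<) (l @ [n]) \<Longrightarrow> norm (w (l @ [n]) - w l) \<le> L"
    using weak_star_tree[OF U f] by blast
  \<comment> \<open>Each of the \<open>k\<close> increments costs an error of \<open>2 * e\<close>; in total this is at most \<open>L\<close>.\<close>
  define e where "e = L / (2 * real k + 2)"
  have e: "e > 0" "2 * real k * e \<le> L" using L by (auto simp: e_def field_simps)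
  define head where "head y N \<longleftrightarrow> (\<forall>a. \<bar>blinfun_apply y (to_completion (restr {..N} a))\<bar> \<le> e * norm a)" for y :: tsirelson_dual and N
  define tail where "tail y N \<longleftrightarrow> (\<forall>a. \<bar>blinfun_apply y (to_completion (restr {N<..} a))\<bar> \<le> e * norm a)" for y :: tsirelson_dual and N
  define T where "T m = {l. set l \<subseteq> {..m} \<and> length l < k \<and> sorted_wrt (<) l}" for m :: nat
  have finT: "finite (T m)" for m
    by (rule finite_subset[OF _ finite_lists_length_le[of "{..m}" k]]) (auto simp: T_def)
  have step: "\<exists>m' N'. m < m' \<and> N < N' \<and> (\<forall>l\<in>T m. head (w (l @ [m']) - w l) N \<and> tail (w (l @ [m']) - w l) N')" for m N
  proof -
    have "eventually (\<lambda>n. head (w (l @ [n]) - w l) N) U" if "l \<in> T m" for l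
      unfolding head_def
    proof (rule weak_star_null_heads[OF _ e(1)])
      show "((\<lambda>n. (w (l @ [n]) - w l) x) \<longlongrightarrow> 0) U" for x
        using tendsto_diff[OF wlim tendsto_const, of l x "w l x"] that
        by (auto simp: T_def blinfun.diff_left)
    qed
    then have "eventually (\<lambda>n. \<forall>l\<in>T m. head (w (l @ [n]) - w l) N) U"
      by (intro eventually_ball_finite finT) blast
    moreover have "eventually (\<lambda>n. m < n) U" by (rule filter_leD[OF U(2) eventually_gt_at_top])
    ultimately have "eventually (\<lambda>n. (\<forall>l\<in>T m. head (w (l @ [n]) - w l) N) \<and> m < n) U" by (rule eventually_conj)
    then obtain m' where m': "\<forall>l\<in>T m. head (w (l @ [m']) - w l) N" "m < m'"
      using eventually_happens'[OF nb] by blast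
    have "eventually (\<lambda>M. \<forall>l\<in>T m. tail (w (l @ [m']) - w l) M) sequentially"
      unfolding tail_def by (intro eventually_ball_finite finT ballI eventually_dual_tails e)
    then have "eventually (\<lambda>M. (\<forall>l\<in>T m. tail (w (l @ [m']) - w l) M) \<and> N < M) sequentially"
      by (intro eventually_conj eventually_gt_at_top)
    then obtain N' where "\<forall>l\<in>T m. tail (w (l @ [m']) - w l) N'" "N < N'"
      using eventually_happens' sequentially_bot by blast
    with m' show ?thesis by blast
  qed
  have "\<exists>s. \<forall>j. (j = 0 \<longrightarrow> k \<le> snd (s j)) \<and> (fst (s j) < fst (s (Suc j)) \<and> snd (s j) < snd (s (Suc j)) \<and>
      (\<forall>l\<in>T (fst (s j)). head (w (l @ [fst (s (Suc j))]) - w l) (snd (s j)) \<and>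
         tail (w (l @ [fst (s (Suc j))]) - w l) (snd (s (Suc j)))))"
  proof (rule dependent_nat_choice)
    show "\<exists>s::nat \<times> nat. 0 = (0::nat) \<longrightarrow> k \<le> snd s" by (rule exI[of _ "(0, k)"]) simp
    fix s :: "nat \<times> nat" and j :: nat
    obtain m' N' where "fst s < m'" "snd s < N'" "\<forall>l\<in>T (fst s). head (w (l @ [m']) - w l) (snd s) \<and> tail (w (l @ [m']) - w l) N'"
      using step by blast
    then show "\<exists>s'. (Suc j = 0 \<longrightarrow> k \<le> snd s') \<and> (fst s < fst s' \<and> snd s < snd s' \<and>
      (\<forall>l\<in>T (fst s). head (w (l @ [fst s']) - w l) (snd s) \<and> tail (w (l @ [fst s']) - w l) (snd s')))"
      by (intro exI[of _ "(m', N')"]) simp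
  qed
  then obtain s :: "nat \<Rightarrow> nat \<times> nat" where s: "\<And>j. (j = 0 \<longrightarrow> k \<le> snd (s j)) \<and> (fst (s j) < fst (s (Suc j)) \<and> snd (s j) < snd (s (Suc j)) \<and>
      (\<forall>l\<in>T (fst (s j)). head (w (l @ [fst (s (Suc j))]) - w l) (snd (s j)) \<and>
         tail (w (l @ [fst (s (Suc j))]) - w l) (snd (s (Suc j)))))"
    by blast
  define m where "m j = fst (s j)" for j
  define N where "N j = snd (s j)" for j
  have N0: "k \<le> N 0" using s[of 0] by (simp add: N_def)
  have m: "strict_mono m" and N: "strict_mono N"
    unfolding strict_mono_Suc_iff m_def N_def using s by blast+
  have ht: "head (w (l @ [m (Suc j)]) - w l) (N j)" "tail (w (l @ [m (Suc j)]) - w l) (N (Suc j))"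
    if "l \<in> T (m j)" for l j
    using s[of j] that by (auto simp: m_def N_def)
  define \<sigma> where "\<sigma> j = m (Suc j)" for j
  have \<sigma>: "strict_mono \<sigma>" using m by (simp add: \<sigma>_def strict_mono_def)
  have main: "norm (f (map \<sigma> l) - w []) \<le> 3 * L" if l: "length l = k" "sorted_wrt (<) l" for l
  proof -
    define l' where "l' = map \<sigma> l"
    have ll: "length l' = k" using l by (simp add: l'_def)
    have nth: "l ! i < l ! j" if "i < j" "j < k" for i j
      using sorted_wrt_nth_less[OF l(2)] that l(1) by simp
    have sl': "sorted_wrt (<) l'"
      unfolding l'_def sorted_wrt_map by (rule sorted_wrt_mono_rel[OF _ l(2)]) (use \<sigma> in \<open>simp add: strict_mono_less\<close>)
    define y where "y i = w (take (Suc i) l') - w (take i l')" for i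
    have tk: "take (Suc i) l' = take i l' @ [m (Suc (l ! i))]" if "i < k" for i
      using that ll by (simp add: take_Suc_conv_app_nth l'_def \<sigma>_def l(1))
    have st: "sorted_wrt (<) (take i l')" for i using sl' by (rule sorted_wrt_take)
    have inT: "take i l' \<in> T (m (l ! i))" if i: "i < k" for i
    proof -
      have "x \<le> m (l ! i)" if "x \<in> set (take i l')" for x
      proof -
        obtain j where j: "j < i" "x = l' ! j" using \<open>x \<in> set (take i l')\<close> by (auto simp: in_set_conv_nth)
        then have "x = m (Suc (l ! j))" using i l(1) by (simp add: l'_def \<sigma>_def)
        moreover have "Suc (l ! j) \<le> l ! i" using nth j i by (simp add: Suc_leI)
        ultimately show ?thesis using m by (simp add: strict_mono_less_eq)
      qed
      then show ?thesis using i ll st by (auto simp: T_def)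
    qed
    have yb: "\<bar>y i (to_completion a)\<bar> \<le> L * norm (restr {N (l ! i)<..N (Suc (l ! i))} a) + 2 * e * norm a" if i: "i < k" for i a
    proof (rule almost_supported_dual_bound)
      show "N (l ! i) \<le> N (Suc (l ! i))" using N by (simp add: strict_mono_less_eq)
      show "\<bar>y i (to_completion (restr {..N (l ! i)} a))\<bar> \<le> e * norm a"
        using ht(1)[OF inT[OF i]] tk[OF i] by (simp add: y_def head_def)
      show "\<bar>y i (to_completion (restr {N (Suc (l ! i))<..} a))\<bar> \<le> e * norm a"
        using ht(2)[OF inT[OF i]] tk[OF i] by (simp add: y_def tail_def)
      show "norm (y i) \<le> L"
        using wL[of "take i l'" "m (Suc (l ! i))"] st[of "Suc i"] i ll by (simp add: y_def tk)
    qed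
    have sum: "f l' - w [] = (\<Sum>i<k. y i)"
      using sum_lessThan_telescope[of "\<lambda>i. w (take i l')" k] wf[OF ll] ll by (simp add: y_def)
    have "norm (f l' - w []) \<le> 3 * L"
    proof (rule norm_completion_dual_le)
      fix a
      have "\<bar>(f l' - w []) (to_completion a)\<bar> \<le> (\<Sum>i<k. \<bar>y i (to_completion a)\<bar>)"
        unfolding sum blinfun.sum_left by (rule sum_abs)
      also have "\<dots> \<le> (\<Sum>i<k. L * norm (restr {N (l ! i)<..N (Suc (l ! i))} a) + 2 * e * norm a)"
        by (intro sum_mono yb) simp
      also have "\<dots> = L * (\<Sum>i<k. norm (restr {N (l ! i)<..N (Suc (l ! i))} a)) + 2 * real k * e * norm a"
        by (simp add: sum.distrib sum_distrib_left)
      also have "\<dots> \<le> L * (2 * norm a) + L * norm a"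
      proof (intro add_mono mult_left_mono mult_right_mono e)
        show "(\<Sum>i<k. norm (restr {N (l ! i)<..N (Suc (l ! i))} a)) \<le> 2 * norm a"
        proof (rule sum_norm_restr_intervals)
          show "N (l ! i) < N (Suc (l ! i))" for i using N by (simp add: strict_mono_less)
          show "N (Suc (l ! i)) \<le> N (l ! Suc i)" if "Suc i < k" for i
            using nth[of i "Suc i"] that N by (simp add: strict_mono_less_eq Suc_leI)
          show "k \<le> N (l ! 0)" using N0 N by (meson order_trans strict_mono_less_eq zero_le)
        qed
      qed (use L in auto)
      finally show "\<bar>(f l' - w []) (to_completion a)\<bar> \<le> 3 * L * norm a" by simp
    qed (use L in simp)
    then show ?thesis by (simp add: l'_def)
  qed
  have "dist (f (map \<sigma> l)) (f (map \<sigma> l')) \<le> 6 * L"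
    if "length l = k" "length l' = k" "sorted_wrt (<) l" "sorted_wrt (<) l'" for l l'
    using main[of l] main[of l'] that norm_triangle_ineq4[of "f (map \<sigma> l) - w []" "f (map \<sigma> l') - w []"]
    by (simp add: dist_norm)
  then show ?thesis using \<sigma> by (intro exI[of _ \<sigma>]) (simp add: oscillation_le_def)
qed

section \<open>Concentration in spaces that embed into the dual of Tsirelson's space\<close>

lemma ennreal_dist_le_expansion_modulus:
  assumes "x \<in> S" "y \<in> S" "dist x y \<le> t"
  shows "ennreal (dist (f x) (f y)) \<le> expansion_modulus S f t"
  unfolding expansion_modulus_def by (rule Sup_upper) (use assms in blast)

lemma compression_modulus_le_ennreal_dist:
  assumes "x \<in> S" "y \<in> S" "t \<le> dist x y"
  shows "compression_modulus S f t \<le> ennreal (dist (f x) (f y))"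
  unfolding compression_modulus_def by (rule Inf_lower) (use assms in blast)

lemma sorted_wrt_map_strict_mono:
  fixes \<sigma> :: "nat \<Rightarrow> nat"
  assumes "strict_mono \<sigma>" "sorted_wrt (<) l"
  shows "sorted_wrt (<) (map \<sigma> l)"
  unfolding sorted_wrt_map by (rule sorted_wrt_mono_rel[OF _ assms(2)]) (use assms(1) in \<open>simp add: strict_mono_less\<close>)

lemma step_lipschitz_subsequence:
  assumes h: "step_lipschitz k L h" and \<sigma>: "strict_mono \<sigma>"
  shows "step_lipschitz k L (\<lambda>l. h (map \<sigma> l))"
  unfolding step_lipschitz_def
proof (intro allI impI, elim conjE)
  fix l r :: "nat list" and n n'
  assume "length (l @ n # r) = k" "sorted_wrt (<) (l @ n # r)" "sorted_wrt (<) (l @ n' # r)"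
  then show "dist (h (map \<sigma> (l @ n # r))) (h (map \<sigma> (l @ n' # r))) \<le> L"
    using step_lipschitzD[OF h, of "map \<sigma> l" "\<sigma> n" "map \<sigma> r" "\<sigma> n'"]
      sorted_wrt_map_strict_mono[OF \<sigma>, of "l @ n # r"] sorted_wrt_map_strict_mono[OF \<sigma>, of "l @ n' # r"]
    by simp
qed

lemma concentration_coarse:
  fixes f :: "'a::metric_space \<Rightarrow> tsirelson_dual"
  assumes f: "coarse_embedding_on UNIV f"
  shows "\<exists>C. \<forall>k (h :: nat list \<Rightarrow> 'a). step_lipschitz k 1 h \<longrightarrow> (\<exists>\<sigma>. strict_mono \<sigma> \<and> oscillation_le k h \<sigma> C)"
proof -
  obtain L where L: "L > 0" "\<And>x y. dist x y \<le> 1 \<Longrightarrow> dist (f x) (f y) \<le> L"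
  proof -
    have "expansion_modulus UNIV f 1 < \<infinity>" using f by (simp add: coarse_embedding_on_def)
    then obtain r where r: "0 \<le> r" "expansion_modulus UNIV f 1 = ennreal r"
      by (cases "expansion_modulus UNIV f 1") auto
    show ?thesis
    proof (rule that[of "r + 1"])
      fix x y :: 'a assume "dist x y \<le> 1"
      then have "ennreal (dist (f x) (f y)) \<le> ennreal r"
        using ennreal_dist_le_expansion_modulus[of x UNIV y 1 f] r(2) by simp
      then show "dist (f x) (f y) \<le> r + 1" using r(1) by (simp add: ennreal_le_iff)
    qed (use r in simp)
  qed
  have "eventually (\<lambda>t. ennreal (6 * L) < compression_modulus UNIV f t) at_top"
    using f unfolding coarse_embedding_on_def by (intro order_tendstoD(1)) auto
  then obtain C where C: "ennreal (6 * L) < compression_modulus UNIV f C"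
    using eventually_happens' trivial_limit_at_top_linorder by blast
  have far: "dist x y \<le> C" if "dist (f x) (f y) \<le> 6 * L" for x y
  proof (rule ccontr)
    assume "\<not> ?thesis"
    then have "compression_modulus UNIV f C \<le> ennreal (dist (f x) (f y))"
      by (intro compression_modulus_le_ennreal_dist) auto
    also have "\<dots> \<le> ennreal (6 * L)" using that by (rule ennreal_leI)
    finally show False using C by simp
  qed
  have "\<exists>\<sigma>. strict_mono \<sigma> \<and> oscillation_le k h \<sigma> C" if h: "step_lipschitz k 1 h" for k and h :: "nat list \<Rightarrow> 'a"
  proof -
    have "step_lipschitz k L (\<lambda>l. f (h l))"
      using h L(2) unfolding step_lipschitz_def by blast
    then obtain \<sigma> where "strict_mono \<sigma>" "oscillation_le k (\<lambda>l. f (h l)) \<sigma> (6 * L)"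
      using tsirelson_dual_concentration[OF _ L(1)] by blast
    then show ?thesis using far unfolding oscillation_le_def by blast
  qed
  then show ?thesis by blast
qed

text \<open>The image of the ball under the rescaled map must be compared at a fixed scale, here \<open>1/2\<close>: the bound
\<open>6 * L\<close> lies below the compression at \<open>1/2\<close>, and steps of size \<open>1 / C\<close> are expanded to at most \<open>L\<close>. Hence an
oscillation \<open>d > C\<close> can be replaced by \<open>d / 2\<close>, and finitely many halvings lead from the trivial bound to \<open>C\<close>.\<close>

lemma concentration_uniform:
  fixes f :: "'a::real_normed_vector \<Rightarrow> tsirelson_dual"
  assumes f: "uniform_embedding_on (cball 0 1) f"
  shows "\<exists>C. \<forall>k (h :: nat list \<Rightarrow> 'a) B. step_lipschitz k 1 h \<and> (\<forall>l. norm (h l) \<le> B) \<longrightarrow>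
    (\<exists>\<sigma>. strict_mono \<sigma> \<and> oscillation_le k h \<sigma> C)"
proof -
  obtain L where L: "L > 0" "ennreal (6 * L) < compression_modulus (cball 0 1) f (1 / 2)"
  proof -
    have "compression_modulus (cball 0 1) f (1 / 2) > 0" using f by (simp add: uniform_embedding_on_def)
    then obtain z where z: "0 < z" "z < compression_modulus (cball 0 1) f (1 / 2)" using dense by blast
    then obtain r where r: "0 \<le> r" "z = ennreal r" by (cases z) auto
    show ?thesis
      by (rule that[of "r / 6"]) (use z r in \<open>auto simp: ennreal_less_zero_iff\<close>)
  qed
  have "eventually (\<lambda>t. expansion_modulus (cball 0 1) f t < ennreal L) (at_right 0)"
    using f L(1) unfolding uniform_embedding_on_def by (intro order_tendstoD(2)) auto
  then obtain b where b: "b > 0" "\<And>t. 0 < t \<Longrightarrow> t < b \<Longrightarrow> expansion_modulus (cball 0 1) f t < ennreal L"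
    unfolding eventually_at_right_field by blast
  \<comment> \<open>Strictly above \<open>1 / b\<close>, so that a step of size \<open>1 / C\<close> lies in the range covered by \<open>b\<close>.\<close>
  define C where "C = 2 / b"
  have C: "C > 0" using b by (simp add: C_def)
  have near: "dist (f x) (f y) \<le> L" if "norm x \<le> 1" "norm y \<le> 1" "dist x y \<le> 1 / C" for x y
  proof -
    have "ennreal (dist (f x) (f y)) \<le> expansion_modulus (cball 0 1) f (1 / C)"
      by (rule ennreal_dist_le_expansion_modulus) (use that in auto)
    also have "\<dots> < ennreal L" using b C by (intro b(2)) (auto simp: C_def)
    finally show ?thesis using L(1) by (simp add: ennreal_less_iff)
  qed
  have far: "dist x y \<le> 1 / 2" if "norm x \<le> 1" "norm y \<le> 1" "dist (f x) (f y) \<le> 6 * L" for x y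
  proof (rule ccontr)
    assume "\<not> ?thesis"
    then have "compression_modulus (cball 0 1) f (1 / 2) \<le> ennreal (dist (f x) (f y))"
      using that by (intro compression_modulus_le_ennreal_dist) auto
    also have "\<dots> \<le> ennreal (6 * L)" using that by (intro ennreal_leI)
    finally show False using L by simp
  qed
  have "\<exists>\<sigma>. strict_mono \<sigma> \<and> oscillation_le k h \<sigma> C"
    if h: "step_lipschitz k 1 h" and hB: "\<And>l. norm (h l) \<le> B" for k and h :: "nat list \<Rightarrow> 'a" and B
  proof -
    have halve: "\<exists>\<sigma>. strict_mono \<sigma> \<and> oscillation_le k h \<sigma> (d / 2)"
      if \<sigma>: "strict_mono \<sigma>" "oscillation_le k h \<sigma> d" and d: "d > C" for d \<sigma>
    proof -
      define g where "g l = (1 / d) *\<^sub>R (h (map \<sigma> l) - h (map \<sigma> [0..<k]))" for l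
      have d0: "d > 0" using d C by simp
      have gball: "norm (g l) \<le> 1" if "length l = k" "sorted_wrt (<) l" for l
      proof -
        have "norm (g l) = dist (h (map \<sigma> l)) (h (map \<sigma> [0..<k])) / d"
          unfolding g_def norm_scaleR dist_norm using d0 by simp
        moreover have "dist (h (map \<sigma> l)) (h (map \<sigma> [0..<k])) \<le> d"
          using \<sigma>(2) that by (simp add: oscillation_le_def)
        ultimately show ?thesis using d0 by simp
      qed
      have gdist: "dist (g l) (g l') = dist (h (map \<sigma> l)) (h (map \<sigma> l')) / d" for l l'
      proof -
        have "g l - g l' = (1 / d) *\<^sub>R (h (map \<sigma> l) - h (map \<sigma> l'))"
          by (simp add: g_def scaleR_diff_right)
        then have "norm (g l - g l') = norm (h (map \<sigma> l) - h (map \<sigma> l')) / d"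
          using d0 by (simp only: norm_scaleR) simp
        then show ?thesis by (simp only: dist_norm)
      qed
      have "step_lipschitz k L (\<lambda>l. f (g l))"
        unfolding step_lipschitz_def
      proof (intro allI impI, elim conjE)
        fix l r :: "nat list" and n n'
        assume len: "length (l @ n # r) = k" and s: "sorted_wrt (<) (l @ n # r)" "sorted_wrt (<) (l @ n' # r)"
        have "dist (h (map \<sigma> (l @ n # r))) (h (map \<sigma> (l @ n' # r))) \<le> 1"
          by (rule step_lipschitzD[OF step_lipschitz_subsequence[OF h \<sigma>(1)] len s])
        then have "dist (g (l @ n # r)) (g (l @ n' # r)) \<le> 1 / d"
          unfolding gdist using d0 by (simp add: divide_right_mono)
        also have "\<dots> \<le> 1 / C" using d C by (simp add: frac_le)
        finally show "dist (f (g (l @ n # r))) (f (g (l @ n' # r))) \<le> L"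
          using len s by (intro near gball) auto
      qed
      then obtain \<tau> where \<tau>: "strict_mono \<tau>" "oscillation_le k (\<lambda>l. f (g l)) \<tau> (6 * L)"
        using tsirelson_dual_concentration[OF _ L(1)] by blast
      have "oscillation_le k h (\<sigma> \<circ> \<tau>) (d / 2)"
        unfolding oscillation_le_def
      proof (intro allI impI, elim conjE)
        fix l l' :: "nat list"
        assume l: "length l = k" "length l' = k" "sorted_wrt (<) l" "sorted_wrt (<) l'"
        have "dist (g (map \<tau> l)) (g (map \<tau> l')) \<le> 1 / 2"
          using l \<tau> by (intro far gball sorted_wrt_map_strict_mono) (auto simp: oscillation_le_def)
        then show "dist (h (map (\<sigma> \<circ> \<tau>) l)) (h (map (\<sigma> \<circ> \<tau>) l')) \<le> d / 2"
          unfolding gdist using d0 by (simp add: field_simps)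
      qed
      then show ?thesis using strict_mono_o[OF \<sigma>(1) \<tau>(1)] by blast
    qed
    have iter: "\<exists>\<sigma>. strict_mono \<sigma> \<and> oscillation_le k h \<sigma> (max C (2 * B / 2 ^ n))" for n
    proof (induction n)
      case 0
      have "dist (h l) (h l') \<le> 2 * B" for l l'
        using norm_triangle_ineq4[of "h l" "h l'"] hB[of l] hB[of l'] by (simp add: dist_norm)
      then show ?case
        by (intro exI[of _ id]) (auto simp: oscillation_le_def strict_mono_def le_max_iff_disj)
    next
      case (Suc n)
      show ?case
      proof (cases "2 * B / 2 ^ n \<le> C")
        case True
        have "2 * B / 2 ^ Suc n \<le> C"
        proof -
          have "2 * B / 2 ^ Suc n = (2 * B / 2 ^ n) / 2" by simp
          moreover have "a \<le> C" if "a = b / 2" "b \<le> C" for a b using that C by simp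
          ultimately show ?thesis using True by blast
        qed
        then show ?thesis using Suc True by (simp add: max_absorb1)
      next
        case False
        then obtain \<sigma> where "strict_mono \<sigma>" "oscillation_le k h \<sigma> (2 * B / 2 ^ n)"
          using Suc by (auto simp: max_absorb2)
        from halve[OF this] False obtain \<tau> where \<tau>: "strict_mono \<tau>" "oscillation_le k h \<tau> (2 * B / 2 ^ n / 2)" by auto
        have "2 * B / 2 ^ n / 2 = 2 * B / 2 ^ Suc n" by simp
        with \<tau> have "oscillation_le k h \<tau> (max C (2 * B / 2 ^ Suc n))"
          unfolding oscillation_le_def by (metis max.cobounded2 order_trans)
        with \<tau>(1) show ?thesis by blast
      qed
    qed
    have "(\<lambda>n. 2 * B / 2 ^ n) \<longlonglongrightarrow> 0" by (rule LIMSEQ_divide_realpow_zero) simp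
    then have "eventually (\<lambda>n. 2 * B / 2 ^ n < C) sequentially" using C by (rule order_tendstoD(2))
    then obtain n where "2 * B / 2 ^ n < C" using eventually_happens' sequentially_bot by blast
    then show ?thesis using iter[of n] by (simp add: max_absorb1)
  qed
  then show ?thesis by blast
qed

text \<open>The property of \<open>X\<close> that both conclusions of the theorem are derived from; what matters is that \<open>C\<close>
is independent of \<open>k\<close> and \<open>h\<close>.\<close>

definition bounded_concentration :: "'a::real_normed_vector itself \<Rightarrow> bool" where
  "bounded_concentration _ \<longleftrightarrow> (\<exists>C. \<forall>k (h :: nat list \<Rightarrow> 'a) B. step_lipschitz k 1 h \<and> (\<forall>l. norm (h l) \<le> B) \<longrightarrow>
    (\<exists>\<sigma>. strict_mono \<sigma> \<and> oscillation_le k h \<sigma> C))"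

text \<open>The map \<open>l \<mapsto> \<Sum>i<k. (c i / 2R) x (l ! i)\<close> is \<open>1\<close>-step-Lipschitz, since one step changes one summand.\<close>

lemma bounded_concentration_linear:
  assumes bc: "bounded_concentration TYPE('a::real_normed_vector)"
  shows "\<exists>C>0. \<forall>k (c :: nat \<Rightarrow> real) (x :: nat \<Rightarrow> 'a) R.
      (\<forall>i. \<bar>c i\<bar> \<le> 1) \<and> (\<forall>n. norm (x n) \<le> R) \<longrightarrow>
      (\<exists>\<sigma>. strict_mono \<sigma> \<and> (\<forall>p q :: nat \<Rightarrow> nat. strict_mono p \<and> strict_mono q \<longrightarrow>
         norm (\<Sum>i<k. c i *\<^sub>R (x (\<sigma> (p i)) - x (\<sigma> (q i)))) \<le> C * R))"
proof -
  obtain C where C: "\<And>k (h :: nat list \<Rightarrow> 'a) B. step_lipschitz k 1 h \<Longrightarrow> (\<And>l. norm (h l) \<le> B) \<Longrightarrow>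
    \<exists>\<sigma>. strict_mono \<sigma> \<and> oscillation_le k h \<sigma> C"
    using bc unfolding bounded_concentration_def by blast
  have "\<exists>\<sigma>. strict_mono \<sigma> \<and> (\<forall>p q :: nat \<Rightarrow> nat. strict_mono p \<and> strict_mono q \<longrightarrow>
         norm (\<Sum>i<k. c i *\<^sub>R (x (\<sigma> (p i)) - x (\<sigma> (q i)))) \<le> 2 * (\<bar>C\<bar> + 1) * R)"
    if c: "\<And>i. \<bar>c i\<bar> \<le> 1" and x: "\<And>n. norm (x n) \<le> R" for k and c :: "nat \<Rightarrow> real" and x :: "nat \<Rightarrow> 'a" and R
  proof (cases "R = 0")
    case True
    then have x0: "x n = 0" for n using x[of n] by simp
    show ?thesis by (intro exI[of _ id] conjI) (simp_all add: strict_mono_def True x0)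
  next
    case False
    have "R \<ge> 0" using x norm_ge_zero order_trans by blast
    with False have R: "R > 0" by simp
    define h where "h l = (\<Sum>i<k. (c i / (2 * R)) *\<^sub>R (if i < length l then x (l ! i) else 0))" for l
    have cR: "norm ((c i / (2 * R)) *\<^sub>R v) \<le> 1 / (2 * R) * norm v" for i and v :: 'a
      using c[of i] R by (simp add: divide_right_mono mult_left_le_one_le mult_right_mono)
    have "norm (h l) \<le> (\<Sum>i<k. 1)" for l
      unfolding h_def
    proof (rule sum_norm_le)
      fix i
      have "norm ((c i / (2 * R)) *\<^sub>R (if i < length l then x (l ! i) else 0)) \<le> 1 / (2 * R) * R"
        by (rule order_trans[OF cR mult_left_mono]) (use x R in auto)
      then show "norm ((c i / (2 * R)) *\<^sub>R (if i < length l then x (l ! i) else 0)) \<le> 1" using R by simp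
    qed
    moreover have "step_lipschitz k 1 h"
      unfolding step_lipschitz_def
    proof (intro allI impI, elim conjE)
      fix l r :: "nat list" and n n'
      assume len: "length (l @ n # r) = k"
      define i0 where "i0 = length l"
      have i0: "i0 < k" using len by (simp add: i0_def)
      have "h (l @ n # r) - h (l @ n' # r) = (\<Sum>i<k. if i = i0 then (c i / (2 * R)) *\<^sub>R (x n - x n') else 0)"
        unfolding h_def sum_subtractf[symmetric]
        by (rule sum.cong) (use len in \<open>auto simp: i0_def nth_append nth_Cons scaleR_diff_right split: nat.splits\<close>)
      also have "\<dots> = (c i0 / (2 * R)) *\<^sub>R (x n - x n')" using i0 by simp
      finally have "dist (h (l @ n # r)) (h (l @ n' # r)) \<le> 1 / (2 * R) * norm (x n - x n')"
        using cR by (simp add: dist_norm)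
      also have "\<dots> \<le> 1 / (2 * R) * (2 * R)"
        using norm_triangle_ineq4[of "x n" "x n'"] x[of n] x[of n'] R by (intro mult_left_mono) auto
      also have "\<dots> = 1" using R by simp
      finally show "dist (h (l @ n # r)) (h (l @ n' # r)) \<le> 1" .
    qed
    ultimately obtain \<sigma> where \<sigma>: "strict_mono \<sigma>" "oscillation_le k h \<sigma> C" using C by blast
    have "norm (\<Sum>i<k. c i *\<^sub>R (x (\<sigma> (p i)) - x (\<sigma> (q i)))) \<le> 2 * (\<bar>C\<bar> + 1) * R"
      if pq: "strict_mono p" "strict_mono q" for p q :: "nat \<Rightarrow> nat"
    proof -
      have sorted: "sorted_wrt (<) (map p [0..<k])" if "strict_mono p" for p :: "nat \<Rightarrow> nat"
        by (rule sorted_wrt_map_strict_mono[OF that]) simp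
      have hp: "h (map \<sigma> (map p [0..<k])) = (1 / (2 * R)) *\<^sub>R (\<Sum>i<k. c i *\<^sub>R x (\<sigma> (p i)))" for p
        by (simp add: h_def scaleR_sum_right)
      have "dist (h (map \<sigma> (map p [0..<k]))) (h (map \<sigma> (map q [0..<k]))) \<le> C"
        using \<sigma>(2) sorted pq unfolding oscillation_le_def by (metis diff_zero length_map length_upt)
      then have "1 / (2 * R) * norm (\<Sum>i<k. c i *\<^sub>R (x (\<sigma> (p i)) - x (\<sigma> (q i)))) \<le> C"
        unfolding hp using R
        by (simp add: dist_norm scaleR_diff_right[symmetric] sum_subtractf[symmetric])
      then have "norm (\<Sum>i<k. c i *\<^sub>R (x (\<sigma> (p i)) - x (\<sigma> (q i)))) \<le> 2 * R * C"
        using R by (simp add: field_simps)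
      also have "\<dots> \<le> 2 * (\<bar>C\<bar> + 1) * R" using R by (simp add: mult.commute)
      finally show ?thesis .
    qed
    with \<sigma>(1) show ?thesis by blast
  qed
  then show ?thesis by (intro exI[of _ "2 * (\<bar>C\<bar> + 1)"]) auto
qed

section \<open>Reflexivity\<close>

text \<open>A functional of the triangular system separates the sum over \<open>k\<close> early indices from the sum over \<open>k\<close>
later ones by \<open>k\<close>, whereas their distance is bounded independently of \<open>k\<close>.\<close>

theorem bounded_concentration_imp_reflexive:
  fixes T :: "'a::banach itself"
  assumes bc: "bounded_concentration T"
  shows "reflexive_space T"
proof (rule ccontr)
  assume "\<not> reflexive_space T"
  then obtain x :: "nat \<Rightarrow> 'a" and g :: "nat \<Rightarrow> 'a \<Rightarrow>\<^sub>L real" and M R :: real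
    where x: "\<And>n. norm (x n) \<le> R" and g: "\<And>n. norm (g n) \<le> M"
      and gx: "\<And>n i. g n (x i) = (if n \<le> i then 1 else 0)"
    by (rule nonreflexive_triangular_system) blast
  have "bounded_concentration TYPE('a)" using bc by (simp add: bounded_concentration_def)
  from bounded_concentration_linear[OF this] obtain C where C: "\<And>k (c :: nat \<Rightarrow> real) (x :: nat \<Rightarrow> 'a) R.
      (\<forall>i. \<bar>c i\<bar> \<le> 1) \<and> (\<forall>n. norm (x n) \<le> R) \<Longrightarrow>
      \<exists>\<sigma>. strict_mono \<sigma> \<and> (\<forall>p q :: nat \<Rightarrow> nat. strict_mono p \<and> strict_mono q \<longrightarrow>
         norm (\<Sum>i<k. c i *\<^sub>R (x (\<sigma> (p i)) - x (\<sigma> (q i)))) \<le> C * R)"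
    by blast
  obtain k :: nat where k: "M * (C * R) < k" using reals_Archimedean2 by blast
  obtain \<sigma> where \<sigma>: "strict_mono \<sigma>" and le: "\<And>p q :: nat \<Rightarrow> nat. strict_mono p \<Longrightarrow> strict_mono q \<Longrightarrow>
         norm (\<Sum>i<k. 1 *\<^sub>R (x (\<sigma> (p i)) - x (\<sigma> (q i)))) \<le> C * R"
    using C[of "\<lambda>_. 1" x R k] x by auto
  define v where "v = (\<Sum>i<k. x (\<sigma> (k + i)) - x (\<sigma> i))"
  have v: "norm v \<le> C * R"
    using le[of "\<lambda>i. k + i" "\<lambda>i. i"] by (simp add: v_def strict_mono_def)
  have "g (\<sigma> k) v = (\<Sum>i<k. 1)"
    unfolding v_def blinfun.sum_right blinfun.diff_right gx
    by (rule sum.cong) (use \<sigma> in \<open>auto simp: strict_mono_less_eq\<close>)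
  then have "real k = norm (g (\<sigma> k) v)" by simp
  also have "\<dots> \<le> norm (g (\<sigma> k)) * norm v" by (rule norm_blinfun)
  also have "\<dots> \<le> M * (C * R)" by (intro mult_mono g v) (use g norm_ge_zero order_trans in blast)+
  finally show False using k by simp
qed

section \<open>Sequences equivalent to the unit vector basis of c0\<close>

lemma mem_c0_iff: "f \<in> c0 \<longleftrightarrow> apply_bcontfun f \<longlonglongrightarrow> 0"
  by (simp add: c0_def)

lemma subspace_c0: "subspace c0"
  unfolding subspace_def
proof (intro conjI ballI allI)
  show "0 \<in> c0" by (simp add: mem_c0_iff)
  show "f + g \<in> c0" if "f \<in> c0" "g \<in> c0" for f g
    using tendsto_add[of "apply_bcontfun f" 0 _ "apply_bcontfun g" 0] that by (simp add: mem_c0_iff)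
  show "c *\<^sub>R f \<in> c0" if "f \<in> c0" for c f
    using tendsto_mult_left[of "apply_bcontfun f" 0 _ c] that by (simp add: mem_c0_iff)
qed

lemma closed_c0: "closed c0"
  unfolding closed_sequential_limits
proof (intro allI impI, elim conjE)
  fix F f assume F: "\<forall>n. F n \<in> c0" and lim: "F \<longlonglongrightarrow> f"
  have "apply_bcontfun f \<longlonglongrightarrow> 0"
  proof (rule LIMSEQ_I)
    fix e :: real assume "e > 0"
    then obtain n where n: "dist (F n) f < e / 2"
      using lim by (metis half_gt_zero metric_LIMSEQ_D order_refl)
    have "apply_bcontfun (F n) \<longlonglongrightarrow> 0" using F by (simp add: mem_c0_iff)
    then obtain N where N: "\<And>i. i \<ge> N \<Longrightarrow> norm (F n i - 0) < e / 2"
      using \<open>e > 0\<close> by (metis half_gt_zero LIMSEQ_D)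
    have "norm (f i - 0) < e" if "i \<ge> N" for i
      using N[OF that] dist_bounded[of "F n" i f] n by (simp add: dist_real_def)
    then show "\<exists>N. \<forall>i\<ge>N. norm (f i - 0) < e" by blast
  qed
  then show "f \<in> c0" by (simp add: mem_c0_iff)
qed

lemma bcontfun_of_bounded_sequence:
  fixes a :: "nat \<Rightarrow> real"
  assumes "\<And>i. \<bar>a i\<bar> \<le> B"
  shows "\<exists>f. apply_bcontfun f = a"
proof -
  have "continuous_on UNIV a" by (simp add: continuous_on_discrete)
  then have "a \<in> bcontfun" by (rule bcontfun_normI) (use assms in simp)
  then show ?thesis using bcontfunE by metis
qed

lemma Cauchy_bounded_sequences_convergent:
  fixes F :: "nat \<Rightarrow> nat \<Rightarrow>\<^sub>C real"
  assumes F: "Cauchy F"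
  shows "convergent F"
proof -
  have "uniformly_Cauchy_on UNIV (\<lambda>n. apply_bcontfun (F n))"
    unfolding uniformly_Cauchy_on_def
  proof (intro allI impI)
    fix r :: real assume "r > 0"
    then obtain M where M: "\<And>m n. m \<ge> M \<Longrightarrow> n \<ge> M \<Longrightarrow> dist (F m) (F n) < r"
      using F unfolding Cauchy_def by blast
    then have "dist (F m i) (F n i) < r" if "m \<ge> M" "n \<ge> M" for m n i
      using dist_bounded[of "F m" i "F n"] that le_less_trans by blast
    then show "\<exists>M. \<forall>i\<in>UNIV. \<forall>m\<ge>M. \<forall>n\<ge>M. dist (F m i) (F n i) < r" by blast
  qed
  then obtain g where "uniform_limit UNIV (\<lambda>n. apply_bcontfun (F n)) g sequentially"
    using uniformly_convergent_eq_Cauchy unfolding uniformly_convergent_on_def by blast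
  then show ?thesis
    using uniform_limit_bcontfunE[OF _ sequentially_bot] convergentI by metis
qed

text \<open>The isomorphism is the inverse of \<open>f \<mapsto> \<Sum>i. f i *\<^sub>R v i\<close>, which is bounded above and below on \<open>c\<^sub>0\<close>.
By completeness of \<open>c\<^sub>0\<close> its image is closed; as it contains the \<open>v i\<close>, it is the whole closed span.\<close>

theorem c0_basis_span_isomorphic:
  fixes v :: "nat \<Rightarrow> 'e::banach"
  assumes up: "\<And>k a M. (\<And>i. i < k \<Longrightarrow> \<bar>a i\<bar> \<le> M) \<Longrightarrow> M \<ge> 0 \<Longrightarrow> norm (\<Sum>i<k. a i *\<^sub>R v i) \<le> C * M"
    and low: "\<And>k a i. i < k \<Longrightarrow> c * \<bar>a i\<bar> \<le> norm (\<Sum>i<k. a i *\<^sub>R v i)" and c: "c > 0"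
  shows "isomorphic_normed_subspaces (closure (span (range v))) c0"
proof -
  define C' where "C' = max C 1"
  have C': "C' > 0" "C \<le> C'" by (auto simp: C'_def)
  define T where "T f = (\<Sum>i. apply_bcontfun f i *\<^sub>R v i)" for f :: "nat \<Rightarrow>\<^sub>C real"
  have summ: "summable (\<lambda>i. f i *\<^sub>R v i)" if f: "f \<in> c0" for f
    unfolding summable_Cauchy
  proof (intro allI impI)
    fix e :: real assume e: "e > 0"
    define b where "b = e / (2 * C')"
    have b: "b > 0" using e C' by (simp add: b_def)
    obtain N where N: "\<And>i. i \<ge> N \<Longrightarrow> \<bar>f i\<bar> < b"
      using f b unfolding mem_c0_iff by (metis LIMSEQ_D diff_zero real_norm_def)
    have "norm (\<Sum>i=m..<n. f i *\<^sub>R v i) < e" if m: "m \<ge> N" for m n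
    proof -
      have "(\<Sum>i=m..<n. f i *\<^sub>R v i) = (\<Sum>i<n. (if m \<le> i then f i else 0) *\<^sub>R v i)"
        by (rule sum.mono_neutral_cong_left) auto
      also have "norm \<dots> \<le> C * b"
        by (rule up) (use N m b in \<open>auto simp: less_imp_le\<close>)
      also have "\<dots> \<le> C' * b" using C' b by simp
      also have "\<dots> < e" using e C' by (simp add: b_def)
      finally show ?thesis .
    qed
    then show "\<exists>N. \<forall>m\<ge>N. \<forall>n. norm (\<Sum>i=m..<n. f i *\<^sub>R v i) < e" by blast
  qed
  have lim: "(\<lambda>n. \<Sum>i<n. f i *\<^sub>R v i) \<longlonglongrightarrow> T f" if "f \<in> c0" for f
    using summable_LIMSEQ[OF summ[OF that]] by (simp add: T_def)
  have add: "T (f + g) = T f + T g" if "f \<in> c0" "g \<in> c0" for f g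
    using suminf_add[OF summ summ, OF that] by (simp add: T_def scaleR_add_left)
  have scale: "T (r *\<^sub>R f) = r *\<^sub>R T f" if "f \<in> c0" for r f
    using suminf_scaleR_right[OF summ[OF that], of r] by (simp add: T_def)
  have Tup: "norm (T f) \<le> C' * norm f" if f: "f \<in> c0" for f
  proof (rule LIMSEQ_le_const2[OF tendsto_norm[OF lim[OF f]]])
    have "norm (\<Sum>i<n. f i *\<^sub>R v i) \<le> C * norm f" for n
      by (rule up) (use norm_bounded[of f] in auto)
    moreover have "C * norm f \<le> C' * norm f" using C' by (simp add: mult_right_mono)
    ultimately show "\<exists>N. \<forall>n\<ge>N. norm (\<Sum>i<n. f i *\<^sub>R v i) \<le> C' * norm f"
      using order_trans by blast
  qed
  have Tlow: "c * norm f \<le> norm (T f)" if f: "f \<in> c0" for f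
  proof -
    have "norm (f i) \<le> norm (T f) / c" for i
    proof -
      have "c * \<bar>f i\<bar> \<le> norm (T f)"
        by (rule LIMSEQ_le_const[OF tendsto_norm[OF lim[OF f]]])
          (use low in \<open>auto intro!: exI[of _ "Suc i"] simp: Suc_le_eq\<close>)
      then show ?thesis using c by (simp add: field_simps)
    qed
    then have "norm f \<le> norm (T f) / c" by (rule norm_bound)
    then show ?thesis using c by (simp add: field_simps)
  qed
  have diff: "T (f - g) = T f - T g" if "f \<in> c0" "g \<in> c0" for f g
    using add[OF subspace_diff[OF subspace_c0 that] that(2)] by simp
  have inj: "f = g" if "f \<in> c0" "g \<in> c0" "T f = T g" for f g
    using Tlow[OF subspace_diff[OF subspace_c0 that(1,2)]] diff[OF that(1,2)] that(3) c
    by (simp add: mult_le_0_iff)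
  have sub: "subspace (T ` c0)"
    unfolding subspace_def
  proof (intro conjI ballI allI)
    show "0 \<in> T ` c0" using scale[OF subspace_0[OF subspace_c0], of 0] subspace_0[OF subspace_c0]
      by (intro image_eqI[of _ _ 0]) simp_all
    show "x + y \<in> T ` c0" if "x \<in> T ` c0" "y \<in> T ` c0" for x y
      using that by (auto simp: add[symmetric] intro!: imageI subspace_add[OF subspace_c0])
    show "r *\<^sub>R x \<in> T ` c0" if "x \<in> T ` c0" for r x
      using that by (auto simp: scale[symmetric] intro!: imageI subspace_scale[OF subspace_c0])
  qed
  have "v j \<in> T ` c0" for j
  proof -
    have "\<exists>f::nat \<Rightarrow>\<^sub>C real. apply_bcontfun f = (\<lambda>i. if i = j then 1 else 0)"
      by (rule bcontfun_of_bounded_sequence[of _ 1]) auto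
    then obtain f :: "nat \<Rightarrow>\<^sub>C real" where f: "apply_bcontfun f = (\<lambda>i. if i = j then 1 else 0)" by blast
    have "eventually (\<lambda>i. apply_bcontfun f i = 0) sequentially"
      unfolding f by (rule eventually_mono[OF eventually_gt_at_top[of j]]) auto
    then have fc: "f \<in> c0" unfolding mem_c0_iff by (rule tendsto_eventually)
    have "T f = (\<Sum>i. if i = j then v i else 0)" by (simp add: T_def f if_distrib[of "\<lambda>r. r *\<^sub>R _"] cong: if_cong)
    also have "\<dots> = v j" using sums_single[of j v] by (simp add: sums_iff)
    finally show ?thesis using fc by (metis imageI)
  qed
  then have span: "span (range v) \<subseteq> T ` c0"
    by (intro span_minimal sub) auto
  have "closure (span (range v)) = T ` c0"
  proof
    show "T ` c0 \<subseteq> closure (span (range v))"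
    proof clarify
      fix f assume f: "f \<in> c0"
      have "(\<Sum>i<n. f i *\<^sub>R v i) \<in> span (range v)" for n
        by (intro span_sum span_scale span_base) auto
      with lim[OF f] show "T f \<in> closure (span (range v))"
        unfolding closure_sequential by (intro exI[of _ "\<lambda>n. \<Sum>i<n. f i *\<^sub>R v i"]) simp
    qed
    show "closure (span (range v)) \<subseteq> T ` c0"
    proof
      fix x assume "x \<in> closure (span (range v))"
      then obtain s where s: "\<And>n. s n \<in> span (range v)" "s \<longlonglongrightarrow> x" unfolding closure_sequential by blast
      then have "\<forall>n. \<exists>f. f \<in> c0 \<and> s n = T f" using span by blast
      then obtain F where F: "\<And>n. F n \<in> c0" "\<And>n. s n = T (F n)" by metis
      have bound: "c * norm (F m - F n) \<le> norm (s m - s n)" for m n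
        using Tlow[OF subspace_diff[OF subspace_c0 F(1) F(1)]] by (simp add: diff F)
      have "Cauchy F"
        unfolding Cauchy_iff
      proof (intro allI impI)
        fix e :: real assume "e > 0"
        then obtain M where M: "\<And>m n. m \<ge> M \<Longrightarrow> n \<ge> M \<Longrightarrow> norm (s m - s n) < c * e"
          using LIMSEQ_imp_Cauchy[OF s(2)] c unfolding Cauchy_iff by (meson mult_pos_pos)
        have "norm (F m - F n) < e" if "m \<ge> M" "n \<ge> M" for m n
        proof -
          have "c * norm (F m - F n) < c * e" using bound M[OF that] by (rule le_less_trans)
          then show ?thesis using c by simp
        qed
        then show "\<exists>M. \<forall>m\<ge>M. \<forall>n\<ge>M. norm (F m - F n) < e" by blast
      qed
      then have "convergent F" by (rule Cauchy_bounded_sequences_convergent)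
      then obtain f where Ff: "F \<longlonglongrightarrow> f" by (auto simp: convergent_def)
      have f: "f \<in> c0" by (rule closed_sequentially[OF closed_c0 F(1) Ff])
      have "(\<lambda>n. s n - T f) \<longlonglongrightarrow> 0"
      proof (rule Lim_null_comparison)
        show "eventually (\<lambda>n. norm (s n - T f) \<le> C' * norm (F n - f)) sequentially"
          using Tup[OF subspace_diff[OF subspace_c0 F(1) f]] by (simp add: diff F f)
        show "(\<lambda>n. C' * norm (F n - f)) \<longlonglongrightarrow> 0"
          using tendsto_mult_left[OF tendsto_norm[OF tendsto_diff[OF Ff tendsto_const[of f]]], of C'] by simp
      qed
      then have "s \<longlonglongrightarrow> T f" using LIM_zero_cancel by blast
      then show "x \<in> T ` c0" using s(2) LIMSEQ_unique f by blast
    qed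
  qed
  moreover have "isomorphic_normed_subspaces (T ` c0) c0"
    unfolding isomorphic_normed_subspaces_def
  proof (intro conjI exI[of _ "inv_into c0 T"] sub subspace_c0)
    have inv: "inv_into c0 T (T f) = f" if "f \<in> c0" for f
      by (rule inv_into_f_f[OF inj_onI that]) (use inj in blast)
    show "\<forall>x\<in>T ` c0. \<forall>y\<in>T ` c0. inv_into c0 T (x + y) = inv_into c0 T x + inv_into c0 T y"
      by (auto simp: inv add[symmetric] subspace_add[OF subspace_c0])
    show "\<forall>r. \<forall>x\<in>T ` c0. inv_into c0 T (r *\<^sub>R x) = r *\<^sub>R inv_into c0 T x"
      by (auto simp: inv scale[symmetric] subspace_scale[OF subspace_c0])
    show "inv_into c0 T ` T ` c0 = c0" by (force simp: inv image_image)
    show "\<exists>m>0. \<exists>M. \<forall>x\<in>T ` c0. m * norm x \<le> norm (inv_into c0 T x) \<and> norm (inv_into c0 T x) \<le> M * norm x"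
    proof -
      have "1 / C' * norm x \<le> norm (inv_into c0 T x) \<and> norm (inv_into c0 T x) \<le> 1 / c * norm x"
        if "x \<in> T ` c0" for x
      proof -
        obtain f where f: "f \<in> c0" "x = T f" using \<open>x \<in> T ` c0\<close> by blast
        have "1 / C' * norm x \<le> norm (inv_into c0 T x)" using Tup[OF f(1)] C' by (simp add: f inv field_simps)
        moreover have "norm (inv_into c0 T x) \<le> 1 / c * norm x" using Tlow[OF f(1)] c by (simp add: f inv field_simps)
        ultimately show ?thesis ..
      qed
      moreover have "1 / C' > 0" using C' by simp
      ultimately show ?thesis by blast
    qed
  qed
  ultimately show ?thesis by simp
qed

section \<open>Spreading sequences\<close>

lemma sum_lessThan_add: "(\<Sum>i<k + m. f i) = (\<Sum>i<k. f i) + (\<Sum>i<m. f (k + i))"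
  for f :: "nat \<Rightarrow> 'b::comm_monoid_add"
  by (induction m) (simp_all add: add.assoc)

lemma subspace_closure:
  fixes S :: "'b::real_normed_vector set"
  assumes S: "subspace S"
  shows "subspace (closure S)"
  unfolding subspace_def
proof (intro conjI ballI allI)
  show "0 \<in> closure S" using subspace_0[OF S] closure_subset by blast
next
  fix x y assume "x \<in> closure S" "y \<in> closure S"
  then obtain u w where "\<And>n. u n \<in> S" "u \<longlonglongrightarrow> x" "\<And>n. w n \<in> S" "w \<longlonglongrightarrow> y"
    unfolding closure_sequential by blast
  then show "x + y \<in> closure S"
    unfolding closure_sequential
    by (intro exI[of _ "\<lambda>n. u n + w n"] conjI allI subspace_add[OF S] tendsto_add)
next
  fix r x assume "x \<in> closure S"
  then obtain u where "\<And>n. u n \<in> S" "u \<longlonglongrightarrow> x" unfolding closure_sequential by blast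
  then show "r *\<^sub>R x \<in> closure S"
    unfolding closure_sequential
    by (intro exI[of _ "\<lambda>n. r *\<^sub>R u n"] conjI allI subspace_scale[OF S] tendsto_scaleR tendsto_const)
qed

text \<open>What is known about the fundamental sequence of a spreading model: the norm of a combination does not change
when the indices are spread out, concentration bounds differences of two successive blocks with
equal coefficients, and the sequence is not constant.\<close>

locale block_bounded_spreading_sequence =
  fixes e :: "nat \<Rightarrow> 'e::banach" and C :: real
  assumes spreading: "strict_mono p \<Longrightarrow> norm (\<Sum>i<k. c i *\<^sub>R e (p i)) = norm (\<Sum>i<k. c i *\<^sub>R e i)"
    and blocks: "(\<And>i. \<bar>c i\<bar> \<le> 1) \<Longrightarrow> norm (\<Sum>i<k. c i *\<^sub>R (e i - e (k + i))) \<le> C"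
    and nontrivial: "e 0 \<noteq> e 1"
begin

definition "K = norm (e 0)"
definition "\<delta> = norm (e 0 - e 1)"

lemma norm_e: "norm (e i) = K"
  using spreading[of "\<lambda>j. i + j" "\<lambda>_. 1" 1] by (simp add: K_def strict_mono_def)

lemma norm_consecutive: "norm (e i - e (Suc i)) = \<delta>"
  using spreading[of "\<lambda>j. i + j" "\<lambda>j. if j = 0 then 1 else - 1" 2]
  by (simp add: \<delta>_def strict_mono_def numeral_2_eq_2)

lemma \<delta>_pos: "\<delta> > 0"
  using nontrivial by (simp add: \<delta>_def)

text \<open>By spreading invariance the second block may be moved to the right by \<open>l\<close> without changing the norm.\<close>

lemma far_blocks:
  assumes "\<And>i. \<bar>c i\<bar> \<le> 1"
  shows "norm (\<Sum>i<k. c i *\<^sub>R (e i - e (k + l + i))) \<le> C"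
proof -
  define d where "d j = (if j < k then c j else - c (j - k))" for j
  \<comment> \<open>The two blocks as one combination \<open>d\<close> of length \<open>2 k\<close>, whose second half is then moved by \<open>l\<close>.\<close>
  define p where "p j = (if j < k then j else j + l)" for j
  have d: "(\<Sum>i<k + k. d i *\<^sub>R z i) = (\<Sum>i<k. c i *\<^sub>R (z i - z (k + i)))" for z :: "nat \<Rightarrow> 'e"
    by (simp add: sum_lessThan_add d_def sum_negf scaleR_diff_right sum_subtractf)
  have "norm (\<Sum>i<k + k. d i *\<^sub>R e (p i)) = norm (\<Sum>i<k + k. d i *\<^sub>R e i)"
    by (rule spreading) (auto simp: strict_mono_def p_def)
  then show ?thesis
    using blocks[of c k, OF assms] by (simp add: d p_def add_ac)
qed

lemma shift_bound: "norm ((\<Sum>l<L. e (i + l)) - (\<Sum>l<L. e l)) \<le> 2 * K * real i"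
proof (induction i)
  case (Suc i)
  have "(\<Sum>l<L. e (Suc i + l)) - (\<Sum>l<L. e (i + l)) = e (i + L) - e i"
    using sum_lessThan_telescope[of "\<lambda>l. e (i + l)" L] by (simp add: sum_subtractf)
  then have "norm ((\<Sum>l<L. e (Suc i + l)) - (\<Sum>l<L. e (i + l))) \<le> 2 * K"
    using norm_triangle_ineq4[of "e (i + L)" "e i"] by (simp add: norm_e)
  then show ?case
    using Suc norm_triangle_ineq[of "(\<Sum>l<L. e (Suc i + l)) - (\<Sum>l<L. e (i + l))" "(\<Sum>l<L. e (i + l)) - (\<Sum>l<L. e l)"]
    by (simp add: algebra_simps)
qed simp

text \<open>Average \<open>far_blocks\<close> over the shifts \<open>l < L\<close>. The first block is unaffected. Since the coefficients sum to
\<open>0\<close>, the sum of the shifted second blocks telescopes to a vector whose norm is bounded independently of \<open>L\<close>, so its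
average tends to \<open>0\<close>. This works although the sequence may fail to be weakly null.\<close>

lemma norm_zero_sum_le:
  assumes c: "\<And>i. \<bar>c i\<bar> \<le> 1" and zero: "(\<Sum>i<k. c i) = 0"
  shows "norm (\<Sum>i<k. c i *\<^sub>R e i) \<le> C"
proof (rule ccontr)
  define V where "V = (\<Sum>i<k. c i *\<^sub>R e i)"
  \<comment> \<open>A bound, independent of \<open>L\<close>, for the sum of the \<open>L\<close> shifted second blocks.\<close>
  define D where "D = (\<Sum>i<k. 2 * K * real (k + i))"
  assume "\<not> ?thesis"
  then have V: "norm V - C > 0" by (simp add: V_def)
  have "real L * (norm V - C) \<le> D" for L
  proof -
    define W where "W = (\<Sum>l<L. \<Sum>i<k. c i *\<^sub>R e (k + l + i))"
    have "norm (real L *\<^sub>R V - W) \<le> (\<Sum>l<L. C)"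
    proof -
      have "real L *\<^sub>R V - W = (\<Sum>l<L. \<Sum>i<k. c i *\<^sub>R (e i - e (k + l + i)))"
        by (simp add: V_def W_def scaleR_diff_right sum_subtractf sum_constant_scaleR)
      then show ?thesis using far_blocks[of c, OF c] by (simp only:) (rule sum_norm_le)
    qed
    moreover have "norm W \<le> D"
    proof -
      have "W = (\<Sum>i<k. c i *\<^sub>R (\<Sum>l<L. e (k + i + l)))"
        unfolding W_def by (subst sum.swap) (simp add: scaleR_sum_right add_ac)
      also have "\<dots> = (\<Sum>i<k. c i *\<^sub>R ((\<Sum>l<L. e (k + i + l)) - (\<Sum>l<L. e l)))"
        by (simp add: scaleR_diff_right sum_subtractf scaleR_sum_left[symmetric] zero)
      also have "norm \<dots> \<le> D"
        unfolding D_def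
      proof (rule sum_norm_le)
        fix i
        have "norm (c i *\<^sub>R ((\<Sum>l<L. e (k + i + l)) - (\<Sum>l<L. e l))) \<le> 1 * (2 * K * real (k + i))"
          unfolding norm_scaleR by (intro mult_mono shift_bound) (use c in auto)
        then show "norm (c i *\<^sub>R ((\<Sum>l<L. e (k + i + l)) - (\<Sum>l<L. e l))) \<le> 2 * K * real (k + i)" by simp
      qed
      finally show ?thesis .
    qed
    moreover have "real L * norm V \<le> norm (real L *\<^sub>R V - W) + norm W"
      using norm_triangle_sub[of "real L *\<^sub>R V" W] by simp
    ultimately show ?thesis by (simp add: algebra_simps)
  qed
  moreover obtain L where "D < real L * (norm V - C)"
    using reals_Archimedean3[OF V] by blast
  ultimately show False by (meson not_less)
qed

lemma norm_zero_sum_le_scaled: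
  assumes c: "\<And>i. i < k \<Longrightarrow> \<bar>c i\<bar> \<le> b" and b: "b \<ge> 0" and zero: "(\<Sum>i<k. c i) = 0"
  shows "norm (\<Sum>i<k. c i *\<^sub>R e i) \<le> C * b"
proof (cases "b = 0")
  case True
  then show ?thesis using c by simp
next
  case False
  define d where "d i = (if i < k then c i / b else 0)" for i
  have "norm (\<Sum>i<k. d i *\<^sub>R e i) \<le> C"
  proof (rule norm_zero_sum_le)
    show "\<bar>d i\<bar> \<le> 1" for i using c[of i] False b by (auto simp: d_def)
    show "(\<Sum>i<k. d i) = 0" using zero by (simp add: d_def sum_divide_distrib[symmetric])
  qed
  moreover have "(\<Sum>i<k. c i *\<^sub>R e i) = b *\<^sub>R (\<Sum>i<k. d i *\<^sub>R e i)"
    using False by (simp add: scaleR_sum_right d_def)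
  ultimately have "norm (\<Sum>i<k. c i *\<^sub>R e i) \<le> b * C" using b by (simp add: mult_left_mono)
  then show ?thesis by (simp add: mult.commute)
qed

text \<open>Open a gap in the combination just after and just before index \<open>i\<close>. Both vectors have the original norm,
and their difference is \<open>c i *\<^sub>R (e i - e (Suc i))\<close>.\<close>

lemma coefficient_le:
  assumes i: "i < k"
  shows "\<bar>c i\<bar> * \<delta> \<le> 2 * norm (\<Sum>j<k. c j *\<^sub>R e j)"
proof -
  define p where "p j = (if j \<le> i then j else Suc j)" for j
  define q where "q j = (if j < i then j else Suc j)" for j
  have "(\<Sum>j<k. c j *\<^sub>R e (p j)) - (\<Sum>j<k. c j *\<^sub>R e (q j)) = (\<Sum>j<k. if j = i then c i *\<^sub>R (e i - e (Suc i)) else 0)"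
    unfolding sum_subtractf[symmetric] by (rule sum.cong) (auto simp: p_def q_def scaleR_diff_right)
  then have "\<bar>c i\<bar> * \<delta> = norm ((\<Sum>j<k. c j *\<^sub>R e (p j)) - (\<Sum>j<k. c j *\<^sub>R e (q j)))"
    using i by (simp add: norm_consecutive)
  also have "\<dots> \<le> norm (\<Sum>j<k. c j *\<^sub>R e (p j)) + norm (\<Sum>j<k. c j *\<^sub>R e (q j))"
    by (rule norm_triangle_ineq4)
  also have "\<dots> = 2 * norm (\<Sum>j<k. c j *\<^sub>R e j)"
    using spreading[of p c k] spreading[of q c k] by (simp add: strict_mono_def p_def q_def)
  finally show ?thesis .
qed

definition average :: "nat \<Rightarrow> 'e" where
  "average n = (1 / real (Suc n)) *\<^sub>R (\<Sum>i<Suc n. e i)"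

text \<open>Estimates involving the limit of the averages are proved for finite averages first; this
and the next lemma describe the coefficients that occur there.\<close>

lemma combination_plus_average:
  assumes "k \<le> Suc n"
  shows "(\<Sum>i<k. c i *\<^sub>R e i) + b *\<^sub>R average n =
    (\<Sum>i<Suc n. ((if i < k then c i else 0) + b / real (Suc n)) *\<^sub>R e i)"
proof -
  have "(\<Sum>i<Suc n. (if i < k then c i else 0) *\<^sub>R e i) = (\<Sum>i<k. c i *\<^sub>R e i)"
    by (rule sum.mono_neutral_cong_right) (use assms in auto)
  moreover have "b *\<^sub>R average n = (\<Sum>i<Suc n. (b / real (Suc n)) *\<^sub>R e i)"
    by (simp only: average_def scaleR_scaleR scaleR_sum_right) simp
  ultimately show ?thesis by (simp only: scaleR_add_left sum.distrib)
qed

lemma sum_coefficients_plus_average: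
  assumes "k \<le> Suc n"
  shows "(\<Sum>i<Suc n. (if i < k then c i else 0) + b / real (Suc n)) = (\<Sum>i<k. c i) + (b::real)"
proof -
  have "(\<Sum>i<Suc n. if i < k then c i else 0) = (\<Sum>i<k. c i)"
    by (rule sum.mono_neutral_cong_right) (use assms in auto)
  moreover have "(\<Sum>i<Suc n. b / real (Suc n)) = b" by (simp only: sum_constant card_lessThan) simp
  ultimately show ?thesis by (simp only: sum.distrib)
qed

lemma C_nonneg: "C \<ge> 0"
  using blocks[of "\<lambda>_. 0" 0] by simp

text \<open>A difference of two averages has coefficient sum \<open>0\<close> and small coefficients.\<close>

lemma average_Cauchy: "Cauchy average"
proof (rule metric_CauchyI)
  fix r :: real assume r: "r > 0"
  obtain M where M: "2 * C / r < real M" using reals_Archimedean2 by blast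
  have le: "norm (average m - average n) < r" if mn: "M \<le> m" "m \<le> n" for m n
  proof -
    define c where "c i = 1 / real (Suc m)" for i :: nat
    define d where "d i = (if i < Suc m then c i else 0) + (- 1) / real (Suc n)" for i
    have "average m = (\<Sum>i<Suc m. c i *\<^sub>R e i)"
      by (simp only: average_def c_def scaleR_sum_right)
    then have "average m - average n = (\<Sum>i<Suc m. c i *\<^sub>R e i) + (- 1) *\<^sub>R average n"
      by simp
    also have "\<dots> = (\<Sum>i<Suc n. d i *\<^sub>R e i)"
      unfolding d_def by (rule combination_plus_average) (use mn in simp)
    also have "norm \<dots> \<le> C * (1 / real (Suc m))"
    proof (rule norm_zero_sum_le_scaled)
      have "(\<Sum>i<Suc n. d i) = (\<Sum>i<Suc m. c i) + (- 1)"
        unfolding d_def by (rule sum_coefficients_plus_average) (use mn in simp)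
      then show "(\<Sum>i<Suc n. d i) = 0" by (simp add: c_def del: sum.lessThan_Suc)
      have "1 / real (Suc n) \<le> 1 / real (Suc m)" using mn by (simp add: frac_le)
      moreover have "\<bar>(if P then u else 0) - w\<bar> \<le> u" if "0 < w" "w \<le> u" for P and u w :: real
        using that by auto
      moreover have "d i = (if i < Suc m then 1 / real (Suc m) else 0) - 1 / real (Suc n)" for i
        by (simp add: d_def c_def)
      ultimately show "\<bar>d i\<bar> \<le> 1 / real (Suc m)" for i
        by (simp only: of_nat_0_less_iff zero_less_divide_iff zero_less_one zero_less_Suc simp_thms)
    qed simp
    also have "\<dots> < r"
    proof -
      have "2 * C < real M * r" using M r by (simp add: field_simps)
      also have "\<dots> \<le> real (Suc m) * r" using mn r by (intro mult_right_mono) auto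
      finally have "2 * C < real (Suc m) * r" .
      then have "C < real (Suc m) * r" using C_nonneg by linarith
      then show ?thesis by (simp add: field_simps)
    qed
    finally show ?thesis .
  qed
  have "dist (average m) (average n) < r" if "M \<le> m" "M \<le> n" for m n
    using le[of m n] le[of n m] that by (cases "m \<le> n") (auto simp: dist_norm norm_minus_commute)
  then show "\<exists>M. \<forall>m\<ge>M. \<forall>n\<ge>M. dist (average m) (average n) < r" by blast
qed

definition center :: 'e where
  "center = lim average"

lemma average_tendsto: "average \<longlonglongrightarrow> center"
  using Cauchy_convergent[OF average_Cauchy] by (simp add: center_def convergent_LIMSEQ_iff)

lemma combination_tendsto:
  "(\<lambda>n. norm (\<Sum>i<Suc n. ((if i < k then c i else 0) + b / real (Suc n)) *\<^sub>R e i))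
     \<longlonglongrightarrow> norm ((\<Sum>i<k. c i *\<^sub>R e i) + b *\<^sub>R center)"
proof (rule Lim_transform_eventually)
  show "(\<lambda>n. norm ((\<Sum>i<k. c i *\<^sub>R e i) + b *\<^sub>R average n)) \<longlonglongrightarrow> norm ((\<Sum>i<k. c i *\<^sub>R e i) + b *\<^sub>R center)"
    by (intro tendsto_intros average_tendsto)
  show "eventually (\<lambda>n. norm ((\<Sum>i<k. c i *\<^sub>R e i) + b *\<^sub>R average n) =
      norm (\<Sum>i<Suc n. ((if i < k then c i else 0) + b / real (Suc n)) *\<^sub>R e i)) sequentially"
    by (rule eventually_mono[OF eventually_ge_at_top[of k]]) (simp only: combination_plus_average le_SucI)
qed

lemma scaled_inverse_tendsto_0: "(\<lambda>n. b / real (Suc n)) \<longlonglongrightarrow> 0"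
  using tendsto_mult_left[OF LIMSEQ_inverse_real_of_nat, of b] by (simp add: divide_inverse)

lemma norm_centered_le:
  assumes c: "\<And>i. i < k \<Longrightarrow> \<bar>c i\<bar> \<le> M" and M: "M \<ge> 0"
  shows "norm ((\<Sum>i<k. c i *\<^sub>R e i) - (\<Sum>i<k. c i) *\<^sub>R center) \<le> C * M"
proof -
  define s where "s = (\<Sum>i<k. c i)"
  have "norm ((\<Sum>i<k. c i *\<^sub>R e i) + (- s) *\<^sub>R center) \<le> C * (M + 0)"
  proof (rule LIMSEQ_le[OF combination_tendsto])
    show "(\<lambda>n. C * (M + \<bar>s\<bar> / real (Suc n))) \<longlonglongrightarrow> C * (M + 0)"
      by (intro tendsto_intros scaled_inverse_tendsto_0)
    have "norm (\<Sum>i<Suc n. ((if i < k then c i else 0) + (- s) / real (Suc n)) *\<^sub>R e i) \<le> C * (M + \<bar>s\<bar> / real (Suc n))"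
      if n: "n \<ge> k" for n
    proof (rule norm_zero_sum_le_scaled)
      show "(\<Sum>i<Suc n. (if i < k then c i else 0) + (- s) / real (Suc n)) = 0"
        using sum_coefficients_plus_average[of k n c "- s"] n by (simp add: s_def del: sum.lessThan_Suc)
      show "\<bar>(if i < k then c i else 0) + (- s) / real (Suc n)\<bar> \<le> M + \<bar>s\<bar> / real (Suc n)" for i
      proof -
        have "\<bar>if i < k then c i else 0\<bar> \<le> M" using c M by simp
        moreover have "\<bar>(- s) / real (Suc n)\<bar> = \<bar>s\<bar> / real (Suc n)" by (simp add: abs_divide)
        ultimately show ?thesis
          using abs_triangle_ineq[of "if i < k then c i else 0" "(- s) / real (Suc n)"] by linarith
      qed
    qed (use M in simp)
    then show "\<exists>N. \<forall>n\<ge>N. norm (\<Sum>i<Suc n. ((if i < k then c i else 0) + (- s) / real (Suc n)) *\<^sub>R e i) \<le> C * (M + \<bar>s\<bar> / real (Suc n))"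
      by blast
  qed
  then show ?thesis by (simp add: s_def)
qed

lemma coefficient_le_center:
  assumes i: "i < k"
  shows "\<bar>c i\<bar> * \<delta> \<le> 2 * norm ((\<Sum>j<k. c j *\<^sub>R e j) + b *\<^sub>R center)"
proof -
  have "\<bar>c i + 0\<bar> * \<delta> \<le> 2 * norm ((\<Sum>j<k. c j *\<^sub>R e j) + b *\<^sub>R center)"
  proof (rule LIMSEQ_le)
    show "(\<lambda>n. \<bar>c i + b / real (Suc n)\<bar> * \<delta>) \<longlonglongrightarrow> \<bar>c i + 0\<bar> * \<delta>"
      by (intro tendsto_intros scaled_inverse_tendsto_0)
    show "(\<lambda>n. 2 * norm (\<Sum>j<Suc n. ((if j < k then c j else 0) + b / real (Suc n)) *\<^sub>R e j))
        \<longlonglongrightarrow> 2 * norm ((\<Sum>j<k. c j *\<^sub>R e j) + b *\<^sub>R center)"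
      by (intro tendsto_mult_left combination_tendsto)
    have "\<bar>c i + b / real (Suc n)\<bar> * \<delta> \<le> 2 * norm (\<Sum>j<Suc n. ((if j < k then c j else 0) + b / real (Suc n)) *\<^sub>R e j)"
      if "n \<ge> k" for n
      using coefficient_le[of i "Suc n" "\<lambda>j. (if j < k then c j else 0) + b / real (Suc n)"] i that
      by (simp del: sum.lessThan_Suc)
    then show "\<exists>N. \<forall>n\<ge>N. \<bar>c i + b / real (Suc n)\<bar> * \<delta> \<le>
        2 * norm (\<Sum>j<Suc n. ((if j < k then c j else 0) + b / real (Suc n)) *\<^sub>R e j)" by blast
  qed
  then show ?thesis by simp
qed

text \<open>The averages of the shifted sequences \<open>e i, e (i + 1), \<dots>\<close> have the same limit for every \<open>i\<close>. Averaging the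
shifts of \<open>\<Sum>i<k. c i *\<^sub>R e i\<close>, which all have the same norm, thus leads to \<open>(\<Sum>i<k. c i) *\<^sub>R center\<close>.\<close>

lemma sum_coefficients_le:
  "\<bar>\<Sum>i<k. c i\<bar> * norm center \<le> norm (\<Sum>i<k. c i *\<^sub>R e i)"
proof -
  define A where "A i n = (1 / real (Suc n)) *\<^sub>R (\<Sum>l<Suc n. e (i + l))" for i n
  have A: "A i \<longlonglongrightarrow> center" for i
  proof -
    have "(\<lambda>n. A i n - average n) \<longlonglongrightarrow> 0"
    proof (rule Lim_null_comparison[OF _ scaled_inverse_tendsto_0])
      have "norm (A i n - average n) \<le> (2 * K * real i) / real (Suc n)" for n
      proof -
        have "A i n - average n = (1 / real (Suc n)) *\<^sub>R ((\<Sum>l<Suc n. e (i + l)) - (\<Sum>l<Suc n. e l))"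
          by (simp only: A_def average_def scaleR_diff_right)
        then have "norm (A i n - average n) = 1 / real (Suc n) * norm ((\<Sum>l<Suc n. e (i + l)) - (\<Sum>l<Suc n. e l))"
          by (simp only: norm_scaleR) simp
        also have "\<dots> \<le> 1 / real (Suc n) * (2 * K * real i)"
          by (intro mult_left_mono shift_bound) simp
        finally show ?thesis by simp
      qed
      then show "eventually (\<lambda>n. norm (A i n - average n) \<le> (2 * K * real i) / real (Suc n)) sequentially" by simp
    qed
    from tendsto_add[OF this average_tendsto] show ?thesis by simp
  qed
  have "norm (\<Sum>i<k. c i *\<^sub>R center) \<le> norm (\<Sum>i<k. c i *\<^sub>R e i)"
  proof (rule LIMSEQ_le_const2)
    show "(\<lambda>n. norm (\<Sum>i<k. c i *\<^sub>R A i n)) \<longlonglongrightarrow> norm (\<Sum>i<k. c i *\<^sub>R center)"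
      by (intro tendsto_intros A)
    have "norm (\<Sum>i<k. c i *\<^sub>R A i n) \<le> norm (\<Sum>i<k. c i *\<^sub>R e i)" for n
    proof -
      have "(\<Sum>i<k. c i *\<^sub>R A i n) = (1 / real (Suc n)) *\<^sub>R (\<Sum>l<Suc n. \<Sum>i<k. c i *\<^sub>R e (i + l))"
        by (subst sum.swap) (simp add: A_def scaleR_sum_right scaleR_left_commute mult.commute del: sum.lessThan_Suc)
      then have "norm (\<Sum>i<k. c i *\<^sub>R A i n) = 1 / real (Suc n) * norm (\<Sum>l<Suc n. \<Sum>i<k. c i *\<^sub>R e (i + l))"
        by (simp only: norm_scaleR) simp
      also have "\<dots> \<le> 1 / real (Suc n) * (\<Sum>l<Suc n. norm (\<Sum>i<k. c i *\<^sub>R e i))"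
      proof (intro mult_left_mono sum_norm_le)
        show "norm (\<Sum>i<k. c i *\<^sub>R e (i + l)) \<le> norm (\<Sum>i<k. c i *\<^sub>R e i)" for l
          using spreading[of "\<lambda>i. i + l" c k] by (simp add: strict_mono_def)
      qed simp
      also have "\<dots> = norm (\<Sum>i<k. c i *\<^sub>R e i)" by (simp only: sum_constant card_lessThan) simp
      finally show ?thesis .
    qed
    then show "\<exists>N. \<forall>n\<ge>N. norm (\<Sum>i<k. c i *\<^sub>R A i n) \<le> norm (\<Sum>i<k. c i *\<^sub>R e i)" by blast
  qed
  then show ?thesis by (simp add: scaleR_sum_left[symmetric])
qed

lemma sum_coefficients_le_center:
  "\<bar>(\<Sum>i<k. c i) + b\<bar> * norm center \<le> norm ((\<Sum>i<k. c i *\<^sub>R e i) + b *\<^sub>R center)"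
proof (rule LIMSEQ_le_const[OF combination_tendsto])
  have "\<bar>(\<Sum>i<k. c i) + b\<bar> * norm center \<le> norm (\<Sum>i<Suc n. ((if i < k then c i else 0) + b / real (Suc n)) *\<^sub>R e i)"
    if "n \<ge> k" for n
    using sum_coefficients_le[of "\<lambda>i. (if i < k then c i else 0) + b / real (Suc n)" "Suc n"]
      sum_coefficients_plus_average[of k n c b] that
    by (simp del: sum.lessThan_Suc)
  then show "\<exists>N. \<forall>n\<ge>N. \<bar>(\<Sum>i<k. c i) + b\<bar> * norm center \<le>
      norm (\<Sum>i<Suc n. ((if i < k then c i else 0) + b / real (Suc n)) *\<^sub>R e i)" by blast
qed

text \<open>If the averages tend to \<open>0\<close> then \<open>e\<close> itself is equivalent to the unit vector basis of \<open>c\<^sub>0\<close>. Otherwise the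
functional \<open>\<Sum>i<k. c i\<close> is bounded, and the sequence \<open>center, e 0 - center, e 1 - center, \<dots>\<close> with the same closed
span is equivalent to that basis.\<close>

theorem closed_span_isomorphic_c0: "isomorphic_normed_subspaces (closure (span (range e))) c0"
proof (cases "center = 0")
  case True
  show ?thesis
  proof (rule c0_basis_span_isomorphic[where C=C and c="\<delta> / 2"])
    show "norm (\<Sum>i<k. a i *\<^sub>R e i) \<le> C * M" if "\<And>i. i < k \<Longrightarrow> \<bar>a i\<bar> \<le> M" "M \<ge> 0" for k a M
      using norm_centered_le[of k a M] that True by simp
    show "\<delta> / 2 * \<bar>a i\<bar> \<le> norm (\<Sum>i<k. a i *\<^sub>R e i)" if "i < k" for k a i
      using coefficient_le[OF that, of a] by (simp add: mult.commute)
  qed (use \<delta>_pos in simp)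
next
  case False
  define v where "v j = (case j of 0 \<Rightarrow> center | Suc i \<Rightarrow> e i - center)" for j
  have comb: "(\<Sum>i<Suc k. a i *\<^sub>R v i) = (\<Sum>i<k. a (Suc i) *\<^sub>R e i) + (a 0 - (\<Sum>i<k. a (Suc i))) *\<^sub>R center" for k a
    by (simp add: sum.lessThan_Suc_shift v_def scaleR_diff_right scaleR_diff_left sum_subtractf scaleR_sum_left del: sum.lessThan_Suc)
  have "isomorphic_normed_subspaces (closure (span (range v))) c0"
  proof (rule c0_basis_span_isomorphic[where C="norm center + C" and c="min (\<delta> / 2) (norm center)"])
    fix k :: nat and a :: "nat \<Rightarrow> real" and M :: real
    assume a: "\<And>i. i < k \<Longrightarrow> \<bar>a i\<bar> \<le> M" and M: "M \<ge> 0"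
    show "norm (\<Sum>i<k. a i *\<^sub>R v i) \<le> (norm center + C) * M"
    proof (cases k)
      case 0
      then show ?thesis using M C_nonneg by simp
    next
      case (Suc l)
      have "(\<Sum>i<k. a i *\<^sub>R v i) = a 0 *\<^sub>R center + ((\<Sum>i<l. a (Suc i) *\<^sub>R e i) - (\<Sum>i<l. a (Suc i)) *\<^sub>R center)"
        unfolding Suc comb by (simp add: algebra_simps)
      also have "norm \<dots> \<le> \<bar>a 0\<bar> * norm center + C * M"
        by (rule order_trans[OF norm_triangle_ineq add_mono])
          (use norm_centered_le[of l "\<lambda>i. a (Suc i)" M] a M Suc in auto)
      also have "\<dots> \<le> M * norm center + C * M"
        using a[of 0] Suc by (intro add_right_mono mult_right_mono) auto
      finally show ?thesis by (simp add: algebra_simps)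
    qed
  next
    fix k i :: nat and a :: "nat \<Rightarrow> real"
    assume i: "i < k"
    then obtain l where k: "k = Suc l" by (cases k) auto
    show "min (\<delta> / 2) (norm center) * \<bar>a i\<bar> \<le> norm (\<Sum>i<k. a i *\<^sub>R v i)"
    proof (cases i)
      case 0
      have "min (\<delta> / 2) (norm center) * \<bar>a i\<bar> \<le> norm center * \<bar>a 0\<bar>"
        unfolding 0 by (intro mult_right_mono) auto
      also have "\<dots> \<le> norm (\<Sum>i<k. a i *\<^sub>R v i)"
        using sum_coefficients_le_center[of "\<lambda>i. a (Suc i)" l "a 0 - (\<Sum>i<l. a (Suc i))"]
        unfolding k comb by (simp add: mult.commute)
      finally show ?thesis .
    next
      case (Suc j)
      have "min (\<delta> / 2) (norm center) * \<bar>a i\<bar> \<le> \<delta> / 2 * \<bar>a (Suc j)\<bar>"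
        unfolding Suc by (intro mult_right_mono) auto
      also have "\<dots> \<le> norm (\<Sum>i<k. a i *\<^sub>R v i)"
        using coefficient_le_center[of j l "\<lambda>i. a (Suc i)" "a 0 - (\<Sum>i<l. a (Suc i))"] i Suc
        unfolding k comb by (simp add: mult.commute)
      finally show ?thesis .
    qed
  qed (use \<delta>_pos False in simp)
  moreover have "closure (span (range v)) = closure (span (range e))"
  proof
    have avg: "average n \<in> span (range e)" for n
      unfolding average_def by (intro span_scale span_sum span_base) auto
    then have center: "center \<in> closure (span (range e))"
      using average_tendsto unfolding closure_sequential by blast
    have sub: "subspace (closure (span (range e)))" by (intro subspace_closure subspace_span)
    have "range v \<subseteq> closure (span (range e))"
    proof clarify
      fix j
      have "e i \<in> closure (span (range e))" for i
        by (rule subsetD[OF closure_subset]) (simp add: span_base)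
      then show "v j \<in> closure (span (range e))"
        using center sub by (auto simp: v_def subspace_diff split: nat.split)
    qed
    then have "span (range v) \<subseteq> closure (span (range e))" using sub by (rule span_minimal)
    then show "closure (span (range v)) \<subseteq> closure (span (range e))"
      using closed_closure by (rule closure_minimal)
    have "e i \<in> span (range v)" for i
    proof -
      have "e i = v (Suc i) + v 0" by (simp add: v_def)
      moreover have "v (Suc i) + v 0 \<in> span (range v)" by (intro span_add span_base rangeI)
      ultimately show ?thesis by (simp only:)
    qed
    then have "range e \<subseteq> span (range v)" by blast
    then have "span (range e) \<subseteq> span (range v)" using subspace_span by (rule span_minimal)
    then show "closure (span (range e)) \<subseteq> closure (span (range v))" by (rule closure_mono)
  qed
  ultimately show ?thesis by simp
qed

end

section \<open>Spreading models of spaces with bounded concentration\<close>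

lemma asymptotic_normD:
  assumes "asymptotic_norm y N" "\<epsilon> > 0"
  shows "\<exists>r. \<forall>n. strict_mono_on {..<length a} n \<and> (\<forall>i<length a. r \<le> n i) \<longrightarrow>
      \<bar>norm (\<Sum>i<length a. (a ! i) *\<^sub>R y (n i)) - N a\<bar> < \<epsilon>"
  using assms unfolding asymptotic_norm_def by blast

lemma asymptotic_norm_limit:
  assumes N: "asymptotic_norm y N" and e: "\<And>a. norm (\<Sum>i<length a. (a ! i) *\<^sub>R e i) = N a"
    and n: "\<And>r. strict_mono (n r)" "\<And>r i. r \<le> n r i"
  shows "(\<lambda>r. norm (\<Sum>i<k. c i *\<^sub>R y (n r i))) \<longlonglongrightarrow> norm (\<Sum>i<k. c i *\<^sub>R e i)"
proof (rule metric_LIMSEQ_I)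
  fix \<epsilon> :: real assume "\<epsilon> > 0"
  define a where "a = map c [0..<k]"
  have a: "length a = k" "\<And>i. i < k \<Longrightarrow> a ! i = c i" by (simp_all add: a_def)
  obtain r0 where "\<forall>m. strict_mono_on {..<length a} m \<and> (\<forall>i<length a. r0 \<le> m i) \<longrightarrow>
      \<bar>norm (\<Sum>i<length a. (a ! i) *\<^sub>R y (m i)) - N a\<bar> < \<epsilon>"
    using asymptotic_normD[OF N \<open>\<epsilon> > 0\<close>] by blast
  then have r0: "\<bar>norm (\<Sum>i<k. (a ! i) *\<^sub>R y (m i)) - N a\<bar> < \<epsilon>"
    if "strict_mono_on {..<k} m" "\<And>i. i < k \<Longrightarrow> r0 \<le> m i" for m
    using that a(1) by simp
  have Na: "N a = norm (\<Sum>i<k. c i *\<^sub>R e i)" using e[of a] a by simp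
  have "dist (norm (\<Sum>i<k. c i *\<^sub>R y (n r i))) (norm (\<Sum>i<k. c i *\<^sub>R e i)) < \<epsilon>" if "r \<ge> r0" for r
  proof -
    have "strict_mono_on {..<k} (n r)" using n(1)[of r] by (simp add: strict_mono_on_def strict_mono_def)
    moreover have "r0 \<le> n r i" for i using n(2)[of r i] that by simp
    ultimately show ?thesis using r0[of "n r"] a(2) by (simp add: dist_real_def Na)
  qed
  then show "\<exists>r0. \<forall>r\<ge>r0. dist (norm (\<Sum>i<k. c i *\<^sub>R y (n r i))) (norm (\<Sum>i<k. c i *\<^sub>R e i)) < \<epsilon>" by blast
qed

text \<open>A combination along a subsequence is a combination of an initial segment with some coefficients
equal to \<open>0\<close>; in this form the defining limit of the spreading model applies to it.\<close>

lemma sum_strict_mono_reindex: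
  fixes z :: "nat \<Rightarrow> 'b::real_vector" and c :: "nat \<Rightarrow> real" and k :: nat
  assumes p: "strict_mono p"
  defines "d \<equiv> \<lambda>j. \<Sum>i<k. if p i = j then c i else 0"
  shows "(\<Sum>j<p k. d j *\<^sub>R z j) = (\<Sum>i<k. c i *\<^sub>R z (p i))"
proof -
  have "(\<Sum>j<p k. d j *\<^sub>R z j) = (\<Sum>i<k. \<Sum>j<p k. (if p i = j then c i else 0) *\<^sub>R z j)"
    unfolding d_def scaleR_sum_left by (rule sum.swap)
  also have "\<dots> = (\<Sum>i<k. c i *\<^sub>R z (p i))"
  proof (rule sum.cong[OF refl])
    fix i assume "i \<in> {..<k}"
    then have "p i < p k" using p by (simp add: strict_mono_less)
    have "(\<Sum>j<p k. (if p i = j then c i else 0) *\<^sub>R z j) = (\<Sum>j<p k. if j = p i then c i *\<^sub>R z j else 0)"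
      by (rule sum.cong) auto
    then show "(\<Sum>j<p k. (if p i = j then c i else 0) *\<^sub>R z j) = c i *\<^sub>R z (p i)"
      using \<open>p i < p k\<close> by simp
  qed
  finally show ?thesis .
qed

text \<open>Spreading invariance holds because both norms are limits of the same norms in the space. The block
estimate is read off along the infinite set provided by concentration. If the first two basis vectors
coincided, the generating sequence would have a convergent subsequence.\<close>

theorem bounded_concentration_imp_spreading_models_c0:
  fixes T :: "'a::banach itself" and E :: "'e::banach set"
  assumes bc: "bounded_concentration T" and E: "spreading_model_of TYPE('a) E"
  shows "isomorphic_normed_subspaces E c0"
proof -
  obtain x :: "nat \<Rightarrow> 'a" where x: "bounded (range x)"
    and nconv: "\<not> (\<exists>\<sigma>. strict_mono \<sigma> \<and> convergent (x \<circ> \<sigma>))"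
    and "spreading_model_generated_by x E"
    using E unfolding spreading_model_of_def by blast
  then obtain \<rho> N where \<rho>: "strict_mono \<rho>" and N: "asymptotic_norm (x \<circ> \<rho>) N"
    and comp: "finite_sequence_completion N E"
    unfolding spreading_model_generated_by_def by blast
  obtain e :: "nat \<Rightarrow> 'e" where e: "\<And>a. norm (\<Sum>i<length a. (a ! i) *\<^sub>R e i) = N a"
    and EE: "E = closure (span (range e))"
    using comp unfolding finite_sequence_completion_def by blast
  define y where "y = x \<circ> \<rho>"
  obtain R where R: "\<And>n. norm (y n) \<le> R" using x unfolding bounded_iff y_def by auto
  note lim = asymptotic_norm_limit[OF N e, folded y_def]
  have "bounded_concentration TYPE('a)" using bc by (simp add: bounded_concentration_def)
  from bounded_concentration_linear[OF this] obtain C where C: "\<And>k (c :: nat \<Rightarrow> real) (x :: nat \<Rightarrow> 'a) R.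
      (\<forall>i. \<bar>c i\<bar> \<le> 1) \<and> (\<forall>n. norm (x n) \<le> R) \<Longrightarrow>
      \<exists>\<sigma>. strict_mono \<sigma> \<and> (\<forall>p q :: nat \<Rightarrow> nat. strict_mono p \<and> strict_mono q \<longrightarrow>
         norm (\<Sum>i<k. c i *\<^sub>R (x (\<sigma> (p i)) - x (\<sigma> (q i)))) \<le> C * R)"
    by blast
  have "block_bounded_spreading_sequence e (C * R)"
  proof
    fix p :: "nat \<Rightarrow> nat" and k :: nat and c :: "nat \<Rightarrow> real" assume p: "strict_mono p"
    define d where "d j = (\<Sum>i<k. if p i = j then c i else 0)" for j
    have d: "(\<Sum>j<p k. d j *\<^sub>R z j) = (\<Sum>i<k. c i *\<^sub>R z (p i))" for z :: "nat \<Rightarrow> 'b::real_vector"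
      unfolding d_def by (rule sum_strict_mono_reindex[OF p])
    have "(\<lambda>r. norm (\<Sum>j<p k. d j *\<^sub>R y (r + j))) \<longlonglongrightarrow> norm (\<Sum>j<p k. d j *\<^sub>R e j)"
      by (rule lim) (auto simp: strict_mono_def)
    then have "(\<lambda>r. norm (\<Sum>i<k. c i *\<^sub>R y (r + p i))) \<longlonglongrightarrow> norm (\<Sum>i<k. c i *\<^sub>R e (p i))"
      unfolding d .
    moreover have "(\<lambda>r. norm (\<Sum>i<k. c i *\<^sub>R y (r + p i))) \<longlonglongrightarrow> norm (\<Sum>i<k. c i *\<^sub>R e i)"
      by (rule lim) (use p in \<open>auto simp: strict_mono_def\<close>)
    ultimately show "norm (\<Sum>i<k. c i *\<^sub>R e (p i)) = norm (\<Sum>i<k. c i *\<^sub>R e i)"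
      by (rule LIMSEQ_unique)
  next
    fix c :: "nat \<Rightarrow> real" and k :: nat assume c: "\<And>i. \<bar>c i\<bar> \<le> 1"
    obtain \<sigma> where \<sigma>: "strict_mono \<sigma>" and le: "\<And>p q :: nat \<Rightarrow> nat. strict_mono p \<Longrightarrow> strict_mono q \<Longrightarrow>
         norm (\<Sum>i<k. c i *\<^sub>R (y (\<sigma> (p i)) - y (\<sigma> (q i)))) \<le> C * R"
      using C[of c y R k] c R by auto
    define d where "d j = (if j < k then c j else - c (j - k))" for j
    have d: "(\<Sum>i<k + k. d i *\<^sub>R z i) = (\<Sum>i<k. c i *\<^sub>R (z i - z (k + i)))" for z :: "nat \<Rightarrow> 'b::real_vector"
      by (simp add: sum_lessThan_add d_def sum_negf scaleR_diff_right sum_subtractf)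
    have "(\<lambda>r. norm (\<Sum>i<k + k. d i *\<^sub>R y (\<sigma> (r + i)))) \<longlonglongrightarrow> norm (\<Sum>i<k + k. d i *\<^sub>R e i)"
    proof (rule lim)
      show "strict_mono (\<lambda>i. \<sigma> (r + i))" for r using \<sigma> by (simp add: strict_mono_def)
      show "r \<le> \<sigma> (r + i)" for r i
        using seq_suble[OF \<sigma>, of "r + i"] by simp
    qed
    then have "(\<lambda>r. norm (\<Sum>i<k. c i *\<^sub>R (y (\<sigma> (r + i)) - y (\<sigma> (r + (k + i)))))) \<longlonglongrightarrow> norm (\<Sum>i<k. c i *\<^sub>R (e i - e (k + i)))"
      unfolding d .
    then show "norm (\<Sum>i<k. c i *\<^sub>R (e i - e (k + i))) \<le> C * R"
    proof (rule LIMSEQ_le_const2)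
      have "norm (\<Sum>i<k. c i *\<^sub>R (y (\<sigma> (r + i)) - y (\<sigma> (r + (k + i))))) \<le> C * R" for r
        by (rule le[of "\<lambda>i. r + i" "\<lambda>i. r + (k + i)"]) (auto simp: strict_mono_def)
      then show "\<exists>M. \<forall>r\<ge>M. norm (\<Sum>i<k. c i *\<^sub>R (y (\<sigma> (r + i)) - y (\<sigma> (r + (k + i))))) \<le> C * R" by blast
    qed
  next
    show "e 0 \<noteq> e 1"
    proof
      assume eq: "e 0 = e 1"
      have N0: "N [1, - 1] = 0" using e[of "[1, - 1]"] eq by (simp add: lessThan_Suc)
      have "Cauchy y"
        unfolding Cauchy_iff
      proof (intro allI impI)
        fix \<epsilon> :: real assume "\<epsilon> > 0"
        define a :: "real list" where "a = [1, - 1]"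
        obtain r where r: "\<And>n. strict_mono_on {..<length a} n \<and> (\<forall>i<length a. r \<le> n i) \<longrightarrow>
            \<bar>norm (\<Sum>i<length a. (a ! i) *\<^sub>R y (n i)) - N a\<bar> < \<epsilon>"
          using asymptotic_normD[OF N[folded y_def] \<open>\<epsilon> > 0\<close>] by blast
        have lt: "norm (y m - y n) < \<epsilon>" if "r \<le> m" "m < n" for m n
        proof -
          have "strict_mono_on {..<length a} (\<lambda>i. if i = 0 then m else n)"
            using that by (auto simp: strict_mono_on_def a_def)
          then show ?thesis
            using r[of "\<lambda>i. if i = 0 then m else n"] that by (simp add: lessThan_Suc N0 a_def)
        qed
        have "norm (y m - y n) < \<epsilon>" if "r \<le> m" "r \<le> n" for m n
          using lt[of m n] lt[of n m] that \<open>\<epsilon> > 0\<close> by (cases m n rule: linorder_cases) (auto simp: norm_minus_commute)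
        then show "\<exists>M. \<forall>m\<ge>M. \<forall>n\<ge>M. norm (y m - y n) < \<epsilon>" by blast
      qed
      then have "convergent y" by (rule Cauchy_convergent)
      then show False using nconv \<rho> unfolding y_def by blast
    qed
  qed
  then show ?thesis
    unfolding EE by (rule block_bounded_spreading_sequence.closed_span_isomorphic_c0)
qed

theorem theoremA:
  assumes "infinite_dimensional TYPE('a::banach)"
    and "(\<exists>f::'a \<Rightarrow> tsirelson_dual. coarse_embedding_on UNIV f) \<or>
         (\<exists>f::'a \<Rightarrow> tsirelson_dual. uniform_embedding_on (cball 0 1) f)"
  shows "reflexive_space TYPE('a) \<and>
         (\<forall>E::'e::banach set. spreading_model_of TYPE('a) E \<longrightarrow> isomorphic_normed_subspaces E c0)"
proof -
  have "bounded_concentration TYPE('a)"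
    using assms(2) concentration_coarse concentration_uniform
    unfolding bounded_concentration_def by meson
  then show ?thesis
    using bounded_concentration_imp_reflexive bounded_concentration_imp_spreading_models_c0 by blast
qed

end
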